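(* Let $(\Omega,d,\mu)$ be an $RD$-space, $X$ an r.i. space on $\Omega$ and $p\ge1$. If $0<\theta<1$, $E$ is a parameter and $b\in SV$, then $$\mathring{B}_{X^{(p)},E}^{\theta,b}=(X^{(p)},\mathring{M}^{1,X^{(p)}})_{\theta,b,E}$$ and $$B_{X^{(p)},E}^{\theta,b}=(X^{(p)},M^{1,X^{(p)}})_{\theta,b,E},$$ with equivalent norms.
   Context: Metric measure space: $(\Omega,d)$ is a metric space with a Borel measure $\mu$ (induced by a Borel regular outer measure) such that $0<\mu(B)<\infty$ for every ball $B$ and $\mu(\{x\})=0$ for all $x\in\Omega$; $B(x,r)=\{y:d(x,y)<r\}$. It is an $RD$-space with indices $(k,n)$, $0<k\le n$, if there are constants $0<C_1\le 1\le C_2$ with $C_1\lambda^k\mu(B(x,r))\le\mu(B(x,\lambda r))\le C_2\lambda^n\mu(B(x,r))$ for all $x\in\Omega$, $r>0$, $\lambda\ge1$. R.i. space: a Banach function space $X$ on $(\Omega,\mu)$ with the Fatou property such that, if $g\in X$ and $f^*\le g^*$ a.e., then $f\in X$ and $\|f\|_X\le\|g\|_X$; here $f^*(s)=\inf\{t\ge0:\mu\{|f|>t\}\le s\}$ is the decreasing rearrangement. For $1\le p<\infty$, $X^{(p)}=\{f:|f|^p\in X\}$ with $\|f\|_{X^{(p)}}=\||f|^p\|_X^{1/p}$. Parameter: an r.i. space $E$ on $(0,\infty)$ with Lebesgue measure. One assumes $E=\mathcal F(L^1,L^\infty)$ for an exact interpolation functor $\mathcal F$, and puts $\tilde E:=\mathcal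 F(\tilde L^1,L^\infty)$ where $\|g\|_{\tilde L^1}=\int_0^\infty|g(t)|\frac{dt}{t}$; $\tilde E$ is an r.i. space with respect to $dt/t$, and concretely $\|g\|_{\tilde E(0,1)}=\|g(e^{-u})\|_{E(0,\infty)}$, $\|g\|_{\tilde E(1,\infty)}=\|g(e^{u})\|_{E(0,\infty)}$, $\|g\|_{\tilde E}\simeq\|g\|_{\tilde E(0,1)}+\|g\|_{\tilde E(1,\infty)}$, where $\|g\|_{\tilde E(I)}=\|g\chi_I\|_{\tilde E}$. $b\in SV$ (slowly varying): $b$ is a positive Lebesgue measurable function on $(0,\infty)$ such that for every $\varepsilon>0$, $t^\varepsilon b(t)$ is equivalent (up to multiplicative constants) to an increasing function and $t^{-\varepsilon}b(t)$ to a decreasing function on $(0,\infty)$. Besov spaces: $E_X(f,t)=\left\|x\mapsto\frac1{\mu(B(x,t))}\int_{B(x,t)}|f(x)-f(y)|\,d\mu(y)\right\|_X$. $\mathring B^{\theta,b}_{X,E}$ is the set of $f\in L^1+L^\infty$ with $\|f\|_{\mathring B^{\theta,b}_{X,E}}=\|t^{-\theta}b(t)E_X(f,t)\|_{\tilde E}<\infty$, and $B^{\theta,b}_{X,E}=\mathring B^{\theta,b}_{X,E}\cap X$ with $\|f\|_{B^{\theta,b}_{X,E}}=\|t^{-\theta}b(t)E_X(f,t)\|_{\tilde E(0,1)}+\|f\|_X$. Hajłasz–Sobolev spaces: a $1$-gradient of a measurable $f$ is a measurable $g\ge0$ with $|f(x)-f(y)|\le d(x,y)(g(x)+g(y))$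 for $\mu$-a.e. $x,y\in\Omega$; $D(f)$ is the set of all $1$-gradients of $f$. $\mathring M^{1,X}$ is the set of $f\in L^1+L^\infty$ with $\|f\|_{\mathring M^{1,X}}=\inf_{g\in D(f)}\|g\|_X<\infty$; $M^{1,X}=\mathring M^{1,X}\cap X$ with $\|f\|_{M^{1,X}}=\|f\|_X+\|f\|_{\mathring M^{1,X}}$. Interpolation: for a compatible couple $(X_0,X_1)$ of (quasi-semi)normed spaces, $K(f,t;X_0,X_1)=\inf_{f=f_0+f_1}\{\|f_0\|_{X_0}+t\|f_1\|_{X_1}\}$, and $(X_0,X_1)_{\theta,b,E}$ is the set of $f\in X_0+X_1$ with $\|f\|_{(X_0,X_1)_{\theta,b,E}}=\|t^{-\theta}b(t)K(f,t;X_0,X_1)\|_{\tilde E}<\infty$. *)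

theory Defs
  imports "HOL-Probability.Essential_Supremum"
begin

section \<open>Extended norms\<close>

text \<open>
  A function space is given by an extended (semi)norm on all real functions, with value
  \<open>\<infinity>\<close> outside the space.
\<close>

type_synonym 'a fnorm = "('a \<Rightarrow> real) \<Rightarrow> ennreal"

definition fspace :: "'a fnorm \<Rightarrow> ('a \<Rightarrow> real) set" where
  "fspace N = {f. N f < \<infinity>}"

definition sum_space :: "'a fnorm \<Rightarrow> 'a fnorm \<Rightarrow> ('a \<Rightarrow> real) set" where
  "sum_space N0 N1 = {f. \<exists>f0\<in>fspace N0. \<exists>f1\<in>fspace N1. f = (\<lambda>x. f0 x + f1 x)}"

definition same_space_equiv_norms :: "'a fnorm \<Rightarrow> 'a fnorm \<Rightarrow> bool" where
  "same_space_equiv_norms N N' \<longleftrightarrow>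
     fspace N = fspace N' \<and>
     (\<exists>c>0::real. \<exists>C>0::real. \<forall>f\<in>fspace N.
        ennreal c * N' f \<le> N f \<and> N f \<le> ennreal C * N' f)"

definition K_functional :: "'a fnorm \<Rightarrow> 'a fnorm \<Rightarrow> ('a \<Rightarrow> real) \<Rightarrow> real \<Rightarrow> ennreal" where
  "K_functional N0 N1 f t = (INF f0. N0 f0 + ennreal t * N1 (\<lambda>x. f x - f0 x))"

section \<open>Metric measure spaces\<close>

text \<open>
  The last clause is Borel regularity. It allows \<open>M\<close> to be either the restriction of a
  Borel regular outer measure to the Borel sets or its restriction to all
  Caratheodory-measurable sets.
\<close>

definition metric_measure_space :: "'a::metric_space measure \<Rightarrow> bool" where
  "metric_measure_space M \<longleftrightarrow>
     space M = UNIV \<and> sets borel \<subseteq> sets M \<and>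
     (\<forall>x. \<forall>r>0. 0 < emeasure M (ball x r) \<and> emeasure M (ball x r) < \<infinity>) \<and>
     (\<forall>x. emeasure M {x} = 0) \<and>
     (\<forall>A\<in>sets M. \<exists>B\<in>sets borel. A \<subseteq> B \<and> emeasure M B = emeasure M A)"

definition RD_space_indices :: "'a::metric_space measure \<Rightarrow> real \<Rightarrow> real \<Rightarrow> bool" where
  "RD_space_indices M k n \<longleftrightarrow>
     metric_measure_space M \<and> 0 < k \<and> k \<le> n \<and>
     (\<exists>C1 C2::real. 0 < C1 \<and> C1 \<le> 1 \<and> 1 \<le> C2 \<and>
        (\<forall>x. \<forall>r>0. \<forall>l\<ge>1.
           ennreal (C1 * l powr k) * emeasure M (ball x r) \<le> emeasure M (ball x (l * r)) \<and>
           emeasure M (ball x (l * r)) \<le> ennreal (C2 * l powr n) * emeasure M (ball x r)))"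

definition RD_space :: "'a::metric_space measure \<Rightarrow> bool" where
  "RD_space M \<longleftrightarrow> (\<exists>k n. RD_space_indices M k n)"

section \<open>Rearrangement invariant spaces\<close>

text \<open>
  A Banach function norm in the sense of Bennett and Sharpley acts on the cone of measurable
  \<open>[0,\<infinity>]\<close>-valued functions; its values on non-measurable functions are irrelevant.
  The fourth clause is the Fatou property.
\<close>

definition banach_function_norm :: "'a measure \<Rightarrow> (('a \<Rightarrow> ennreal) \<Rightarrow> ennreal) \<Rightarrow> bool" where
  "banach_function_norm M \<rho> \<longleftrightarrow>
     (\<forall>f\<in>borel_measurable M. \<rho> f = 0 \<longleftrightarrow> (AE x in M. f x = 0)) \<and>
     (\<forall>f\<in>borel_measurable M. \<forall>a\<ge>0::real. \<rho> (\<lambda>x. ennreal a * f x) = ennreal a * \<rho> f) \<and>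
     (\<forall>f\<in>borel_measurable M. \<forall>g\<in>borel_measurable M.
        \<rho> (\<lambda>x. f x + g x) \<le> \<rho> f + \<rho> g \<and> ((AE x in M. f x \<le> g x) \<longrightarrow> \<rho> f \<le> \<rho> g)) \<and>
     (\<forall>u. \<forall>f\<in>borel_measurable M. (\<forall>i::nat. u i \<in> borel_measurable M) \<longrightarrow>
        (AE x in M. incseq (\<lambda>i. u i x) \<and> f x = (SUP i. u i x)) \<longrightarrow> \<rho> f = (SUP i. \<rho> (u i))) \<and>
     (\<forall>A\<in>sets M. emeasure M A < \<infinity> \<longrightarrow> \<rho> (indicator A) < \<infinity>) \<and>
     (\<forall>A\<in>sets M. emeasure M A < \<infinity> \<longrightarrow>
        (\<exists>C>0::real. \<forall>f\<in>borel_measurable M. (\<integral>\<^sup>+x\<in>A. f x \<partial>M) \<le> ennreal C * \<rho> f))"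

definition decr_rearrangement :: "'a measure \<Rightarrow> ('a \<Rightarrow> ennreal) \<Rightarrow> real \<Rightarrow> ennreal" where
  "decr_rearrangement M f s = Inf {t. emeasure M {x \<in> space M. t < f x} \<le> ennreal s}"

definition half_line :: "real measure" where
  "half_line = lebesgue_on {0<..}"

definition ri_space :: "'a measure \<Rightarrow> (('a \<Rightarrow> ennreal) \<Rightarrow> ennreal) \<Rightarrow> bool" where
  "ri_space M \<rho> \<longleftrightarrow>
     banach_function_norm M \<rho> \<and>
     (\<forall>f\<in>borel_measurable M. \<forall>g\<in>borel_measurable M.
        \<rho> g < \<infinity> \<longrightarrow>
        (AE s in half_line. decr_rearrangement M f s \<le> decr_rearrangement M g s) \<longrightarrow>
        \<rho> f \<le> \<rho> g)"

definition space_norm :: "'a measure \<Rightarrow> (('a \<Rightarrow> ennreal) \<Rightarrow> ennreal) \<Rightarrow> 'a fnorm" where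
  "space_norm M \<rho> f =
     (if f \<in> borel_measurable M then \<rho> (\<lambda>x. ennreal \<bar>f x\<bar>) else \<infinity>)"

definition epowr :: "ennreal \<Rightarrow> real \<Rightarrow> ennreal" where
  "epowr x p = (if x = \<infinity> then \<infinity> else ennreal (enn2real x powr p))"

definition convexification ::
  "real \<Rightarrow> (('a \<Rightarrow> ennreal) \<Rightarrow> ennreal) \<Rightarrow> ('a \<Rightarrow> ennreal) \<Rightarrow> ennreal" where
  "convexification p \<rho> f = epowr (\<rho> (\<lambda>x. epowr (f x) p)) (1 / p)"

definition L1_norm :: "'a measure \<Rightarrow> 'a fnorm" where
  "L1_norm M = space_norm M (\<lambda>f. \<integral>\<^sup>+x. f x \<partial>M)"

definition Linf_norm :: "'a measure \<Rightarrow> 'a fnorm" where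
  "Linf_norm M = space_norm M (esssup M)"

definition L1_plus_Linf :: "'a measure \<Rightarrow> ('a \<Rightarrow> real) set" where
  "L1_plus_Linf M = sum_space (L1_norm M) (Linf_norm M)"

section \<open>Exact interpolation functors and the parameter\<close>

definition complete_seminorm :: "'a fnorm \<Rightarrow> bool" where
  "complete_seminorm N \<longleftrightarrow>
     N (\<lambda>x. 0) = 0 \<and>
     (\<forall>f. \<forall>a. a \<noteq> 0 \<longrightarrow> N (\<lambda>x. a * f x) = ennreal \<bar>a\<bar> * N f) \<and>
     (\<forall>f g. N (\<lambda>x. f x + g x) \<le> N f + N g) \<and>
     (\<forall>u::nat \<Rightarrow> 'a \<Rightarrow> real.
        (\<forall>i. N (u i) < \<infinity>) \<and>
        (\<forall>e>0. \<exists>i0. \<forall>i\<ge>i0. \<forall>j\<ge>i0. N (\<lambda>x. u i x - u j x) < e) \<longrightarrow>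
        (\<exists>f. N f < \<infinity> \<and> (\<lambda>i. N (\<lambda>x. u i x - f x)) \<longlonglongrightarrow> 0))"

text \<open>
  Functions are not identified almost everywhere, so Banach spaces appear as complete seminormed
  spaces. The last clause says that the kernels of \<open>N0\<close>, \<open>N1\<close> and of
  the norm of the sum space coincide: after dividing by this common kernel, this is the
  Hausdorff condition of a compatible couple of Banach spaces.
\<close>

definition banach_couple :: "'a fnorm \<Rightarrow> 'a fnorm \<Rightarrow> bool" where
  "banach_couple N0 N1 \<longleftrightarrow>
     complete_seminorm N0 \<and> complete_seminorm N1 \<and>
     (\<forall>f. K_functional N0 N1 f 1 = 0 \<longrightarrow> N0 f = 0 \<and> N1 f = 0)"

definition linear_on_space :: "('a \<Rightarrow> real) set \<Rightarrow> (('a \<Rightarrow> real) \<Rightarrow> ('a \<Rightarrow> real)) \<Rightarrow> bool" where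
  "linear_on_space S T \<longleftrightarrow>
     (\<forall>f\<in>S. \<forall>g\<in>S. \<forall>a b. T (\<lambda>x. a * f x + b * g x) = (\<lambda>x. a * T f x + b * T g x))"

text \<open>
  The functor is considered on couples of spaces of real functions on one fixed set. The first
  part says that \<open>F A0 A1\<close> is a Banach space lying continuously between the
  intersection and the sum of the couple, the second that the norm of an operator on the
  interpolated spaces is at most the maximum of its norms on the end point spaces.
\<close>

definition exact_interpolation_functor :: "('a fnorm \<Rightarrow> 'a fnorm \<Rightarrow> 'a fnorm) \<Rightarrow> bool" where
  "exact_interpolation_functor F \<longleftrightarrow>
     (\<forall>A0 A1. banach_couple A0 A1 \<longrightarrow>
        complete_seminorm (F A0 A1) \<and>
        (\<exists>C>0::real. \<forall>f. F A0 A1 f \<le> ennreal C * max (A0 f) (A1 f) \<and>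
                          K_functional A0 A1 f 1 \<le> ennreal C * F A0 A1 f)) \<and>
     (\<forall>A0 A1 B0 B1 T. \<forall>c>0::real.
        banach_couple A0 A1 \<and> banach_couple B0 B1 \<and>
        linear_on_space (sum_space A0 A1) T \<and>
        (\<forall>f\<in>fspace A0. B0 (T f) \<le> ennreal c * A0 f) \<and>
        (\<forall>f\<in>fspace A1. B1 (T f) \<le> ennreal c * A1 f) \<longrightarrow>
        (\<forall>f\<in>fspace (F A0 A1). F B0 B1 (T f) \<le> ennreal c * F A0 A1 f))"

definition interpolation_parameter ::
  "(real fnorm \<Rightarrow> real fnorm \<Rightarrow> real fnorm) \<Rightarrow> ((real \<Rightarrow> ennreal) \<Rightarrow> ennreal) \<Rightarrow> bool" where
  "interpolation_parameter F E \<longleftrightarrow>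
     ri_space half_line E \<and> exact_interpolation_functor F \<and>
     F (L1_norm half_line) (Linf_norm half_line) = space_norm half_line E"

definition L1_tilde_norm :: "real fnorm" where
  "L1_tilde_norm = space_norm half_line (\<lambda>f. \<integral>\<^sup>+t. f t * ennreal (1 / t) \<partial>half_line)"

text \<open>
  The norm of the tilde space of the parameter, for \<open>[0,\<infinity>]\<close>-valued functions; such
  a function belongs to the space only if it is finite almost everywhere.
\<close>

definition tilde_norm ::
  "(real fnorm \<Rightarrow> real fnorm \<Rightarrow> real fnorm) \<Rightarrow> (real \<Rightarrow> ennreal) \<Rightarrow> ennreal" where
  "tilde_norm F g =
     (if AE t in half_line. g t < \<infinity>
      then F L1_tilde_norm (Linf_norm half_line) (\<lambda>t. enn2real (g t)) else \<infinity>)"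

definition slowly_varying :: "(real \<Rightarrow> real) \<Rightarrow> bool" where
  "slowly_varying b \<longleftrightarrow>
     b \<in> borel_measurable half_line \<and> (\<forall>t>0. 0 < b t) \<and>
     (\<forall>e>0.
        (\<exists>\<phi> c C. 0 < c \<and> 0 < C \<and> mono_on {0<..} \<phi> \<and>
           (\<forall>t>0. c * \<phi> t \<le> t powr e * b t \<and> t powr e * b t \<le> C * \<phi> t)) \<and>
        (\<exists>\<phi> c C. 0 < c \<and> 0 < C \<and> antimono_on {0<..} \<phi> \<and>
           (\<forall>t>0. c * \<phi> t \<le> t powr (-e) * b t \<and> t powr (-e) * b t \<le> C * \<phi> t)))"

definition interp_norm ::
  "'a fnorm \<Rightarrow> 'a fnorm \<Rightarrow> real \<Rightarrow> (real \<Rightarrow> real) \<Rightarrow>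
   (real fnorm \<Rightarrow> real fnorm \<Rightarrow> real fnorm) \<Rightarrow> 'a fnorm" where
  "interp_norm N0 N1 \<theta> b F f =
     (if f \<in> sum_space N0 N1
      then tilde_norm F (\<lambda>t. ennreal (t powr (-\<theta>) * b t) * K_functional N0 N1 f t) else \<infinity>)"

section \<open>Besov and Hajlasz--Sobolev spaces\<close>

definition mean_oscillation :: "'a::metric_space measure \<Rightarrow> ('a \<Rightarrow> real) \<Rightarrow> real \<Rightarrow> 'a \<Rightarrow> ennreal" where
  "mean_oscillation M f t x =
     (\<integral>\<^sup>+y\<in>ball x t. ennreal \<bar>f x - f y\<bar> \<partial>M) / emeasure M (ball x t)"

definition oscillation_norm ::
  "'a::metric_space measure \<Rightarrow> (('a \<Rightarrow> ennreal) \<Rightarrow> ennreal) \<Rightarrow> ('a \<Rightarrow> real) \<Rightarrow> real \<Rightarrow> ennreal" where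
  "oscillation_norm M X f t = X (mean_oscillation M f t)"

definition hom_besov_norm ::
  "'a::metric_space measure \<Rightarrow> (('a \<Rightarrow> ennreal) \<Rightarrow> ennreal) \<Rightarrow>
   (real fnorm \<Rightarrow> real fnorm \<Rightarrow> real fnorm) \<Rightarrow> real \<Rightarrow> (real \<Rightarrow> real) \<Rightarrow> 'a fnorm" where
  "hom_besov_norm M X F \<theta> b f =
     (if f \<in> L1_plus_Linf M
      then tilde_norm F (\<lambda>t. ennreal (t powr (-\<theta>) * b t) * oscillation_norm M X f t) else \<infinity>)"

definition besov_norm ::
  "'a::metric_space measure \<Rightarrow> (('a \<Rightarrow> ennreal) \<Rightarrow> ennreal) \<Rightarrow>
   (real fnorm \<Rightarrow> real fnorm \<Rightarrow> real fnorm) \<Rightarrow> real \<Rightarrow> (real \<Rightarrow> real) \<Rightarrow> 'a fnorm" where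
  "besov_norm M X F \<theta> b f =
     (if f \<in> fspace (hom_besov_norm M X F \<theta> b) \<inter> fspace (space_norm M X)
      then tilde_norm F (\<lambda>t. indicator {0<..<1} t *
             (ennreal (t powr (-\<theta>) * b t) * oscillation_norm M X f t)) + space_norm M X f
      else \<infinity>)"

definition one_gradients :: "'a::metric_space measure \<Rightarrow> ('a \<Rightarrow> real) \<Rightarrow> ('a \<Rightarrow> real) set" where
  "one_gradients M f =
     {g \<in> borel_measurable M. (\<forall>x. 0 \<le> g x) \<and>
        (\<exists>N\<in>null_sets M. \<forall>x. \<forall>y. x \<notin> N \<longrightarrow> y \<notin> N \<longrightarrow>
           \<bar>f x - f y\<bar> \<le> dist x y * (g x + g y))}"

definition hom_sobolev_norm ::
  "'a::metric_space measure \<Rightarrow> (('a \<Rightarrow> ennreal) \<Rightarrow> ennreal) \<Rightarrow> 'a fnorm" where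
  "hom_sobolev_norm M X f =
     (if f \<in> L1_plus_Linf M then (INF g\<in>one_gradients M f. space_norm M X g) else \<infinity>)"

definition sobolev_norm ::
  "'a::metric_space measure \<Rightarrow> (('a \<Rightarrow> ennreal) \<Rightarrow> ennreal) \<Rightarrow> 'a fnorm" where
  "sobolev_norm M X f = space_norm M X f + hom_sobolev_norm M X f"

end

theory Submission
  imports Defs
begin

text \<open>
  The norm of the convexification is again rearrangement invariant, so one may work with a single
  r.i. space \<open>Y\<close>. The proof compares \<open>K(f,t)\<close> for the couple of \<open>Y\<close> and the homogeneous Sobolev space
  with the oscillation \<open>E(f,t)\<close>.

  For \<open>E(f,t) \<le> C K(f,t)\<close> one needs that averaging over balls of radius \<open>t\<close> is bounded
  on \<open>Y\<close> uniformly in \<open>t\<close>. Conversely, \<open>f\<close> is split by means of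
  \<open>f\<^sub>t(x) = \<integral> \<psi>(x,y) f(y) d\<mu>(y) / \<integral> \<psi>(x,y) d\<mu>(y)\<close> with \<open>\<psi>(x,y) = max 0 (t - d(x,y))\<close>:
  the difference \<open>f - f\<^sub>t\<close> is dominated by the mean oscillation at scale \<open>t\<close>, and the series of the mean
  oscillations at the scales \<open>2\<^sup>j t\<close>, weighted by \<open>2\<^sup>-\<^sup>j\<close>, is up to the factor \<open>C / t\<close> a gradient of \<open>f\<^sub>t\<close>.
  Hence \<open>K(f,t)\<close> is at most a constant times the integral of \<open>(t / s) E(f,s)\<close> with respect to
  \<open>ds / s\<close> over \<open>s > t\<close>, and the Hardy operator on the right is bounded in the weighted parameter space
  by interpolation between \<open>L\<^sup>1(dt / t)\<close> and \<open>L\<^sup>\<infinity>\<close>.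
\<close>

section \<open>Function norms and completeness\<close>

text \<open>Averages over balls are bounded on L^1 and on L^\<infinity>, but \<open>ri_space\<close>
  compares functions only through rearrangements, so these end point bounds do not pass to \<rho>
  directly. Instead the averages are dominated by limits of means of N functions, each with
  distribution function at most that of f; since points are null, cells can be cut into the nearly
  equal pieces this requires. On the half line the functor controls only linear operators, so even
  monotonicity of its norm has to come from an operator.

  The weight w(t) = t^(-\<theta>) b(t) enters through w(t) (t/s) \<le> C (t/s)^\<delta> w(s) for t <
  s, with \<delta> = (1 - \<theta>)/2: half of the gap 1 - \<theta> absorbs b, the other half keeps
  the Hardy kernel integrable. For the inhomogeneous couple only the scales s < 1 are kept; the rest
  of the Hardy integral costs at most C t \<open>Y f\<close>. The function min(1,t) w(t) lies in
  L^1(dt/t) and in L^\<infinity>, hence has a finite nonzero norm, and K(f,t) \<ge> min(1,t) K(f,1)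
  then recovers \<open>Y f\<close> from the weighted norm of K.\<close>

locale function_norm =
  fixes M :: "'a measure" and \<rho> :: "('a \<Rightarrow> ennreal) \<Rightarrow> ennreal"
  assumes zero_iff: "f \<in> borel_measurable M \<Longrightarrow> \<rho> f = 0 \<longleftrightarrow> (AE x in M. f x = 0)"
    and scale: "f \<in> borel_measurable M \<Longrightarrow> 0 \<le> a \<Longrightarrow>
      \<rho> (\<lambda>x. ennreal a * f x) = ennreal a * \<rho> f"
    and triangle: "f \<in> borel_measurable M \<Longrightarrow> g \<in> borel_measurable M \<Longrightarrow>
      \<rho> (\<lambda>x. f x + g x) \<le> \<rho> f + \<rho> g"
    and mono_AE: "f \<in> borel_measurable M \<Longrightarrow> g \<in> borel_measurable M \<Longrightarrow>
      (AE x in M. f x \<le> g x) \<Longrightarrow> \<rho> f \<le> \<rho> g"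
    and fatou: "(\<And>i::nat. u i \<in> borel_measurable M) \<Longrightarrow> incseq u \<Longrightarrow>
      \<rho> (\<lambda>x. SUP i. u i x) = (SUP i. \<rho> (u i))"
begin

lemma mono:
  assumes "f \<in> borel_measurable M" "g \<in> borel_measurable M"
    and "\<And>x. x \<in> space M \<Longrightarrow> f x \<le> g x"
  shows "\<rho> f \<le> \<rho> g"
  by (intro mono_AE assms AE_I2)

lemma zero [simp]: "\<rho> (\<lambda>x. 0) = 0"
  by (subst zero_iff) auto

lemma finite_sum:
  assumes "finite I" "\<And>i. i \<in> I \<Longrightarrow> f i \<in> borel_measurable M"
  shows "\<rho> (\<lambda>x. \<Sum>i\<in>I. f i x) \<le> (\<Sum>i\<in>I. \<rho> (f i))"
  using assms
proof (induction I rule: finite_induct)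
  case (insert i I)
  have "\<rho> (\<lambda>x. f i x + (\<Sum>i\<in>I. f i x)) \<le> \<rho> (f i) + \<rho> (\<lambda>x. \<Sum>i\<in>I. f i x)"
    using insert.prems by (intro triangle borel_measurable_sum) auto
  also have "\<dots> \<le> \<rho> (f i) + (\<Sum>i\<in>I. \<rho> (f i))"
    using insert by (intro add_left_mono) auto
  finally show ?case using insert by simp
qed simp

text \<open>The Fatou property extends the triangle inequality from partial sums to the series. This
  drives both the completeness proof and the bound for the gradient of the smoothed
  function.\<close>

lemma norm_suminf_le:
  fixes f :: "nat \<Rightarrow> 'a \<Rightarrow> ennreal"
  assumes [measurable]: "\<And>i. f i \<in> borel_measurable M"
  shows "\<rho> (\<lambda>x. \<Sum>i. f i x) \<le> (\<Sum>i. \<rho> (f i))"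
proof -
  have "\<rho> (\<lambda>x. \<Sum>i. f i x) = \<rho> (\<lambda>x. SUP n. \<Sum>i<n. f i x)"
    by (simp add: suminf_eq_SUP)
  also have "\<dots> = (SUP n. \<rho> (\<lambda>x. \<Sum>i<n. f i x))"
    by (rule fatou) (auto simp: incseq_def le_fun_def intro!: sum_mono2)
  also have "\<dots> \<le> (SUP n. \<Sum>i<n. \<rho> (f i))"
    by (rule SUP_mono, rule bexI, rule finite_sum) auto
  finally show ?thesis by (simp add: suminf_eq_SUP)
qed

text \<open>Homogeneity is the reason: n times the function that is \<infinity> on {f = \<infinity>}
  and 0 elsewhere stays below f for every n, so its norm must vanish.\<close>

lemma finite_AE:
  assumes [measurable]: "f \<in> borel_measurable M" and "\<rho> f < \<infinity>"
  shows "AE x in M. f x < \<infinity>"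
proof -
  let ?g = "\<lambda>x. if f x = \<infinity> then \<infinity> else (0::ennreal)"
  have le: "ennreal (real n) * \<rho> ?g \<le> \<rho> f" for n
  proof -
    have "ennreal (real n) * \<rho> ?g = \<rho> (\<lambda>x. ennreal (real n) * ?g x)"
      by (subst scale) auto
    also have "\<dots> \<le> \<rho> f" by (intro mono) auto
    finally show ?thesis .
  qed
  have "\<rho> ?g = 0"
  proof (rule ccontr)
    assume "\<rho> ?g \<noteq> 0"
    then have "(SUP n. ennreal (real n) * \<rho> ?g) = \<infinity>"
      by (subst SUP_mult_right_ennreal[symmetric])
         (simp add: ennreal_of_nat_eq_real_of_nat[symmetric] ennreal_SUP_of_nat_eq_top ennreal_top_mult)
    moreover have "(SUP n. ennreal (real n) * \<rho> ?g) \<le> \<rho> f" by (intro SUP_least le)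
    ultimately have "\<rho> f = \<infinity>" by (metis infinity_ennreal_def top.extremum_uniqueI)
    then show False using assms(2) by simp
  qed
  then have "AE x in M. ?g x = 0" by (subst (asm) zero_iff) auto
  then show ?thesis by eventually_elim (auto simp: less_top split: if_splits)
qed

lemma space_norm_eq: "f \<in> borel_measurable M \<Longrightarrow> space_norm M \<rho> f = \<rho> (\<lambda>x. ennreal \<bar>f x\<bar>)"
  by (simp add: space_norm_def)

lemma space_norm_finite_measurable: "space_norm M \<rho> f < \<infinity> \<Longrightarrow> f \<in> borel_measurable M"
  by (auto simp: space_norm_def split: if_splits)

lemma space_norm_zero [simp]: "space_norm M \<rho> (\<lambda>x. 0) = 0"
  by (simp add: space_norm_def)

lemma space_norm_scale:
  assumes "a \<noteq> 0"
  shows "space_norm M \<rho> (\<lambda>x. a * f x) = ennreal \<bar>a\<bar> * space_norm M \<rho> f"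
proof (cases "f \<in> borel_measurable M")
  case True
  then show ?thesis by (simp add: space_norm_def abs_mult ennreal_mult scale)
next
  case False
  have "(\<lambda>x. a * f x) \<notin> borel_measurable M"
  proof
    assume "(\<lambda>x. a * f x) \<in> borel_measurable M"
    then have "(\<lambda>x. (1/a) * (a * f x)) \<in> borel_measurable M" by measurable
    then show False using False assms by simp
  qed
  then show ?thesis using False assms by (simp add: space_norm_def ennreal_mult_top)
qed

lemma space_norm_triangle:
  "space_norm M \<rho> (\<lambda>x. f x + g x) \<le> space_norm M \<rho> f + space_norm M \<rho> g"
proof (cases "f \<in> borel_measurable M \<and> g \<in> borel_measurable M")
  case True
  then have [measurable]: "f \<in> borel_measurable M" "g \<in> borel_measurable M" by auto
  have "\<rho> (\<lambda>x. ennreal \<bar>f x + g x\<bar>) \<le> \<rho> (\<lambda>x. ennreal \<bar>f x\<bar> + ennreal \<bar>g x\<bar>)"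
    by (intro mono) (auto simp: ennreal_plus[symmetric] simp del: ennreal_plus)
  also have "\<dots> \<le> \<rho> (\<lambda>x. ennreal \<bar>f x\<bar>) + \<rho> (\<lambda>x. ennreal \<bar>g x\<bar>)"
    by (intro triangle) auto
  finally show ?thesis by (simp add: space_norm_eq)
qed (auto simp: space_norm_def)

lemma space_norm_minus: "space_norm M \<rho> (\<lambda>x. - f x) = space_norm M \<rho> f"
  using space_norm_scale[of "-1" f] by simp

lemma space_norm_diff:
  "space_norm M \<rho> (\<lambda>x. f x - g x) \<le> space_norm M \<rho> f + space_norm M \<rho> g"
  using space_norm_triangle[of f "\<lambda>x. - g x"] by (simp add: space_norm_minus)

lemma space_norm_mono_AE:
  assumes [measurable]: "f \<in> borel_measurable M" and "AE x in M. \<bar>f x\<bar> \<le> \<bar>g x\<bar>"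
  shows "space_norm M \<rho> f \<le> space_norm M \<rho> g"
proof (cases "g \<in> borel_measurable M")
  case True
  then have [measurable]: "g \<in> borel_measurable M" .
  show ?thesis using assms(2) by (auto simp: space_norm_eq intro!: mono_AE elim!: eventually_mono)
qed (simp add: space_norm_def)

text \<open>Riesz--Fischer: a rapidly Cauchy subsequence converges almost everywhere because the
  series of its increments has finite norm.\<close>

lemma complete_seminorm_space_norm: "complete_seminorm (space_norm M \<rho>)"
proof -
  let ?N = "space_norm M \<rho>"
  have compl: "\<exists>f. ?N f < \<infinity> \<and> (\<lambda>i. ?N (\<lambda>x. u i x - f x)) \<longlonglongrightarrow> 0"
    if fin: "\<And>i. ?N (u i) < \<infinity>"
      and cauchy: "\<And>e. e > 0 \<Longrightarrow> \<exists>i0. \<forall>i\<ge>i0. \<forall>j\<ge>i0. ?N (\<lambda>x. u i x - u j x) < e"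
    for u :: "nat \<Rightarrow> 'a \<Rightarrow> real"
  proof -
    have um [measurable]: "u i \<in> borel_measurable M" for i
      using space_norm_finite_measurable[OF fin[of i]] .
    have "\<forall>k. \<exists>i0. \<forall>i\<ge>i0. \<forall>j\<ge>i0. ?N (\<lambda>x. u i x - u j x) < ennreal ((1/2)^k)"
      by (intro allI cauchy) auto
    then obtain r0 where r0: "\<And>k i j. i \<ge> r0 k \<Longrightarrow> j \<ge> r0 k \<Longrightarrow>
        ?N (\<lambda>x. u i x - u j x) < ennreal ((1/2)^k)"
      by metis
    \<comment> \<open>Sums of the thresholds, so that \<open>r\<close> is increasing as well and
      consecutive members of the subsequence can be compared.\<close>
    define r where "r k = (\<Sum>i\<le>k. r0 i)" for k
    have r_ge: "r k \<ge> r0 k" for k unfolding r_def by (intro member_le_sum) auto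
    have r_Suc: "r (Suc k) \<ge> r k" for k unfolding r_def by simp
    have rN: "?N (\<lambda>x. u i x - u (r k) x) \<le> ennreal ((1/2)^k)" if "i \<ge> r k" for i k
      using r0[of k i "r k"] r_ge[of k] that by (intro less_imp_le) auto
    define v where "v k = u (r k)" for k
    have [measurable]: "v k \<in> borel_measurable M" for k by (simp add: v_def)
    define d where "d k x = ennreal \<bar>v (Suc k) x - v k x\<bar>" for k x
    have [measurable]: "d k \<in> borel_measurable M" for k unfolding d_def by measurable
    have d_le: "\<rho> (d k) \<le> ennreal ((1/2)^k)" for k
      using rN[of k "r (Suc k)"] r_Suc[of k] by (simp add: space_norm_eq v_def d_def[abs_def])
    have tail: "\<rho> (\<lambda>x. \<Sum>j. d (k + j) x) \<le> ennreal (2 * (1/2)^k)" for k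
    proof -
      have "\<rho> (\<lambda>x. \<Sum>j. d (k + j) x) \<le> (\<Sum>j. \<rho> (d (k + j)))" by (intro norm_suminf_le) auto
      also have "\<dots> \<le> (\<Sum>j. ennreal ((1/2)^k * (1/2)^j))"
        using d_le[of "k + _"] by (intro suminf_le[OF _ summableI summableI]) (simp add: power_add)
      also have "\<dots> = ennreal (\<Sum>j. (1/2)^k * (1/2)^j)"
        by (intro suminf_ennreal2 summable_mult summable_geometric) auto
      also have "(\<Sum>j. (1/2)^k * (1/2)^j) = (2 * (1/2)^k :: real)"
        by (subst suminf_mult) (auto simp: suminf_geometric summable_geometric)
      finally show ?thesis .
    qed
    have "AE x in M. (\<Sum>j. d (0 + j) x) < \<infinity>"
      by (intro finite_AE) (use tail[of 0] in \<open>auto intro: le_less_trans\<close>)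
    define f where "f x = lim (\<lambda>k. v k x)" for x
    have [measurable]: "f \<in> borel_measurable M"
      unfolding f_def by measurable
    have dist_le: "AE x in M. \<forall>k. ennreal \<bar>v k x - f x\<bar> \<le> (\<Sum>j. d (k + j) x)"
      using \<open>AE x in M. _ < \<infinity>\<close>
    proof eventually_elim
      case (elim x)
      have "summable (\<lambda>j. \<bar>v (Suc j) x - v j x\<bar>)"
        using elim by (intro summable_suminf_not_top) (auto simp: d_def)
      then have "summable (\<lambda>j. v (Suc j) x - v j x)" by (rule summable_rabs_cancel)
      then have "(\<lambda>n. \<Sum>j<n. v (Suc j) x - v j x) \<longlonglongrightarrow> (\<Sum>j. v (Suc j) x - v j x)"
        by (rule summable_LIMSEQ)
      then have "(\<lambda>n. v n x - v 0 x) \<longlonglongrightarrow> (\<Sum>j. v (Suc j) x - v j x)"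
        by (simp only: sum_lessThan_telescope[of "\<lambda>j. v j x"])
      then have "(\<lambda>n. v n x) \<longlonglongrightarrow> (\<Sum>j. v (Suc j) x - v j x) + v 0 x"
        using tendsto_add[OF _ tendsto_const[of "v 0 x"]] by fastforce
      then have conv: "(\<lambda>n. v n x) \<longlonglongrightarrow> f x"
        unfolding f_def by (metis limI)
      show ?case
      proof
        fix k
        have "(\<lambda>n. ennreal \<bar>v k x - v (k + n) x\<bar>) \<longlonglongrightarrow> ennreal \<bar>v k x - f x\<bar>"
          using LIMSEQ_ignore_initial_segment[OF conv, of k]
          by (intro tendsto_ennrealI tendsto_intros) (auto simp: add.commute)
        moreover have "ennreal \<bar>v k x - v (k + n) x\<bar> \<le> (\<Sum>j. d (k + j) x)" for n
        proof -
          have "ennreal \<bar>v k x - v (k + n) x\<bar> \<le> (\<Sum>j<n. d (k + j) x)"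
          proof (induction n)
            case (Suc n)
            have "ennreal \<bar>v k x - v (k + Suc n) x\<bar> \<le> ennreal \<bar>v k x - v (k + n) x\<bar> + d (k + n) x"
              unfolding d_def by (subst ennreal_plus[symmetric]) (auto simp del: ennreal_plus)
            with Suc show ?case by (auto intro: order_trans add_right_mono)
          qed simp
          also have "\<dots> \<le> (\<Sum>j. d (k + j) x)" by (intro sum_le_suminf) auto
          finally show ?thesis .
        qed
        ultimately show "ennreal \<bar>v k x - f x\<bar> \<le> (\<Sum>j. d (k + j) x)"
          by (rule LIMSEQ_le_const2[OF _ exI, OF _ allI, OF _ impI])
      qed
    qed
    have vf: "?N (\<lambda>x. v k x - f x) \<le> ennreal (2 * (1/2)^k)" for k
    proof -
      have "?N (\<lambda>x. v k x - f x) \<le> \<rho> (\<lambda>x. \<Sum>j. d (k + j) x)"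
        using dist_le by (subst space_norm_eq) (auto intro!: mono_AE elim!: eventually_mono)
      with tail[of k] show ?thesis by simp
    qed
    have bound: "?N (\<lambda>x. u i x - f x) \<le> ennreal (3 * (1/2)^k)" if "i \<ge> r k" for i k
    proof -
      have "?N (\<lambda>x. u i x - f x) = ?N (\<lambda>x. (u i x - u (r k) x) + (v k x - f x))"
        by (simp add: v_def)
      also have "\<dots> \<le> ?N (\<lambda>x. u i x - u (r k) x) + ?N (\<lambda>x. v k x - f x)"
        by (rule space_norm_triangle)
      also have "\<dots> \<le> ennreal ((1/2)^k) + ennreal (2 * (1/2)^k)"
        by (intro add_mono rN vf that)
      finally show ?thesis by (simp add: ennreal_plus[symmetric] del: ennreal_plus)
    qed
    have "?N f \<le> ?N (u (r 0)) + ?N (\<lambda>x. u (r 0) x - f x)"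
      using space_norm_diff[of "u (r 0)" "\<lambda>x. u (r 0) x - f x"] by simp
    also have "\<dots> < \<infinity>"
      using fin[of "r 0"] bound[of 0 "r 0"] by (auto simp: le_less_trans)
    finally have "?N f < \<infinity>" .
    moreover have "(\<lambda>i. ?N (\<lambda>x. u i x - f x)) \<longlonglongrightarrow> 0"
    proof (rule order_tendstoI)
      fix e :: ennreal assume "0 < e"
      have "(\<lambda>k. ennreal (3 * (1/2)^k)) \<longlonglongrightarrow> ennreal (3 * 0)"
        by (intro tendsto_ennrealI tendsto_mult tendsto_const LIMSEQ_power_zero) auto
      then have "eventually (\<lambda>k. ennreal (3 * (1/2)^k) < e) sequentially"
        using \<open>0 < e\<close> by (intro order_tendstoD(2)) auto
      then obtain k where k: "ennreal (3 * (1/2)^k) < e"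
        by (auto simp: eventually_sequentially)
      show "eventually (\<lambda>i. ?N (\<lambda>x. u i x - f x) < e) sequentially"
        using bound[of k] k by (intro eventually_sequentiallyI[of "r k"]) (auto intro: le_less_trans)
    qed auto
    ultimately show ?thesis by blast
  qed
  show ?thesis
    unfolding complete_seminorm_def
    using space_norm_scale space_norm_triangle compl by auto
qed

end

lemma banach_function_normD:
  assumes "banach_function_norm M \<rho>"
  shows "f \<in> borel_measurable M \<Longrightarrow> \<rho> f = 0 \<longleftrightarrow> (AE x in M. f x = 0)"
    and "f \<in> borel_measurable M \<Longrightarrow> 0 \<le> a \<Longrightarrow> \<rho> (\<lambda>x. ennreal a * f x) = ennreal a * \<rho> f"
    and "f \<in> borel_measurable M \<Longrightarrow> g \<in> borel_measurable M \<Longrightarrow>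
      \<rho> (\<lambda>x. f x + g x) \<le> \<rho> f + \<rho> g"
    and "f \<in> borel_measurable M \<Longrightarrow> g \<in> borel_measurable M \<Longrightarrow>
      (AE x in M. f x \<le> g x) \<Longrightarrow> \<rho> f \<le> \<rho> g"
    and "f \<in> borel_measurable M \<Longrightarrow> (\<And>i::nat. u i \<in> borel_measurable M) \<Longrightarrow>
      (AE x in M. incseq (\<lambda>i. u i x) \<and> f x = (SUP i. u i x)) \<Longrightarrow> \<rho> f = (SUP i. \<rho> (u i))"
    and "A \<in> sets M \<Longrightarrow> emeasure M A < \<infinity> \<Longrightarrow> \<rho> (indicator A) < \<infinity>"
    and "A \<in> sets M \<Longrightarrow> emeasure M A < \<infinity> \<Longrightarrow>
      \<exists>C>0::real. \<forall>f\<in>borel_measurable M. (\<integral>\<^sup>+x\<in>A. f x \<partial>M) \<le> ennreal C * \<rho> f"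
proof -
  note A = assms[unfolded banach_function_norm_def]
  note A1 = conjunct1[OF A] and B1 = conjunct2[OF A]
  note A2 = conjunct1[OF B1] and B2 = conjunct2[OF B1]
  note A3 = conjunct1[OF B2] and B3 = conjunct2[OF B2]
  note A4 = conjunct1[OF B3] and B4 = conjunct2[OF B3]
  note A5 = conjunct1[OF B4] and A6 = conjunct2[OF B4]
  show "f \<in> borel_measurable M \<Longrightarrow> \<rho> f = 0 \<longleftrightarrow> (AE x in M. f x = 0)"
    by (rule A1[rule_format])
  show "f \<in> borel_measurable M \<Longrightarrow> 0 \<le> a \<Longrightarrow> \<rho> (\<lambda>x. ennreal a * f x) = ennreal a * \<rho> f"
    by (rule A2[rule_format])
  show "f \<in> borel_measurable M \<Longrightarrow> g \<in> borel_measurable M \<Longrightarrow>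
      \<rho> (\<lambda>x. f x + g x) \<le> \<rho> f + \<rho> g"
    by (rule conjunct1[OF A3[rule_format]])
  show "f \<in> borel_measurable M \<Longrightarrow> g \<in> borel_measurable M \<Longrightarrow>
      (AE x in M. f x \<le> g x) \<Longrightarrow> \<rho> f \<le> \<rho> g"
    using A3 by blast
  show "f \<in> borel_measurable M \<Longrightarrow> (\<And>i::nat. u i \<in> borel_measurable M) \<Longrightarrow>
      (AE x in M. incseq (\<lambda>i. u i x) \<and> f x = (SUP i. u i x)) \<Longrightarrow> \<rho> f = (SUP i. \<rho> (u i))"
    by (rule A4[THEN spec, THEN bspec, THEN mp, THEN mp]) auto
  show "A \<in> sets M \<Longrightarrow> emeasure M A < \<infinity> \<Longrightarrow> \<rho> (indicator A) < \<infinity>"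
    by (rule A5[rule_format])
  show "A \<in> sets M \<Longrightarrow> emeasure M A < \<infinity> \<Longrightarrow>
      \<exists>C>0::real. \<forall>f\<in>borel_measurable M. (\<integral>\<^sup>+x\<in>A. f x \<partial>M) \<le> ennreal C * \<rho> f"
    by (rule A6[THEN bspec, THEN mp])
qed

lemma banach_function_norm_imp_function_norm:
  assumes "banach_function_norm M \<rho>"
  shows "function_norm M \<rho>"
proof
  note D = banach_function_normD[OF assms]
  fix f g :: "'a \<Rightarrow> ennreal" assume f: "f \<in> borel_measurable M"
  show "\<rho> f = 0 \<longleftrightarrow> (AE x in M. f x = 0)" by (rule D(1)[OF f])
  show "\<rho> (\<lambda>x. ennreal a * f x) = ennreal a * \<rho> f" if "0 \<le> a" for a
    by (rule D(2)[OF f that])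
  assume g: "g \<in> borel_measurable M"
  show "\<rho> (\<lambda>x. f x + g x) \<le> \<rho> f + \<rho> g" by (rule D(3)[OF f g])
  show "\<rho> f \<le> \<rho> g" if "AE x in M. f x \<le> g x" by (rule D(4)[OF f g that])
next
  fix u :: "nat \<Rightarrow> 'a \<Rightarrow> ennreal"
  assume u: "\<And>i. u i \<in> borel_measurable M" "incseq u"
  show "\<rho> (\<lambda>x. SUP i. u i x) = (SUP i. \<rho> (u i))"
    by (rule banach_function_normD(5)[OF assms])
       (use u in \<open>auto simp: incseq_def le_fun_def\<close>)
qed

section \<open>The half line and the couple of end point spaces\<close>

lemma space_half_line [simp]: "space half_line = {0<..}"
  by (simp add: half_line_def)

lemma sets_half_line: "sets half_line = (\<inter>) {0<..} ` sets lebesgue"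
  by (simp add: half_line_def sets_restrict_space)

lemma borel_half_lineI:
  "f \<in> borel_measurable borel \<Longrightarrow> f \<in> borel_measurable half_line"
  unfolding half_line_def
  by (intro measurable_restrict_space1) (simp add: measurable_completion)

lemma measurable_ident_half_line [measurable (raw)]:
  "(\<lambda>x. x) \<in> borel_measurable half_line"
  "fst \<in> borel_measurable (half_line \<Otimes>\<^sub>M K)"
  "snd \<in> borel_measurable (L \<Otimes>\<^sub>M half_line)"
proof -
  show *: "(\<lambda>x. x) \<in> borel_measurable half_line" by (rule borel_half_lineI) simp
  show "fst \<in> borel_measurable (half_line \<Otimes>\<^sub>M K)" "snd \<in> borel_measurable (L \<Otimes>\<^sub>M half_line)"
    by (rule measurable_compose[OF measurable_fst *], rule measurable_compose[OF measurable_snd *])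
qed

lemma sigma_finite_half_line: "sigma_finite_measure half_line"
proof
  let ?A = "range (\<lambda>n::nat. {0<..real n})"
  have "{0<..real n} \<in> sets half_line \<and> emeasure half_line {0<..real n} \<noteq> \<infinity>" for n
  proof
    show "{0<..real n} \<in> sets half_line"
      unfolding half_line_def by (subst sets_restrict_space_iff) auto
    show "emeasure half_line {0<..real n} \<noteq> \<infinity>"
      unfolding half_line_def by (subst emeasure_restrict_space) auto
  qed
  moreover have "\<Union>?A = space half_line"
    by (auto intro: real_arch_simple)
  ultimately show "\<exists>A. countable A \<and> A \<subseteq> sets half_line \<and> \<Union>A = space half_line \<and>
      (\<forall>a\<in>A. emeasure half_line a \<noteq> \<infinity>)"
    by (intro exI[of _ ?A]) auto
qed

lemma nn_integral_half_line:
  "(\<integral>\<^sup>+t. f t \<partial>half_line) = (\<integral>\<^sup>+t. f t * indicator {0<..} t \<partial>lebesgue)"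
  unfolding half_line_def by (rule nn_integral_restrict_space) auto

lemma nn_integral_half_line_borel:
  assumes "f \<in> borel_measurable borel"
  shows "(\<integral>\<^sup>+t. f t \<partial>half_line) = (\<integral>\<^sup>+t. f t * indicator {0<..} t \<partial>lborel)"
  unfolding nn_integral_half_line
  by (rule nn_integral_completion)

lemma AE_half_line_neq: "AE t in half_line. t \<noteq> a"
proof -
  have "AE t in lborel. t \<noteq> a" by (rule AE_lborel_singleton)
  then have "AE t in lebesgue. t \<noteq> a" by (rule AE_completion)
  then show ?thesis unfolding half_line_def by (subst AE_restrict_space_iff) (auto elim: eventually_mono)
qed

lemma not_AE_half_line_False: "\<not> (AE t in half_line. False)"
proof
  assume "AE t in half_line. False"
  then obtain Z where Z: "{t \<in> space half_line. \<not> False} \<subseteq> Z" "emeasure half_line Z = 0" "Z \<in> sets half_line"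
    by (rule AE_E)
  then have "emeasure half_line {0<..} \<le> emeasure half_line Z" by (intro emeasure_mono) auto
  then have "emeasure half_line {0<..} = 0" using Z(2) by simp
  moreover have "emeasure lborel {0<..1::real} \<le> emeasure lborel {0::real<..}"
    by (rule emeasure_mono) auto
  ultimately show False by (simp add: half_line_def emeasure_restrict_space)
qed

section \<open>The essential supremum and the integral against dt/t as function norms\<close>

lemma esssup_le_iff:
  assumes "f \<in> borel_measurable M"
  shows "esssup M f \<le> (z::ennreal) \<longleftrightarrow> (AE x in M. f x \<le> z)"
proof
  assume "esssup M f \<le> z"
  with esssup_AE[of f M] show "AE x in M. f x \<le> z" by (auto elim: eventually_mono)
next
  assume "AE x in M. f x \<le> z"
  then show "esssup M f \<le> z" by (simp add: esssup_eq_AE[OF assms] Inf_lower)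
qed

lemma function_norm_esssup: "function_norm M (esssup M)"
proof
  fix f g :: "'a \<Rightarrow> ennreal" assume [measurable]: "f \<in> borel_measurable M"
  show "esssup M f = 0 \<longleftrightarrow> (AE x in M. f x = 0)"
    using esssup_le_iff[of f M 0] by simp
  have le: "esssup M (\<lambda>x. c * h x) \<le> c * esssup M h"
    if [measurable]: "h \<in> borel_measurable M" for h and c :: ennreal
    using esssup_AE[of h M] by (subst esssup_le_iff) (auto elim!: eventually_mono intro: mult_left_mono)
  show "esssup M (\<lambda>x. ennreal a * f x) = ennreal a * esssup M f" if "0 \<le> a" for a
  proof (cases "a = 0")
    case True
    then show ?thesis using esssup_le_iff[of "\<lambda>x. 0" M 0] by simp
  next
    case False
    with that have a: "a > 0" by simp
    have inv: "ennreal (1 / a) * (ennreal a * y) = y" "ennreal a * (ennreal (1 / a) * y) = y" for y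
      using a by (simp_all add: mult.assoc[symmetric] ennreal_mult[symmetric])
    have "esssup M f = esssup M (\<lambda>x. ennreal (1 / a) * (ennreal a * f x))" by (simp add: inv)
    also have "\<dots> \<le> ennreal (1 / a) * esssup M (\<lambda>x. ennreal a * f x)" by (rule le) measurable
    finally have "ennreal a * esssup M f \<le> esssup M (\<lambda>x. ennreal a * f x)"
      using mult_left_mono[of "esssup M f" _ "ennreal a"] by (metis inv(2) zero_le)
    then show ?thesis using le[of f "ennreal a"] by (intro antisym) auto
  qed
  assume [measurable]: "g \<in> borel_measurable M"
  have "AE x in M. f x + g x \<le> esssup M f + esssup M g"
    using esssup_AE[of f M] esssup_AE[of g M] by eventually_elim (rule add_mono)
  then show "esssup M (\<lambda>x. f x + g x) \<le> esssup M f + esssup M g"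
    by (subst esssup_le_iff) auto
  show "esssup M f \<le> esssup M g" if "AE x in M. f x \<le> g x"
  proof -
    from that esssup_AE[of g M] have "AE x in M. f x \<le> esssup M g"
      by eventually_elim (rule order_trans)
    then show ?thesis by (subst esssup_le_iff) auto
  qed
next
  fix u :: "nat \<Rightarrow> 'a \<Rightarrow> ennreal"
  assume [measurable]: "\<And>i. u i \<in> borel_measurable M"
  have mono: "esssup M f \<le> esssup M g"
    if [measurable]: "f \<in> borel_measurable M" "g \<in> borel_measurable M" and "\<And>x. f x \<le> g x"
    for f g :: "'a \<Rightarrow> ennreal"
    using esssup_AE[of g M] that(3)
    by (subst esssup_le_iff) (auto elim!: eventually_mono intro: order_trans)
  show "esssup M (\<lambda>x. SUP i. u i x) = (SUP i. esssup M (u i))"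
  proof (rule antisym)
    have "AE x in M. \<forall>i. u i x \<le> esssup M (u i)"
      by (intro AE_all_countable[THEN iffD2] allI esssup_AE)
    then show "esssup M (\<lambda>x. SUP i. u i x) \<le> (SUP i. esssup M (u i))"
      by (subst esssup_le_iff) (auto elim!: eventually_mono intro!: SUP_mono)
    show "(SUP i. esssup M (u i)) \<le> esssup M (\<lambda>x. SUP i. u i x)"
    proof (rule SUP_least)
      fix i
      show "esssup M (u i) \<le> esssup M (\<lambda>x. SUP i. u i x)"
        by (rule mono) (auto intro: SUP_upper)
    qed
  qed
qed

text \<open>Not an instance of \<open>banach_function_norm\<close>: the indicator of (0,1) has
  infinite integral against dt/t. The axioms of \<open>function_norm\<close> speak of no sets of
  finite measure, so that completeness covers this norm too.\<close>

lemma function_norm_L1_tilde: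
  "function_norm half_line (\<lambda>f. \<integral>\<^sup>+t. f t * ennreal (1 / t) \<partial>half_line)"
proof
  fix f g :: "real \<Rightarrow> ennreal" assume [measurable]: "f \<in> borel_measurable half_line"
  show "(\<integral>\<^sup>+t. f t * ennreal (1 / t) \<partial>half_line) = 0 \<longleftrightarrow> (AE x in half_line. f x = 0)"
    by (subst nn_integral_0_iff_AE) (auto intro!: AE_cong)
  show "(\<integral>\<^sup>+t. ennreal a * f t * ennreal (1 / t) \<partial>half_line) =
      ennreal a * (\<integral>\<^sup>+t. f t * ennreal (1 / t) \<partial>half_line)" for a
    by (subst nn_integral_cmult[symmetric]) (auto simp: mult.assoc)
  assume [measurable]: "g \<in> borel_measurable half_line"
  show "(\<integral>\<^sup>+t. (f t + g t) * ennreal (1 / t) \<partial>half_line) \<le>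
      (\<integral>\<^sup>+t. f t * ennreal (1 / t) \<partial>half_line) + (\<integral>\<^sup>+t. g t * ennreal (1 / t) \<partial>half_line)"
    by (subst nn_integral_add[symmetric]) (auto simp: distrib_right)
  show "(\<integral>\<^sup>+t. f t * ennreal (1 / t) \<partial>half_line) \<le> (\<integral>\<^sup>+t. g t * ennreal (1 / t) \<partial>half_line)"
    if "AE x in half_line. f x \<le> g x"
    using that by (intro nn_integral_mono_AE) (auto elim!: eventually_mono intro: mult_right_mono)
next
  fix u :: "nat \<Rightarrow> real \<Rightarrow> ennreal"
  assume [measurable]: "\<And>i. u i \<in> borel_measurable half_line" and "incseq u"
  then show "(\<integral>\<^sup>+t. (SUP i. u i t) * ennreal (1 / t) \<partial>half_line) =
      (SUP i. \<integral>\<^sup>+t. u i t * ennreal (1 / t) \<partial>half_line)"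
    by (subst nn_integral_monotone_convergence_SUP[symmetric])
       (auto simp: incseq_def le_fun_def SUP_mult_right_ennreal intro!: mult_right_mono)
qed

interpretation Linf: function_norm M "esssup M" for M by (rule function_norm_esssup)

interpretation L1t: function_norm half_line "\<lambda>f. \<integral>\<^sup>+t. f t * ennreal (1 / t) \<partial>half_line"
  by (rule function_norm_L1_tilde)

lemma Linf_norm_measurable: "Linf_norm M f < \<infinity> \<Longrightarrow> f \<in> borel_measurable M"
  unfolding Linf_norm_def by (rule Linf.space_norm_finite_measurable)

lemma L1_tilde_norm_measurable: "L1_tilde_norm f < \<infinity> \<Longrightarrow> f \<in> borel_measurable half_line"
  unfolding L1_tilde_norm_def by (rule L1t.space_norm_finite_measurable)

lemma L1_tilde_norm_eq:
  "f \<in> borel_measurable half_line \<Longrightarrow>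
   L1_tilde_norm f = (\<integral>\<^sup>+t. ennreal \<bar>f t\<bar> * ennreal (1 / t) \<partial>half_line)"
  by (simp add: L1_tilde_norm_def L1t.space_norm_eq)

lemma Linf_norm_le_iff:
  "f \<in> borel_measurable M \<Longrightarrow> Linf_norm M f \<le> z \<longleftrightarrow> (AE t in M. ennreal \<bar>f t\<bar> \<le> z)"
  by (simp add: Linf_norm_def Linf.space_norm_eq esssup_le_iff)

text \<open>If K(f,1) = 0, then f differs uniformly by at most 1/(m+1) from some f0 of arbitrarily
  small L^1(dt/t) norm. The part of |f| above 1/(m+1) is dominated by |f0|, hence has integral 0;
  this for all m gives f = 0 almost everywhere.\<close>

lemma banach_couple_L1_tilde_Linf: "banach_couple L1_tilde_norm (Linf_norm half_line)"
proof -
  have "L1_tilde_norm f = 0 \<and> Linf_norm half_line f = 0"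
    if K: "K_functional L1_tilde_norm (Linf_norm half_line) f 1 = 0" for f
  proof -
    have ex: "\<exists>f0. L1_tilde_norm f0 + Linf_norm half_line (\<lambda>x. f x - f0 x) < e" if "e > 0" for e
      using K that unfolding K_functional_def by (auto simp: INF_less_iff dest!: eq_refl[THEN le_less_trans])
    have fm [measurable]: "f \<in> borel_measurable half_line"
    proof -
      obtain f0 where f0: "L1_tilde_norm f0 + Linf_norm half_line (\<lambda>x. f x - f0 x) < 1"
        using ex[of 1] by auto
      then have "L1_tilde_norm f0 < \<infinity>" "Linf_norm half_line (\<lambda>x. f x - f0 x) < \<infinity>"
        by (auto simp: less_top[symmetric] top_unique)
      then have [measurable]: "f0 \<in> borel_measurable half_line"
          "(\<lambda>x. f x - f0 x) \<in> borel_measurable half_line"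
        by (auto intro: L1_tilde_norm_measurable Linf_norm_measurable)
      have "(\<lambda>x. (f x - f0 x) + f0 x) \<in> borel_measurable half_line" by measurable
      then show ?thesis by simp
    qed
    have "AE t in half_line. \<bar>f t\<bar> \<le> 1 / real (Suc m)" for m
    proof -
      \<comment> \<open>\<open>ennreal\<close> sends negative numbers to 0, so this is the positive
        part.\<close>
      define h where "h t = ennreal (\<bar>f t\<bar> - 1 / real (Suc m))" for t
      have [measurable]: "h \<in> borel_measurable half_line" unfolding h_def by measurable
      have le: "(\<integral>\<^sup>+t. h t * ennreal (1 / t) \<partial>half_line) \<le> e"
        if e: "0 < e" "e \<le> ennreal (1 / real (Suc m))" for e
      proof -
        obtain f0 where f0: "L1_tilde_norm f0 + Linf_norm half_line (\<lambda>x. f x - f0 x) < e"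
          using ex[OF e(1)] by auto
        then have l: "L1_tilde_norm f0 < e" "Linf_norm half_line (\<lambda>x. f x - f0 x) < e"
          using le_less_trans[OF _ f0] by auto
        then have [measurable]: "f0 \<in> borel_measurable half_line"
          by (intro L1_tilde_norm_measurable) (auto simp: less_top[symmetric])
        have "Linf_norm half_line (\<lambda>x. f x - f0 x) \<le> ennreal (1 / real (Suc m))"
          using l e by simp
        then have "AE t in half_line. ennreal \<bar>f t - f0 t\<bar> \<le> ennreal (1 / real (Suc m))"
          by (subst (asm) Linf_norm_le_iff) auto
        then have "AE t in half_line. h t \<le> ennreal \<bar>f0 t\<bar>"
          by eventually_elim (auto simp: h_def intro!: ennreal_leI)
        then have "(\<integral>\<^sup>+t. h t * ennreal (1 / t) \<partial>half_line) \<le> L1_tilde_norm f0"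
          by (subst L1_tilde_norm_eq) (auto intro!: L1t.mono_AE)
        with l show ?thesis by simp
      qed
      have "(\<integral>\<^sup>+t. h t * ennreal (1 / t) \<partial>half_line) \<le> 0"
      proof (rule ccontr)
        let ?I = "\<integral>\<^sup>+t. h t * ennreal (1 / t) \<partial>half_line"
        assume "\<not> ?I \<le> 0"
        then have "0 < ?I" by (simp only: not_le)
        then obtain e where e: "0 < e" "e < ?I" using dense[OF \<open>0 < ?I\<close>] by (elim exE conjE)
        let ?e = "min e (ennreal (1 / real (Suc m)))"
        have "?I \<le> ?e" using e by (intro le) auto
        then show False using e(2) by (simp only: min.bounded_iff) (metis not_le)
      qed
      then have "AE t in half_line. h t = 0" by (subst L1t.zero_iff[symmetric]) auto
      then show ?thesis by eventually_elim (simp add: h_def ennreal_eq_0_iff)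
    qed
    then have "AE t in half_line. \<forall>m. \<bar>f t\<bar> \<le> 1 / real (Suc m)"
      by (simp add: AE_all_countable)
    then have ae: "AE t in half_line. f t = 0"
    proof eventually_elim
      case (elim t)
      have "\<bar>f t\<bar> \<le> 0" by (rule field_le_epsilon) (metis add_0 elim nat_approx_posE le_less order_trans)
      then show ?case by simp
    qed
    show ?thesis
    proof
      show "L1_tilde_norm f = 0"
        using ae by (simp add: L1_tilde_norm_def L1t.space_norm_eq L1t.zero_iff)
      show "Linf_norm half_line f = 0"
        using ae by (simp add: Linf_norm_def Linf.space_norm_eq Linf.zero_iff)
    qed
  qed
  then show ?thesis
    unfolding banach_couple_def
    using L1t.complete_seminorm_space_norm Linf.complete_seminorm_space_norm
    by (auto simp: L1_tilde_norm_def Linf_norm_def)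
qed

section \<open>Interpolation on the half line\<close>

text \<open>Lebesgue density of (t/s)^\<delta> ds/s on s > t. Exponent 1 is the one that the
  smoothing produces; a smaller \<delta> is what remains once the weight has been moved inside the
  integral.\<close>

definition hardy_kernel :: "real \<Rightarrow> real \<Rightarrow> real \<Rightarrow> real" where
  "hardy_kernel \<delta> t s = (if 0 < t \<and> t < s then (t / s) powr \<delta> / s else 0)"

definition hardy :: "real \<Rightarrow> (real \<Rightarrow> ennreal) \<Rightarrow> real \<Rightarrow> ennreal" where
  "hardy \<delta> g t = (\<integral>\<^sup>+s. ennreal (hardy_kernel \<delta> t s) * g s \<partial>half_line)"

lemma hardy_kernel_nonneg: "0 \<le> hardy_kernel \<delta> t s"
  by (simp add: hardy_kernel_def)

lemma hardy_kernel_le: "0 < \<delta> \<Longrightarrow> 0 < s \<Longrightarrow> hardy_kernel \<delta> t s \<le> 1 / s"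
  by (auto simp: hardy_kernel_def intro!: divide_right_mono powr_le1)

lemma hardy_kernel_measurable [measurable]:
  assumes [measurable]: "f \<in> borel_measurable L" "g \<in> borel_measurable L"
  shows "(\<lambda>x. hardy_kernel \<delta> (f x) (g x)) \<in> borel_measurable L"
  unfolding hardy_kernel_def by measurable

text \<open>The mass in s is the norm of the Hardy operator on L^\<infinity>.\<close>

lemma nn_integral_hardy_kernel_tail:
  assumes "0 < t" "0 < \<delta>"
  shows "(\<integral>\<^sup>+s. ennreal (hardy_kernel \<delta> t s) \<partial>half_line) = ennreal (1 / \<delta>)"
proof -
  have "(\<integral>\<^sup>+s. ennreal (hardy_kernel \<delta> t s) \<partial>half_line) =
      (\<integral>\<^sup>+s. ennreal (hardy_kernel \<delta> t s) * indicator {0<..} s \<partial>lborel)"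
    by (rule nn_integral_half_line_borel) measurable
  also have "\<dots> = (\<integral>\<^sup>+s. ennreal (t powr \<delta> * s powr (- \<delta> - 1)) * indicator {t..} s \<partial>lborel)"
  proof (rule nn_integral_cong_AE, use AE_lborel_singleton[of t] in eventually_elim)
    case (elim s)
    then consider "s < t" | "t < s" by linarith
    then show "ennreal (hardy_kernel \<delta> t s) * indicator {0<..} s =
        ennreal (t powr \<delta> * s powr (- \<delta> - 1)) * indicator {t..} s"
      using assms
      by cases (auto simp: hardy_kernel_def powr_divide powr_diff powr_minus field_simps)
  qed
  also have "\<dots> = ennreal (1 / \<delta>)"
  proof (rule nn_integral_has_integral_lebesgue')
    have "((\<lambda>s. s powr (- \<delta> - 1)) has_integral - (t powr (- \<delta> - 1 + 1)) / (- \<delta> - 1 + 1)) {t..}"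
      using assms by (intro has_integral_powr_to_inf) auto
    then have "((\<lambda>s. t powr \<delta> * s powr (- \<delta> - 1)) has_integral t powr \<delta> * (t powr (- \<delta>) / \<delta>)) {t..}"
      by (intro has_integral_mult_right) simp
    also have "t powr \<delta> * (t powr (- \<delta>) / \<delta>) = 1 / \<delta>"
      using assms by (simp add: powr_minus field_simps)
    finally show "((\<lambda>s. t powr \<delta> * s powr (- \<delta> - 1)) has_integral 1 / \<delta>) {t..}" .
  qed auto
  finally show ?thesis .
qed

lemma nn_integral_hardy_kernel_le:
  assumes "0 < \<delta>"
  shows "(\<integral>\<^sup>+s. ennreal (hardy_kernel \<delta> t s) \<partial>half_line) \<le> ennreal (1 / \<delta>)"
  using nn_integral_hardy_kernel_tail[OF _ assms, of t]
  by (cases "0 < t") (auto simp: hardy_kernel_def)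

text \<open>By Fubini, the mass in t against dt/t bounds the Hardy operator on L^1(dt/t), with the
  same constant 1/\<delta> as on L^\<infinity>.\<close>

lemma nn_integral_hardy_kernel_head:
  assumes "0 < s" "0 < \<delta>"
  shows "(\<integral>\<^sup>+t. ennreal (hardy_kernel \<delta> t s) * ennreal (1 / t) \<partial>half_line) = ennreal (1 / \<delta>) * ennreal (1 / s)"
proof -
  have "(\<integral>\<^sup>+t. ennreal (hardy_kernel \<delta> t s) * ennreal (1 / t) \<partial>half_line) =
      (\<integral>\<^sup>+t. ennreal (hardy_kernel \<delta> t s) * ennreal (1 / t) * indicator {0<..} t \<partial>lborel)"
    by (rule nn_integral_half_line_borel) measurable
  also have "\<dots> = (\<integral>\<^sup>+t. ennreal (s powr (- \<delta> - 1) * t powr (\<delta> - 1)) * indicator {0..s} t \<partial>lborel)"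
  proof (rule nn_integral_cong_AE, use AE_lborel_singleton[of 0] AE_lborel_singleton[of s] in eventually_elim)
    case (elim t)
    then consider "t < 0" | "0 < t" "t < s" | "s < t" by linarith
    then show "ennreal (hardy_kernel \<delta> t s) * ennreal (1 / t) * indicator {0<..} t =
        ennreal (s powr (- \<delta> - 1) * t powr (\<delta> - 1)) * indicator {0..s} t"
      using assms
      by cases (auto simp: hardy_kernel_def powr_divide powr_diff powr_minus field_simps ennreal_mult[symmetric])
  qed
  also have "\<dots> = ennreal (1 / \<delta> * (1 / s))"
  proof (rule nn_integral_has_integral_lebesgue')
    have "((\<lambda>t. t powr (\<delta> - 1)) has_integral s powr (\<delta> - 1 + 1) / (\<delta> - 1 + 1)) {0..s}"
      using assms by (intro has_integral_powr_from_0) auto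
    then have "((\<lambda>t. s powr (- \<delta> - 1) * t powr (\<delta> - 1)) has_integral
        s powr (- \<delta> - 1) * (s powr \<delta> / \<delta>)) {0..s}"
      by (intro has_integral_mult_right) simp
    also have "s powr (- \<delta> - 1) * (s powr \<delta> / \<delta>) = 1 / \<delta> * (1 / s)"
      using assms by (simp add: powr_minus powr_diff field_simps)
    finally show "((\<lambda>t. s powr (- \<delta> - 1) * t powr (\<delta> - 1)) has_integral 1 / \<delta> * (1 / s)) {0..s}" .
  qed auto
  finally show ?thesis using assms by (simp add: ennreal_mult[symmetric])
qed

section \<open>Lattice properties and the Hardy inequality for the norm given by the functor\<close>

locale functor_norm =
  fixes F :: "real fnorm \<Rightarrow> real fnorm \<Rightarrow> real fnorm"
  assumes F: "exact_interpolation_functor F"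
begin

abbreviation N :: "real fnorm" where "N \<equiv> F L1_tilde_norm (Linf_norm half_line)"

lemma N_complete: "complete_seminorm N"
  and N_bound: "\<exists>C>0::real. \<forall>f. N f \<le> ennreal C * max (L1_tilde_norm f) (Linf_norm half_line f) \<and>
      K_functional L1_tilde_norm (Linf_norm half_line) f 1 \<le> ennreal C * N f"
  using conjunct1[OF F[unfolded exact_interpolation_functor_def], rule_format,
    OF banach_couple_L1_tilde_Linf] by auto

lemma N_operator:
  assumes "linear_on_space (sum_space L1_tilde_norm (Linf_norm half_line)) T" "0 < c"
    and "\<And>f. L1_tilde_norm f < \<infinity> \<Longrightarrow> L1_tilde_norm (T f) \<le> ennreal c * L1_tilde_norm f"
    and "\<And>f. Linf_norm half_line f < \<infinity> \<Longrightarrow>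
      Linf_norm half_line (T f) \<le> ennreal c * Linf_norm half_line f"
    and "N f < \<infinity>"
  shows "N (T f) \<le> ennreal c * N f"
proof -
  note A = conjunct2[OF F[unfolded exact_interpolation_functor_def]]
  show ?thesis
    by (rule A[THEN spec, THEN spec, THEN spec, THEN spec, THEN spec, THEN spec, THEN mp,
          THEN mp, THEN bspec])
       (use assms banach_couple_L1_tilde_Linf in \<open>auto simp: fspace_def\<close>)
qed

lemma N_zero: "N (\<lambda>t. 0) = 0"
  and N_scale: "a \<noteq> 0 \<Longrightarrow> N (\<lambda>t. a * f t) = ennreal \<bar>a\<bar> * N f"
  and N_triangle: "N (\<lambda>t. f t + g t) \<le> N f + N g"
  using N_complete unfolding complete_seminorm_def by blast+

text \<open>The functor returns a bare extended seminorm. Its continuous inclusion into the sum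
  space is what restricts its finite values to decomposable, hence measurable, functions.\<close>

lemma N_finite_imp:
  assumes "N f < \<infinity>"
  shows "f \<in> sum_space L1_tilde_norm (Linf_norm half_line)" "f \<in> borel_measurable half_line"
proof -
  obtain C :: real where "C > 0" "K_functional L1_tilde_norm (Linf_norm half_line) f 1 \<le> ennreal C * N f"
    using N_bound by blast
  then have "K_functional L1_tilde_norm (Linf_norm half_line) f 1 < \<infinity>"
    using assms by (auto simp: ennreal_mult_less_top intro: le_less_trans)
  then obtain f0 where f0: "L1_tilde_norm f0 + Linf_norm half_line (\<lambda>x. f x - f0 x) < \<infinity>"
    by (auto simp: K_functional_def INF_less_iff)
  then have fin: "L1_tilde_norm f0 < \<infinity>" "Linf_norm half_line (\<lambda>x. f x - f0 x) < \<infinity>"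
    by auto
  have eq: "f = (\<lambda>x. f0 x + (f x - f0 x))" by simp
  show "f \<in> sum_space L1_tilde_norm (Linf_norm half_line)"
    unfolding sum_space_def fspace_def
    by (intro CollectI bexI[of _ f0] bexI[of _ "\<lambda>x. f x - f0 x"]) (use fin eq in auto)
  have "f0 \<in> borel_measurable half_line" "(\<lambda>x. f x - f0 x) \<in> borel_measurable half_line"
    using fin by (auto intro: L1_tilde_norm_measurable Linf_norm_measurable)
  then have "(\<lambda>x. f0 x + (f x - f0 x)) \<in> borel_measurable half_line" by (rule borel_measurable_add)
  then show "f \<in> borel_measurable half_line" by simp
qed

lemma N_null:
  assumes "f \<in> borel_measurable half_line" "AE t in half_line. f t = 0"
  shows "N f = 0"
proof -
  have "L1_tilde_norm f = 0" "Linf_norm half_line f = 0"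
    using assms by (simp_all add: L1_tilde_norm_def L1t.space_norm_eq L1t.zero_iff
        Linf_norm_def Linf.space_norm_eq Linf.zero_iff)
  moreover obtain C :: real where "N f \<le> ennreal C * max (L1_tilde_norm f) (Linf_norm half_line f)"
    using N_bound by blast
  ultimately show ?thesis by simp
qed

lemma N_finite_pos:
  assumes "L1_tilde_norm f < \<infinity>" "Linf_norm half_line f < \<infinity>"
  shows "N f < \<infinity>"
proof -
  obtain C :: real where "N f \<le> ennreal C * max (L1_tilde_norm f) (Linf_norm half_line f)"
    using N_bound by blast
  then show ?thesis using assms by (auto simp: ennreal_mult_less_top max_def intro: le_less_trans split: if_splits)
qed

text \<open>The compatibility condition of the couple turns K(f,1) = 0 into vanishing of the end
  point norms. It will show that the norm of min(1,t) w(t) is not 0.\<close>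

lemma N_eq_0D:
  assumes "N f = 0"
  shows "AE t in half_line. f t = 0"
proof -
  have [measurable]: "f \<in> borel_measurable half_line" by (rule N_finite_imp) (simp add: assms)
  have "K_functional L1_tilde_norm (Linf_norm half_line) f 1 = 0"
    using N_bound assms by (auto dest: spec[of _ f])
  then have "L1_tilde_norm f = 0"
    using banach_couple_L1_tilde_Linf unfolding banach_couple_def by blast
  then show ?thesis by (simp add: L1_tilde_norm_def L1t.space_norm_eq L1t.zero_iff)
qed

text \<open>The lattice property comes from interpolating the operator of multiplication by a function
  with values in \<open>[-1,1]\<close>.\<close>

lemma N_mono_AE:
  assumes f [measurable]: "f \<in> borel_measurable half_line" and "AE t in half_line. \<bar>f t\<bar> \<le> \<bar>g t\<bar>"
  shows "N f \<le> N g"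
proof (cases "N g < \<infinity>")
  case True
  have [measurable]: "g \<in> borel_measurable half_line" by (rule N_finite_imp[OF True])
  \<comment> \<open>Where g = 0 and |f| \<le> |g|, division by zero gives 0, and f = 0 there as
    well. Hence \<open>m t * g t\<close> differs from f only on the exceptional null set, which
    \<open>N_null\<close> removes.\<close>
  define m where "m t = (if \<bar>f t\<bar> \<le> \<bar>g t\<bar> then f t / g t else 0)" for t
  have [measurable]: "m \<in> borel_measurable half_line" unfolding m_def by measurable
  have m1: "\<bar>m t\<bar> \<le> 1" for t by (auto simp: m_def divide_le_eq)
  have le: "\<bar>m t * h t\<bar> \<le> \<bar>h t\<bar>" for t and h :: "real \<Rightarrow> real"
    using mult_right_mono[OF m1[of t], of "\<bar>h t\<bar>"] by (simp add: abs_mult)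
  let ?T = "\<lambda>h t. m t * h t"
  have 1: "N (?T g) \<le> ennreal 1 * N g"
  proof (rule N_operator)
    show "linear_on_space (sum_space L1_tilde_norm (Linf_norm half_line)) ?T"
      by (auto simp: linear_on_space_def algebra_simps)
    fix h :: "real \<Rightarrow> real"
    show "L1_tilde_norm (?T h) \<le> ennreal 1 * L1_tilde_norm h" if "L1_tilde_norm h < \<infinity>"
    proof -
      have [measurable]: "h \<in> borel_measurable half_line" using L1_tilde_norm_measurable[OF that] .
      show ?thesis using le[of _ h] unfolding L1_tilde_norm_def
        by (simp, intro L1t.space_norm_mono_AE) (auto intro!: AE_I2)
    qed
    show "Linf_norm half_line (?T h) \<le> ennreal 1 * Linf_norm half_line h"
      if "Linf_norm half_line h < \<infinity>"
    proof -
      have [measurable]: "h \<in> borel_measurable half_line" using Linf_norm_measurable[OF that] .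
      show ?thesis using le[of _ h] unfolding Linf_norm_def
        by (simp, intro Linf.space_norm_mono_AE) (auto intro!: AE_I2)
    qed
  qed (use True in auto)
  have "N f = N (\<lambda>t. ?T g t + (f t - ?T g t))" by simp
  also have "\<dots> \<le> N (?T g) + N (\<lambda>t. f t - ?T g t)" by (rule N_triangle)
  also have "N (\<lambda>t. f t - ?T g t) = 0"
    using assms(2) by (intro N_null) (auto elim!: eventually_mono simp: m_def)
  finally show ?thesis using 1 by simp
qed (simp add: not_less top_unique)

text \<open>Interpolation requires an operator that is linear at every point on the whole sum space, not
  only almost everywhere. The integral meets this requirement because the kernel, for every fixed
  \<open>t\<close>, is integrable against each element of the sum space.\<close>

lemma hardy_operator:
  assumes "0 < \<delta>" "N u < \<infinity>"
  defines "T \<equiv> \<lambda>g t. \<integral>s. hardy_kernel \<delta> t s * g s \<partial>half_line"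
  shows "N (T u) \<le> ennreal (1 / \<delta>) * N u"
    and "integrable half_line (\<lambda>s. hardy_kernel \<delta> t s * u s)"
proof -
  interpret sigma_finite_measure half_line by (rule sigma_finite_half_line)
  interpret pair_sigma_finite half_line half_line ..
  let ?k = "hardy_kernel \<delta>"
  have int0: "integrable half_line (\<lambda>s. ?k t s * g s)" if g: "L1_tilde_norm g < \<infinity>" for t g
  proof -
    have [measurable]: "g \<in> borel_measurable half_line" by (rule L1_tilde_norm_measurable[OF g])
    show ?thesis
    proof (rule integrableI_bounded)
      have "ennreal (norm (?k t s * g s)) \<le> ennreal \<bar>g s\<bar> * ennreal (1 / s)" if "0 < s" for s
      proof -
        have "norm (?k t s * g s) \<le> \<bar>g s\<bar> * (1 / s)"
          using mult_left_mono[OF hardy_kernel_le[OF assms(1) that, of t], of "\<bar>g s\<bar>"]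
          by (simp add: abs_mult hardy_kernel_nonneg mult.commute)
        then have "ennreal (norm (?k t s * g s)) \<le> ennreal (\<bar>g s\<bar> * (1 / s))" by (rule ennreal_leI)
        then show ?thesis using that by (subst ennreal_mult[symmetric]) auto
      qed
      then have "(\<integral>\<^sup>+s. ennreal (norm (?k t s * g s)) \<partial>half_line) \<le> L1_tilde_norm g"
        by (subst L1_tilde_norm_eq) (auto intro!: nn_integral_mono)
      with g show "(\<integral>\<^sup>+s. ennreal (norm (?k t s * g s)) \<partial>half_line) < \<infinity>" by simp
    qed measurable
  qed
  have int1: "(\<integral>\<^sup>+s. ennreal \<bar>?k t s * g s\<bar> \<partial>half_line) \<le> ennreal (1 / \<delta>) * Linf_norm half_line g"
    if [measurable]: "g \<in> borel_measurable half_line" for t g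
  proof -
    have "AE s in half_line. ennreal \<bar>g s\<bar> \<le> Linf_norm half_line g"
      by (subst Linf_norm_le_iff[symmetric]) auto
    then have "AE s in half_line. ennreal \<bar>?k t s * g s\<bar> \<le> ennreal (?k t s) * Linf_norm half_line g"
      by eventually_elim (simp add: abs_mult ennreal_mult hardy_kernel_nonneg mult_left_mono)
    then have "(\<integral>\<^sup>+s. ennreal \<bar>?k t s * g s\<bar> \<partial>half_line) \<le>
        (\<integral>\<^sup>+s. ennreal (?k t s) * Linf_norm half_line g \<partial>half_line)"
      by (rule nn_integral_mono_AE)
    also have "\<dots> = (\<integral>\<^sup>+s. ennreal (?k t s) \<partial>half_line) * Linf_norm half_line g"
      by (rule nn_integral_multc) measurable
    also have "\<dots> \<le> ennreal (1 / \<delta>) * Linf_norm half_line g"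
      by (intro mult_right_mono nn_integral_hardy_kernel_le assms(1)) auto
    finally show ?thesis .
  qed
  have int: "integrable half_line (\<lambda>s. ?k t s * g s)"
    if g: "g \<in> sum_space L1_tilde_norm (Linf_norm half_line)" for t g
  proof -
    obtain g0 g1 where g01: "L1_tilde_norm g0 < \<infinity>" "Linf_norm half_line g1 < \<infinity>" "g = (\<lambda>x. g0 x + g1 x)"
      using g by (auto simp: sum_space_def fspace_def)
    have [measurable]: "g1 \<in> borel_measurable half_line" by (rule Linf_norm_measurable[OF g01(2)])
    have "integrable half_line (\<lambda>s. ?k t s * g1 s)"
    proof (rule integrableI_bounded)
      have "ennreal (1 / \<delta>) * Linf_norm half_line g1 < \<infinity>"
        using g01(2) by (simp add: ennreal_mult_less_top)
      with int1[of g1 t] show "(\<integral>\<^sup>+s. ennreal (norm (?k t s * g1 s)) \<partial>half_line) < \<infinity>"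
        by (simp add: le_less_trans)
    qed measurable
    from Bochner_Integration.integrable_add[OF int0[OF g01(1)] this]
    show ?thesis by (simp add: g01(3) algebra_simps)
  qed
  show "integrable half_line (\<lambda>s. ?k t s * u s)"
    by (rule int[OF N_finite_imp(1)[OF assms(2)]])
  have Tm: "T g \<in> borel_measurable half_line" if [measurable]: "g \<in> borel_measurable half_line" for g
    unfolding T_def by measurable
  \<comment> \<open>The Bochner integral of a non-integrable function is 0, so the bound holds
    without an integrability assumption on g.\<close>
  have T_le: "ennreal \<bar>T g t\<bar> \<le> (\<integral>\<^sup>+s. ennreal \<bar>?k t s * g s\<bar> \<partial>half_line)" for g t
    using integral_norm_bound_ennreal[of half_line "\<lambda>s. ?k t s * g s"]
    unfolding T_def real_norm_def
    by (cases "integrable half_line (\<lambda>s. ?k t s * g s)") (auto simp: not_integrable_integral_eq)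
  show "N (T u) \<le> ennreal (1 / \<delta>) * N u"
  proof (rule N_operator)
    have "T (\<lambda>x. a * f x + b * g x) t = a * T f t + b * T g t"
      if "f \<in> sum_space L1_tilde_norm (Linf_norm half_line)"
        "g \<in> sum_space L1_tilde_norm (Linf_norm half_line)" for a b f g t
    proof -
      have "(\<integral>s. ?k t s * (a * f s + b * g s) \<partial>half_line) =
          (\<integral>s. a * (?k t s * f s) + b * (?k t s * g s) \<partial>half_line)"
        by (simp add: algebra_simps)
      also have "\<dots> = a * (\<integral>s. ?k t s * f s \<partial>half_line) + b * (\<integral>s. ?k t s * g s \<partial>half_line)"
        using int[OF that(1), of t] int[OF that(2), of t]
        by (subst Bochner_Integration.integral_add) auto
      finally show ?thesis by (simp add: T_def)
    qed
    then show "linear_on_space (sum_space L1_tilde_norm (Linf_norm half_line)) T"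
      by (auto simp: linear_on_space_def)
    show "Linf_norm half_line (T g) \<le> ennreal (1 / \<delta>) * Linf_norm half_line g"
      if "Linf_norm half_line g < \<infinity>" for g
    proof -
      have g [measurable]: "g \<in> borel_measurable half_line" by (rule Linf_norm_measurable[OF that])
      show ?thesis
        by (subst Linf_norm_le_iff[OF Tm[OF g]])
           (auto intro!: AE_I2 order_trans[OF T_le int1])
    qed
    show "L1_tilde_norm (T g) \<le> ennreal (1 / \<delta>) * L1_tilde_norm g"
      if "L1_tilde_norm g < \<infinity>" for g
    proof -
      have g [measurable]: "g \<in> borel_measurable half_line" by (rule L1_tilde_norm_measurable[OF that])
      have "L1_tilde_norm (T g) = (\<integral>\<^sup>+t. ennreal \<bar>T g t\<bar> * ennreal (1 / t) \<partial>half_line)"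
        by (rule L1_tilde_norm_eq[OF Tm[OF g]])
      also have "\<dots> \<le> (\<integral>\<^sup>+t. (\<integral>\<^sup>+s. ennreal \<bar>?k t s * g s\<bar> \<partial>half_line) * ennreal (1 / t) \<partial>half_line)"
        by (intro nn_integral_mono mult_right_mono T_le) auto
      also have "\<dots> = (\<integral>\<^sup>+t. (\<integral>\<^sup>+s. ennreal \<bar>?k t s * g s\<bar> * ennreal (1 / t) \<partial>half_line) \<partial>half_line)"
        by (intro nn_integral_cong nn_integral_multc[symmetric]) measurable
      also have "\<dots> = (\<integral>\<^sup>+s. (\<integral>\<^sup>+t. ennreal \<bar>?k t s * g s\<bar> * ennreal (1 / t) \<partial>half_line) \<partial>half_line)"
        by (rule Fubini'[symmetric]) measurable
      also have "\<dots> = (\<integral>\<^sup>+s. (\<integral>\<^sup>+t. ennreal \<bar>g s\<bar> * (ennreal (?k t s) * ennreal (1 / t)) \<partial>half_line) \<partial>half_line)"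
        by (simp add: abs_mult ennreal_mult hardy_kernel_nonneg mult_ac)
      also have "\<dots> = (\<integral>\<^sup>+s. ennreal (1 / \<delta>) * (ennreal \<bar>g s\<bar> * ennreal (1 / s)) \<partial>half_line)"
        using nn_integral_hardy_kernel_head[OF _ assms(1)]
        by (intro nn_integral_cong, subst nn_integral_cmult) (auto simp: mult_ac)
      also have "\<dots> = ennreal (1 / \<delta>) * L1_tilde_norm g"
        by (subst nn_integral_cmult) (auto simp: L1_tilde_norm_eq)
      finally show ?thesis .
    qed
  qed (use assms in auto)
qed

lemma tilde_norm_finite_AE: "tilde_norm F g < \<infinity> \<Longrightarrow> AE t in half_line. g t < \<infinity>"
  by (auto simp: tilde_norm_def split: if_splits)

lemma tilde_norm_eq: "AE t in half_line. g t < \<infinity> \<Longrightarrow> tilde_norm F g = N (\<lambda>t. enn2real (g t))"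
  by (simp add: tilde_norm_def)

lemma tilde_norm_mono:
  assumes [measurable]: "g \<in> borel_measurable half_line"
    and le: "AE t in half_line. g t \<le> ennreal C * h t" and C: "0 < C"
  shows "tilde_norm F g \<le> ennreal C * tilde_norm F h"
proof (cases "tilde_norm F h < \<infinity>")
  case True
  note h = tilde_norm_finite_AE[OF True]
  have g: "AE t in half_line. g t < \<infinity>"
    using le h by eventually_elim (auto simp: ennreal_mult_less_top intro: le_less_trans)
  have "N (\<lambda>t. enn2real (g t)) \<le> N (\<lambda>t. C * enn2real (h t))"
  proof (rule N_mono_AE)
    show "AE t in half_line. \<bar>enn2real (g t)\<bar> \<le> \<bar>C * enn2real (h t)\<bar>"
      using le h
    proof eventually_elim
      case (elim t)
      have "enn2real (g t) \<le> enn2real (ennreal C * h t)"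
        using elim by (intro enn2real_mono) (auto simp: ennreal_mult_less_top)
      then show ?case using C by (simp add: enn2real_mult)
    qed
  qed measurable
  also have "\<dots> = ennreal C * N (\<lambda>t. enn2real (h t))" using C by (subst N_scale) auto
  finally show ?thesis by (simp only: tilde_norm_eq[OF g] tilde_norm_eq[OF h])
next
  case False
  then show ?thesis using C by (simp add: not_less top_unique ennreal_mult_top)
qed

lemma tilde_norm_add:
  "tilde_norm F (\<lambda>t. g t + h t) \<le> tilde_norm F g + tilde_norm F h"
  if [measurable]: "g \<in> borel_measurable half_line" "h \<in> borel_measurable half_line"
proof (cases "(AE t in half_line. g t < \<infinity>) \<and> (AE t in half_line. h t < \<infinity>)")
  case True
  then have ae: "AE t in half_line. g t < \<infinity>" "AE t in half_line. h t < \<infinity>" by auto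
  then have "AE t in half_line. g t + h t < \<infinity>" by eventually_elim auto
  then have "tilde_norm F (\<lambda>t. g t + h t) = N (\<lambda>t. enn2real (g t + h t))" by (rule tilde_norm_eq)
  also have "\<dots> \<le> N (\<lambda>t. enn2real (g t) + enn2real (h t))"
    using ae by (intro N_mono_AE) (auto elim!: eventually_elim2 simp: enn2real_plus)
  also have "\<dots> \<le> N (\<lambda>t. enn2real (g t)) + N (\<lambda>t. enn2real (h t))" by (rule N_triangle)
  finally show ?thesis by (simp only: tilde_norm_eq[OF ae(1)] tilde_norm_eq[OF ae(2)])
qed (auto simp: tilde_norm_def)

lemma measurable_hardy:
  assumes [measurable]: "g \<in> borel_measurable half_line"
  shows "hardy \<delta> g \<in> borel_measurable half_line"
proof -
  interpret sigma_finite_measure half_line by (rule sigma_finite_half_line)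
  show ?thesis unfolding hardy_def by measurable
qed

text \<open>Carries \<open>hardy_operator\<close> over to [0,\<infinity>]-valued functions.
  Finiteness is obtained at every \<open>t\<close>, not just almost everywhere; its value at 1 later
  yields membership in the sum space.\<close>

lemma tilde_norm_hardy:
  assumes [measurable]: "g \<in> borel_measurable half_line" and \<delta>: "0 < \<delta>"
  shows "tilde_norm F (hardy \<delta> g) \<le> ennreal (1 / \<delta>) * tilde_norm F g"
    and "tilde_norm F g < \<infinity> \<Longrightarrow> hardy \<delta> g t < \<infinity>"
proof -
  let ?u = "\<lambda>t. enn2real (g t)"
  let ?T = "\<lambda>t. \<integral>s. hardy_kernel \<delta> t s * ?u s \<partial>half_line"
  have *: "hardy \<delta> g t = ennreal (?T t)" if fin: "tilde_norm F g < \<infinity>" for t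
  proof -
    have gf: "AE t in half_line. g t < \<infinity>" by (rule tilde_norm_finite_AE[OF fin])
    have "N ?u < \<infinity>" using fin by (simp only: tilde_norm_eq[OF gf])
    from hardy_operator(2)[OF \<delta> this, of t]
    have "ennreal (?T t) = (\<integral>\<^sup>+s. ennreal (hardy_kernel \<delta> t s * ?u s) \<partial>half_line)"
      by (subst nn_integral_eq_integral) (auto intro!: AE_I2 simp: hardy_kernel_nonneg)
    also have "\<dots> = hardy \<delta> g t"
      unfolding hardy_def using gf
      by (intro nn_integral_cong_AE) (auto elim!: eventually_mono simp: ennreal_mult hardy_kernel_nonneg)
    finally show ?thesis by simp
  qed
  show "hardy \<delta> g t < \<infinity>" if "tilde_norm F g < \<infinity>"
    using *[OF that] by simp
  show "tilde_norm F (hardy \<delta> g) \<le> ennreal (1 / \<delta>) * tilde_norm F g"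
  proof (cases "tilde_norm F g < \<infinity>")
    case True
    note gf = tilde_norm_finite_AE[OF True]
    have Nu: "N ?u < \<infinity>" using True by (simp only: tilde_norm_eq[OF gf])
    have "AE t in half_line. hardy \<delta> g t < \<infinity>" using *[OF True] by (intro AE_I2) auto
    then have "tilde_norm F (hardy \<delta> g) = N (\<lambda>t. enn2real (hardy \<delta> g t))" by (rule tilde_norm_eq)
    also have "\<dots> \<le> N ?T"
    proof (rule N_mono_AE)
      show "(\<lambda>t. enn2real (hardy \<delta> g t)) \<in> borel_measurable half_line"
        using measurable_hardy[OF assms(1), of \<delta>] by measurable
      have "0 \<le> ?T t" for t by (intro integral_nonneg_AE AE_I2) (simp add: hardy_kernel_nonneg)
      then show "AE t in half_line. \<bar>enn2real (hardy \<delta> g t)\<bar> \<le> \<bar>?T t\<bar>" by (simp add: *[OF True])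
    qed
    also have "\<dots> \<le> ennreal (1 / \<delta>) * N ?u" by (rule hardy_operator(1)[OF \<delta> Nu])
    finally show ?thesis by (simp only: tilde_norm_eq[OF gf])
  next
    case False
    then show ?thesis using \<delta> by (simp add: not_less top_unique ennreal_mult_top)
  qed
qed

end

section \<open>Doubling spaces\<close>

text \<open>\<open>singleton_null\<close> is the non-atomicity behind the cutting of sets into
  nearly equal pieces.\<close>

locale doubling_space =
  fixes M :: "'a::metric_space measure" and D :: real
  assumes space_M [simp]: "space M = UNIV"
    and borel_sets: "sets borel \<subseteq> sets M"
    and ball_pos: "0 < r \<Longrightarrow> 0 < emeasure M (ball x r)"
    and ball_finite: "emeasure M (ball x r) < \<infinity>"
    and singleton_null: "emeasure M {x} = 0"
    and D_ge_1: "1 \<le> D"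
    and doubling: "0 < r \<Longrightarrow> emeasure M (ball x (2 * r)) \<le> ennreal D * emeasure M (ball x r)"
begin

abbreviation V :: "'a \<Rightarrow> real \<Rightarrow> real" where "V x r \<equiv> measure M (ball x r)"

lemma sets_ball [measurable, simp]: "ball x r \<in> sets M"
  by (rule subsetD[OF borel_sets]) simp

lemma fmeasurable_ball [simp]: "ball x r \<in> fmeasurable M"
  using ball_finite[of x r] by (auto intro: fmeasurableI)

lemma emeasure_ball: "emeasure M (ball x r) = ennreal (V x r)"
  using ball_finite[of x r] by (intro emeasure_eq_ennreal_measure) auto

lemma V_pos: "0 < r \<Longrightarrow> 0 < V x r"
  using ball_pos[of r x] by (simp add: emeasure_ball)

lemma V_mono: "ball x r \<subseteq> ball y R \<Longrightarrow> V x r \<le> V y R"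
  by (rule measure_mono_fmeasurable) auto

lemma V_doubling_pow: "0 < r \<Longrightarrow> V x (2 ^ k * r) \<le> D ^ k * V x r"
proof (induction k)
  case (Suc k)
  have "ennreal (V x (2 * (2 ^ k * r))) \<le> ennreal (D * V x (2 ^ k * r))"
    using doubling[of "2 ^ k * r" x] Suc.prems D_ge_1 by (simp add: emeasure_ball ennreal_mult)
  then have "V x (2 * (2 ^ k * r)) \<le> D * V x (2 ^ k * r)" using D_ge_1 by simp
  also have "\<dots> \<le> D * (D ^ k * V x r)" using Suc D_ge_1 by (intro mult_left_mono) auto
  finally show ?case by (simp add: mult_ac)
qed simp

text \<open>All volume comparisons below have this shape: k counts the doublings of
  \<open>ball x r\<close> needed to swallow \<open>ball y R\<close>.\<close>

lemma V_le_pow: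
  assumes "0 < r" "dist x y + R \<le> 2 ^ k * r"
  shows "V y R \<le> D ^ k * V x r"
proof -
  have "ball y R \<subseteq> ball x (2 ^ k * r)"
  proof
    fix z assume "z \<in> ball y R"
    then show "z \<in> ball x (2 ^ k * r)"
      using assms(2) dist_triangle[of x z y] by (simp add: dist_commute)
  qed
  then have "V y R \<le> V x (2 ^ k * r)" by (rule V_mono)
  also have "\<dots> \<le> D ^ k * V x r" by (rule V_doubling_pow[OF assms(1)])
  finally show ?thesis .
qed

text \<open>Packing argument: around the points of an e-separated set in the ball, the balls of
  radius e/2 are disjoint and by doubling each has a fixed fraction of the volume. So cardinalities
  are bounded, and a separated set of greatest cardinality is a net.\<close>

lemma finite_net:
  fixes x0 :: 'a
  assumes "0 < e" "0 < R"
  shows "\<exists>S. finite S \<and> ball x0 R \<subseteq> (\<Union>x\<in>S. ball x e)"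
proof -
  \<comment> \<open>For any x in \<open>ball x0 R\<close>, the ball of radius R + e about x0 lies
    within radius 2R + e of x; k counts the doublings from e/2 to there.\<close>
  obtain k :: nat where k: "(2 * R + e) / (e / 2) < 2 ^ k"
    using real_arch_pow[of 2] by auto
  define c where "c = V x0 (R + e) / D ^ k"
  have c: "0 < c" using V_pos[of "R + e" x0] assms D_ge_1 by (simp add: c_def)
  define P where "P S \<longleftrightarrow> finite S \<and> S \<subseteq> ball x0 R \<and> (\<forall>x\<in>S. \<forall>y\<in>S. x \<noteq> y \<longrightarrow> e \<le> dist x y)" for S
  have card_le: "card S \<le> nat \<lceil>D ^ k\<rceil>" if "P S" for S
  proof -
    have S: "finite S" "S \<subseteq> ball x0 R" "\<And>x y. x \<in> S \<Longrightarrow> y \<in> S \<Longrightarrow> x \<noteq> y \<Longrightarrow> e \<le> dist x y"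
      using that by (auto simp: P_def)
    have "c \<le> V x (e / 2)" if "x \<in> S" for x
    proof -
      have "dist x x0 < R" using S(2) that by (auto simp: dist_commute)
      then have "V x0 (R + e) \<le> D ^ k * V x (e / 2)"
        using assms k by (intro V_le_pow) (auto simp: field_simps)
      then show ?thesis using D_ge_1 by (simp add: c_def field_simps)
    qed
    then have "(\<Sum>x\<in>S. c) \<le> (\<Sum>x\<in>S. V x (e / 2))" by (intro sum_mono) auto
    also have "\<dots> = measure M (\<Union>x\<in>S. ball x (e / 2))"
    proof (rule measure_finite_Union[symmetric])
      show "disjoint_family_on (\<lambda>x. ball x (e / 2)) S"
        unfolding disjoint_family_on_def
      proof (intro ballI impI)
        fix x y assume xy: "x \<in> S" "y \<in> S" "x \<noteq> y"
        show "ball x (e / 2) \<inter> ball y (e / 2) = {}"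
        proof (rule ccontr)
          assume "\<not> ?thesis"
          then obtain z where "dist x z < e / 2" "dist y z < e / 2" by auto
          then show False using S(3)[OF xy] dist_triangle[of x y z] by (simp add: dist_commute)
        qed
      qed
      show "emeasure M (ball x (e / 2)) \<noteq> \<infinity>" for x using ball_finite[of x "e / 2"] by auto
    qed (use S in auto)
    also have "\<dots> \<le> V x0 (R + e)"
    proof (rule measure_mono_fmeasurable)
      show "(\<Union>x\<in>S. ball x (e / 2)) \<subseteq> ball x0 (R + e)"
      proof
        fix z assume "z \<in> (\<Union>x\<in>S. ball x (e / 2))"
        then obtain x where "x \<in> S" "dist x z < e / 2" by auto
        then show "z \<in> ball x0 (R + e)"
          using S(2) dist_triangle[of x0 z x] assms by (auto dest!: subsetD)
      qed
      show "(\<Union>x\<in>S. ball x (e / 2)) \<in> sets M" using S(1) by auto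
    qed auto
    finally have "real (card S) * c \<le> D ^ k * c" using D_ge_1 by (simp add: c_def)
    then have "real (card S) \<le> D ^ k" using c by simp
    then show ?thesis by linarith
  qed
  have "P {}" by (simp add: P_def)
  from ex_has_greatest_nat[of P, OF this, of card "Suc (nat \<lceil>D ^ k\<rceil>)"] card_le
  have "\<exists>S. P S \<and> (\<forall>S'. P S' \<longrightarrow> card S' \<le> card S)" by (simp add: less_Suc_eq_le)
  then obtain S where S: "P S" "\<And>S'. P S' \<Longrightarrow> card S' \<le> card S" by auto
  have "ball x0 R \<subseteq> (\<Union>x\<in>S. ball x e)"
  proof (rule ccontr)
    assume "\<not> ?thesis"
    then obtain z where "z \<in> ball x0 R" "z \<notin> (\<Union>x\<in>S. ball x e)" by blast
    then have z: "z \<in> ball x0 R" "\<And>x. x \<in> S \<Longrightarrow> e \<le> dist x z" by (auto simp: not_less)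
    have "z \<notin> S" using z(2)[of z] assms by auto
    moreover have "P (insert z S)" using S(1) z by (auto simp: P_def dist_commute)
    ultimately show False using S(1) S(2)[of "insert z S"] by (simp add: P_def)
  qed
  then show ?thesis using S(1) by (auto simp: P_def)
qed

text \<open>The type is merely a metric space. Separability comes from nets of mesh 1/(n+1) in the
  balls of radius m+1 about one arbitrary point.\<close>

lemma dense_sequence: "\<exists>q :: nat \<Rightarrow> 'a. \<forall>x. \<forall>e>0. \<exists>i. dist (q i) x < e"
proof -
  define x0 :: 'a where "x0 = undefined"
  have "\<forall>n m. \<exists>S. finite S \<and> ball x0 (real (Suc m)) \<subseteq> (\<Union>x\<in>S. ball x (1 / real (Suc n)))"
    by (intro allI finite_net) auto
  then obtain S where S: "\<And>n m. finite (S n m)"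
    "\<And>n m. ball x0 (real (Suc m)) \<subseteq> (\<Union>x\<in>S n m. ball x (1 / real (Suc n)))" by metis
  define Q where "Q = (\<Union>n m. S n m)"
  have "countable (S n m)" for n m by (rule countable_finite[OF S(1)])
  then have Qc: "countable Q" unfolding Q_def by (intro countable_UN) auto
  have ex: "\<exists>y\<in>Q. dist y x < e" if e: "0 < e" for x e
  proof -
    obtain n where n: "1 / real (Suc n) < e" using nat_approx_posE[OF e] by blast
    obtain m where "dist x0 x < real m" using reals_Archimedean2 by auto
    then have "x \<in> ball x0 (real (Suc m))" by auto
    then obtain y where "y \<in> S n m" "dist y x < 1 / real (Suc n)" using S(2)[of m n] by auto
    then show ?thesis using n by (intro bexI[of _ y]) (auto simp: Q_def)
  qed
  have "Q \<noteq> {}" using ex[where e = 1 and x = x0] by auto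
  then have "range (from_nat_into Q) = Q" using Qc by (rule range_from_nat_into)
  then show ?thesis using ex by (intro exI[of _ "from_nat_into Q"]) (metis rangeE)
qed

definition q :: "nat \<Rightarrow> 'a" where "q = (SOME q. \<forall>x. \<forall>e>0. \<exists>i. dist (q i) x < e)"

lemma q_dense: "0 < e \<Longrightarrow> \<exists>i. dist (q i) x < e"
  using someI_ex[OF dense_sequence] unfolding q_def by blast

lemma sigma_finite_M: "sigma_finite_measure M"
proof
  let ?A = "range (\<lambda>i. ball (q i) 1)"
  have "x \<in> \<Union>?A" for x using q_dense[of 1 x] by auto
  then have "\<Union>?A = space M" by auto
  moreover have "emeasure M (ball (q i) 1) \<noteq> \<infinity>" for i using ball_finite[of "q i" 1] by auto
  ultimately show "\<exists>A. countable A \<and> A \<subseteq> sets M \<and> \<Union>A = space M \<and> (\<forall>a\<in>A. emeasure M a \<noteq> \<infinity>)"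
    by (intro exI[of _ ?A]) auto
qed

sublocale sigma_finite_measure M by (rule sigma_finite_M)

sublocale pair: pair_sigma_finite M M ..

text \<open>Measurability refers to the product \<sigma>-algebra, so the set d(x,y) < a has to be a
  countable union of rectangles. By density some \<open>q i\<close> and rational r satisfy d(q i, x)
  < r and d(q i, y) < a - r exactly when d(x,y) < a.\<close>

lemma measurable_dist_pair [measurable]: "(\<lambda>p. dist (fst p) (snd p)) \<in> borel_measurable (M \<Otimes>\<^sub>M M)"
proof (rule borel_measurable_iff_less[THEN iffD2], rule allI)
  fix a :: real
  define R where "R = (\<Union>i. \<Union>r\<in>\<rat>. ball (q i) r \<times> ball (q i) (a - r))"
  have "p \<in> R \<longleftrightarrow> dist (fst p) (snd p) < a" for p
  proof
    assume "p \<in> R"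
    then have "\<exists>i. \<exists>r\<in>\<rat>. p \<in> ball (q i) r \<times> ball (q i) (a - r)"
      unfolding R_def by (simp only: UN_iff UNIV_I simp_thms bex_simps)
    then obtain i r where "p \<in> ball (q i) r \<times> ball (q i) (a - r)" by (elim exE bexE)
    then have "dist (q i) (fst p) < r" "dist (q i) (snd p) < a - r" by (simp_all add: mem_Times_iff)
    then show "dist (fst p) (snd p) < a" using dist_triangle[of "fst p" "snd p" "q i"]
      by (simp add: dist_commute)
  next
    assume p: "dist (fst p) (snd p) < a"
    define e where "e = (a - dist (fst p) (snd p)) / 2"
    have e: "0 < e" using p by (simp add: e_def)
    obtain i where i: "dist (q i) (fst p) < e" using q_dense[OF e] by blast
    obtain r where r: "r \<in> \<rat>" "dist (q i) (fst p) < r" "r < e" using Rats_dense_in_real[OF i] by auto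
    have "dist (q i) (snd p) < a - r"
      using dist_triangle[of "q i" "snd p" "fst p"] i r by (simp add: e_def field_simps)
    then have "p \<in> ball (q i) r \<times> ball (q i) (a - r)" using r by (simp add: mem_Times_iff)
    then show "p \<in> R" unfolding R_def using r(1) by (intro UN_I[of i] UN_I[of r] UNIV_I)
  qed
  then have "{p \<in> space (M \<Otimes>\<^sub>M M). dist (fst p) (snd p) < a} = R"
    by (auto simp: space_pair_measure)
  moreover have "R \<in> sets (M \<Otimes>\<^sub>M M)"
    unfolding R_def by (intro sets.countable_UN'' countable_rat) auto
  ultimately show "{p \<in> space (M \<Otimes>\<^sub>M M). dist (fst p) (snd p) < a} \<in> sets (M \<Otimes>\<^sub>M M)" by simp
qed

lemma measurable_dist_compose [measurable (raw)]:
  assumes "f \<in> measurable L M" "g \<in> measurable L M"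
  shows "(\<lambda>x. dist (f x) (g x)) \<in> borel_measurable L"
  using measurable_compose[OF measurable_Pair[OF assms] measurable_dist_pair] by simp

lemma measurable_V [measurable]: "(\<lambda>x. emeasure M (ball x t)) \<in> borel_measurable M"
proof -
  have eq: "emeasure M (ball x t) = (\<integral>\<^sup>+y. (if dist x y < t then 1 else 0) \<partial>M)" for x
  proof -
    have "emeasure M (ball x t) = (\<integral>\<^sup>+y. indicator (ball x t) y \<partial>M)" by simp
    also have "\<dots> = (\<integral>\<^sup>+y. (if dist x y < t then 1 else 0) \<partial>M)"
      by (intro nn_integral_cong) (simp add: indicator_def)
    finally show ?thesis .
  qed
  show ?thesis unfolding eq by measurable
qed

text \<open>Balls shrinking to a point have measure tending to that of the point, which is 0. So
  every point lies in an arbitrarily small ball centred at some \<open>q i\<close>; balls that are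
  too large are replaced by the empty set.\<close>

lemma small_cover:
  assumes "0 < (e::ennreal)"
  shows "\<exists>W :: nat \<Rightarrow> 'a set. (\<forall>n. W n \<in> sets M \<and> emeasure M (W n) \<le> e) \<and> (\<Union>n. W n) = UNIV"
proof -
  define B where "B n = (case prod_decode n of (i, j) \<Rightarrow> ball (q i) (1 / real (Suc j)))" for n
  define W where "W n = (if emeasure M (B n) \<le> e then B n else {})" for n
  have Bs: "B n \<in> sets M" for n by (cases "prod_decode n") (simp add: B_def)
  have "x \<in> (\<Union>n. W n)" for x
  proof -
    have "(\<lambda>k. emeasure M (ball x (1 / real (Suc k)))) \<longlonglongrightarrow> emeasure M (\<Inter>k. ball x (1 / real (Suc k)))"
    proof (rule Lim_emeasure_decseq)
      show "decseq (\<lambda>k. ball x (1 / real (Suc k)))"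
        by (intro decseq_SucI subset_ball) (simp add: field_simps)
      show "emeasure M (ball x (1 / real (Suc k))) \<noteq> \<infinity>" for k
        using ball_finite[of x "1 / real (Suc k)"] by auto
    qed auto
    also have "(\<Inter>k. ball x (1 / real (Suc k))) = {x}"
    proof -
      have "y = x" if "\<And>k. dist x y < 1 / real (Suc k)" for y
      proof (rule ccontr)
        assume "y \<noteq> x"
        then obtain n where "1 / real (Suc n) < dist x y" by (metis nat_approx_posE zero_less_dist_iff)
        with that[of n] show False by simp
      qed
      then show ?thesis by auto
    qed
    finally have "eventually (\<lambda>k. emeasure M (ball x (1 / real (Suc k))) < e) sequentially"
      using assms by (intro order_tendstoD(2)) (auto simp: singleton_null)
    then obtain k where k: "emeasure M (ball x (1 / real (Suc k))) < e"
      by (auto simp: eventually_sequentially)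
    \<comment> \<open>Twice as fine, because the ball is centred at \<open>q i\<close> instead of x
      and may reach 2/(j+1) away from x.\<close>
    define j where "j = 2 * Suc k"
    have j: "2 / real (Suc j) \<le> 1 / real (Suc k)" by (simp add: j_def field_simps)
    obtain i where i: "dist (q i) x < 1 / real (Suc j)" using q_dense[of "1 / real (Suc j)"] by auto
    have Bn: "B (prod_encode (i, j)) = ball (q i) (1 / real (Suc j))" by (simp add: B_def)
    have "B (prod_encode (i, j)) \<subseteq> ball x (1 / real (Suc k))"
    proof
      fix z assume "z \<in> B (prod_encode (i, j))"
      then have "dist (q i) z < 1 / real (Suc j)" by (simp add: Bn)
      then show "z \<in> ball x (1 / real (Suc k))"
        using i j dist_triangle[of x z "q i"] by (simp add: dist_commute)
    qed
    then have "emeasure M (B (prod_encode (i, j))) \<le> e"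
      using k by (intro order_trans[OF emeasure_mono less_imp_le]) auto
    then have "x \<in> W (prod_encode (i, j))" using i by (simp add: W_def Bn)
    then show ?thesis by blast
  qed
  then have "(\<Union>n. W n) = UNIV" by auto
  then show ?thesis using Bs by (intro exI[of _ W]) (auto simp: W_def)
qed

text \<open>A set of finite measure is cut into \<open>N\<close> pieces of nearly equal measure by running through a
  cover by small sets and labelling each of them according to the measure accumulated before it.\<close>

lemma equipartition:
  assumes A [measurable]: "A \<in> sets M" and fin: "emeasure M A < \<infinity>" and "0 < (N::nat)"
  shows "\<exists>lab :: 'a \<Rightarrow> nat. lab \<in> measurable M (count_space UNIV) \<and> (\<forall>x. lab x < N) \<and>
    (\<forall>k. measure M {x \<in> A. lab x = k} \<le> 2 / real N * measure M A)"
proof (cases "measure M A = 0")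
  case True
  have "measure M {x \<in> A. (0::nat) = k} \<le> 2 / real N * measure M A" for k
    using True by (cases "k = 0") auto
  then show ?thesis using \<open>0 < N\<close> by (intro exI[of _ "\<lambda>_. 0"]) auto
next
  case False
  define m where "m = measure M A"
  have m: "0 < m" using False by (simp add: m_def zero_less_measure_iff)
  define e where "e = m / real N"
  have e: "0 < e" using m \<open>0 < N\<close> by (simp add: e_def)
  have e': "0 < ennreal e" using e by simp
  obtain W :: "nat \<Rightarrow> 'a set" where W0: "\<forall>n. W n \<in> sets M \<and> emeasure M (W n) \<le> ennreal e"
    and WU: "(\<Union>n. W n) = UNIV"
    using small_cover[OF e'] by auto
  have W [measurable]: "W n \<in> sets M" and We: "emeasure M (W n) \<le> ennreal e" for n
    using W0 by auto
  define J where "J x = (LEAST n. x \<in> W n)" for x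
  have J: "x \<in> W (J x)" "j < J x \<Longrightarrow> x \<notin> W j" for x j
  proof -
    have "\<exists>n. x \<in> W n" using WU by blast
    then show "x \<in> W (J x)" unfolding J_def by (rule LeastI_ex)
    show "x \<notin> W j" if "j < J x" using that unfolding J_def by (rule not_less_Least)
  qed
  have Jm [measurable]: "J \<in> measurable M (count_space UNIV)" unfolding J_def by measurable
  have Af: "A \<in> fmeasurable M" using fin by (auto intro: fmeasurableI)
  define u where "u n = measure M (A \<inter> (\<Union>j<n. W j))" for n
  have uf: "A \<inter> (\<Union>j<n. W j) \<in> fmeasurable M" for n
    by (intro fmeasurable_Int_fmeasurable[OF Af]) auto
  have u_le: "u n \<le> m" for n unfolding u_def m_def by (intro measure_mono_fmeasurable Af) (use uf in auto)
  have u_Suc: "u (Suc n) \<le> u n + e" for n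
  proof -
    have "W n \<in> fmeasurable M" using We[of n] by (intro fmeasurableI) (auto intro: le_less_trans)
    have "u (Suc n) \<le> measure M ((A \<inter> (\<Union>j<n. W j)) \<union> W n)"
      unfolding u_def by (intro measure_mono_fmeasurable fmeasurable.Un uf \<open>W n \<in> fmeasurable M\<close>)
        (auto simp: lessThan_Suc)
    also have "\<dots> \<le> u n + measure M (W n)"
      unfolding u_def by (intro measure_Un_le) auto
    also have "measure M (W n) \<le> e"
      using We[of n] e by (simp add: measure_def enn2real_leI)
    finally show ?thesis by simp
  qed
  \<comment> \<open>The quotient reaches N when all of A has been accumulated; the minimum keeps
    labels below N.\<close>
  define l where "l n = min (N - 1) (nat \<lfloor>u n / e\<rfloor>)" for n
  have l_bounds: "real k * e \<le> u n" "u n \<le> real (Suc k) * e" if "l n = k" for n k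
  proof -
    have u0: "0 \<le> u n" by (simp add: u_def)
    have "real k \<le> real (nat \<lfloor>u n / e\<rfloor>)" using that by (auto simp: l_def)
    also have "\<dots> \<le> u n / e" using u0 e by (intro of_nat_floor) auto
    finally have "real k \<le> u n / e" .
    then show "real k * e \<le> u n" using e by (simp add: field_simps)
    have "u n / e \<le> real (Suc k)"
    proof (cases "k = nat \<lfloor>u n / e\<rfloor>")
      case True
      then show ?thesis by linarith
    next
      case False
      then have "k = N - 1" using that by (auto simp: l_def min_def split: if_splits)
      then have "real (Suc k) = real N" using \<open>0 < N\<close> by simp
      moreover have "u n / e \<le> m / e" using u_le[of n] e by (intro divide_right_mono) auto
      moreover have "m / e = real N" using m \<open>0 < N\<close> by (simp add: e_def)
      ultimately show ?thesis by simp
    qed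
    then show "u n \<le> real (Suc k) * e" using e by (simp add: field_simps)
  qed
  have bound: "measure M {x \<in> A. l (J x) = k} \<le> 2 / real N * measure M A" for k
  proof -
    \<comment> \<open>Infinitely many indices may carry the label k. Cutting at n provides a first
      and a last one; the limit in n is taken at the end.\<close>
    let ?S = "\<lambda>n. {x \<in> A. l (J x) = k \<and> J x \<le> n}"
    have "measure M (?S n) \<le> 2 * e" for n
    proof (cases "\<exists>i\<le>n. l i = k")
      case False
      then have S0: "?S n = {}" by auto
      show ?thesis unfolding S0 using e by simp
    next
      case True
      define I where "I = {i. i \<le> n \<and> l i = k}"
      have I: "finite I" "I \<noteq> {}" using True by (auto simp: I_def)
      define n0 n1 where "n0 = Min I" and "n1 = Max I"
      have n01: "l n0 = k" "l n1 = k" "n0 \<le> n1"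
        using Min_in[OF I] Max_in[OF I] Min_le[OF I(1) Max_in[OF I]] by (auto simp: I_def n0_def n1_def)
      have "?S n \<subseteq> (A \<inter> (\<Union>j<Suc n1. W j)) - (A \<inter> (\<Union>j<n0. W j))"
      proof
        fix x assume x: "x \<in> ?S n"
        then have "J x \<in> I" by (simp add: I_def)
        then have "n0 \<le> J x" "J x \<le> n1" using I by (auto simp: n0_def n1_def)
        then show "x \<in> (A \<inter> (\<Union>j<Suc n1. W j)) - (A \<inter> (\<Union>j<n0. W j))"
          using x J[where x = x] by (auto simp: less_Suc_eq_le)
      qed
      then have "measure M (?S n) \<le> measure M ((A \<inter> (\<Union>j<Suc n1. W j)) - (A \<inter> (\<Union>j<n0. W j)))"
        using uf[of "Suc n1"] uf[of n0] by (intro measure_mono_fmeasurable fmeasurable.Diff) auto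
      also have "\<dots> = u (Suc n1) - u n0"
      proof -
        have "{..<n0} \<subseteq> {..<Suc n1}" using \<open>n0 \<le> n1\<close> by auto
        then have "A \<inter> (\<Union>j<n0. W j) \<subseteq> A \<inter> (\<Union>j<Suc n1. W j)" by (intro Int_mono UN_mono) auto
        then show ?thesis
          unfolding u_def using uf[of "Suc n1"] uf[of n0] by (intro measure_Diff) (auto simp: fmeasurable_def)
      qed
      \<comment> \<open>Between indices of label k the accumulated measure grows by at most e, and
        the last set of the cover adds at most e more. This is the factor 2.\<close>
      also have "\<dots> \<le> (real (Suc k) * e + e) - real k * e"
        using u_Suc[of n1] l_bounds(2)[OF n01(2)] l_bounds(1)[OF n01(1)] by linarith
      finally show ?thesis by (simp add: algebra_simps)
    qed
    moreover have "(\<lambda>n. measure M (?S n)) \<longlonglongrightarrow> measure M (\<Union>n. ?S n)"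
    proof (rule Lim_measure_incseq)
      show "incseq ?S" by (auto simp: incseq_def)
      have "emeasure M (\<Union>n. ?S n) \<le> emeasure M A" by (intro emeasure_mono) auto
      then show "emeasure M (\<Union>n. ?S n) \<noteq> \<infinity>" using fin by auto
      have "?S n \<in> sets M" for n by measurable
      then show "range ?S \<subseteq> sets M" by auto
    qed
    ultimately have "measure M (\<Union>n. ?S n) \<le> 2 * e" by (intro LIMSEQ_le_const2) auto
    moreover have "(\<Union>n. ?S n) = {x \<in> A. l (J x) = k}" by auto
    ultimately show ?thesis by (simp add: e_def m_def)
  qed
  have "(\<lambda>x. l (J x)) \<in> measurable M (count_space UNIV)" by measurable
  moreover have "l (J x) < N" for x using \<open>0 < N\<close> by (auto simp: l_def)
  ultimately show ?thesis using bound by (intro exI[of _ "\<lambda>x. l (J x)"]) auto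
qed

end

section \<open>Averaging operators on rearrangement invariant spaces\<close>

text \<open>A smaller distribution function admits more levels in the infimum that defines the
  rearrangement. Norm comparisons can then be made through measures of superlevel sets.\<close>

lemma ri_space_le:
  assumes ri: "ri_space M \<rho>" and fg: "f \<in> borel_measurable M" "g \<in> borel_measurable M"
    and fin: "\<rho> g < \<infinity>"
    and le: "\<And>s. emeasure M {x \<in> space M. s < f x} \<le> emeasure M {x \<in> space M. s < g x}"
  shows "\<rho> f \<le> \<rho> g"
proof -
  have "decr_rearrangement M f s \<le> decr_rearrangement M g s" for s
    unfolding decr_rearrangement_def
    by (rule Inf_superset_mono) (use order_trans[OF le] in auto)
  then show ?thesis
    using conjunct2[OF ri[unfolded ri_space_def], rule_format, OF fg fin] by simp
qed

lemma emeasure_lborel_ennreal_below: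
  "emeasure lborel {s::real. 0 < s \<and> ennreal s < c} = c"
  "emeasure lborel {s::real. 0 < s \<and> ennreal s \<le> c} = c"
proof -
  have top: "emeasure lborel {0::real<..} = top"
  proof -
    have "of_nat n \<le> emeasure lborel {0::real<..}" for n
    proof -
      have "emeasure lborel {0<..real n} \<le> emeasure lborel {0::real<..}"
        by (rule emeasure_mono) auto
      then show ?thesis by (simp add: ennreal_of_nat_eq_real_of_nat)
    qed
    then have "(SUP n. of_nat n) \<le> emeasure lborel {0::real<..}" by (rule SUP_least)
    then show ?thesis by (simp add: ennreal_SUP_of_nat_eq_top top_unique)
  qed
  show "emeasure lborel {s::real. 0 < s \<and> ennreal s < c} = c"
  proof (cases c)
    case (real r)
    then have "{s. 0 < s \<and> ennreal s < c} = {0<..<r}" by (auto simp: ennreal_less_iff)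
    then show ?thesis using real by simp
  next
    case c: top
    then have "{s::real. 0 < s \<and> ennreal s < c} = {0<..}" by auto
    then show ?thesis using top c by simp
  qed
  show "emeasure lborel {s::real. 0 < s \<and> ennreal s \<le> c} = c"
  proof (cases c)
    case (real r)
    then have "{s. 0 < s \<and> ennreal s \<le> c} = {0<..r}" by (auto simp: ennreal_le_iff)
    then show ?thesis using real by simp
  next
    case c: top
    then have "{s::real. 0 < s \<and> ennreal s \<le> c} = {0<..}" by auto
    then show ?thesis using top c by simp
  qed
qed

lemma (in sigma_finite_measure) nn_integral_layer_cake:
  assumes [measurable]: "f \<in> borel_measurable M"
  shows "(\<integral>\<^sup>+x. f x \<partial>M) = (\<integral>\<^sup>+s. emeasure M {x \<in> space M. ennreal s < f x} * indicator {0<..} s \<partial>lborel)"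
proof -
  interpret P: pair_sigma_finite lborel M ..
  have "(\<integral>\<^sup>+x. f x \<partial>M) = (\<integral>\<^sup>+x. (\<integral>\<^sup>+s. (if 0 < s \<and> ennreal s < f x then 1 else 0) \<partial>lborel) \<partial>M)"
  proof (rule nn_integral_cong)
    fix x
    have "f x = (\<integral>\<^sup>+s. indicator {s. 0 < s \<and> ennreal s < f x} s \<partial>lborel)"
      by (subst nn_integral_indicator) (auto simp: emeasure_lborel_ennreal_below)
    also have "\<dots> = (\<integral>\<^sup>+s. (if 0 < s \<and> ennreal s < f x then 1 else 0) \<partial>lborel)"
      by (intro nn_integral_cong) (simp add: indicator_def)
    finally show "f x = (\<integral>\<^sup>+s. (if 0 < s \<and> ennreal s < f x then 1 else 0) \<partial>lborel)" .
  qed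
  also have "\<dots> = (\<integral>\<^sup>+s. (\<integral>\<^sup>+x. (if 0 < s \<and> ennreal s < f x then 1 else 0) \<partial>M) \<partial>lborel)"
    by (rule P.Fubini') measurable
  also have "\<dots> = (\<integral>\<^sup>+s. emeasure M {x \<in> space M. ennreal s < f x} * indicator {0<..} s \<partial>lborel)"
  proof (rule nn_integral_cong)
    fix s :: real
    have "(\<integral>\<^sup>+x. (if 0 < s \<and> ennreal s < f x then 1 else 0) \<partial>M) =
        (\<integral>\<^sup>+x. indicator {x \<in> space M. ennreal s < f x} x * indicator {0<..} s \<partial>M)"
      by (intro nn_integral_cong) (auto simp: indicator_def)
    also have "\<dots> = emeasure M {x \<in> space M. ennreal s < f x} * indicator {0<..} s"
      by (subst nn_integral_multc) auto
    finally show "(\<integral>\<^sup>+x. (if 0 < s \<and> ennreal s < f x then 1 else 0) \<partial>M) =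
        emeasure M {x \<in> space M. ennreal s < f x} * indicator {0<..} s" .
  qed
  finally show ?thesis .
qed

lemma divide_ennreal_eq_times: "0 < v \<Longrightarrow> y / ennreal v = ennreal (1 / v) * y"
  by (simp add: divide_ennreal_def inverse_ennreal mult.commute inverse_eq_divide)

lemma bij_betw_shift_mod:
  assumes "0 < (N::nat)"
  shows "bij_betw (\<lambda>k. (k + \<sigma>) mod N) {..<N} {..<N}"
proof -
  have "inj_on (\<lambda>k. (k + \<sigma>) mod N) {..<N}"
  proof (rule linorder_inj_onI)
    fix k l assume "k < l" and kl: "k \<in> {..<N}" "l \<in> {..<N}"
    show "(k + \<sigma>) mod N \<noteq> (l + \<sigma>) mod N"
    proof
      assume "(k + \<sigma>) mod N = (l + \<sigma>) mod N"
      then have "N dvd (l + \<sigma>) - (k + \<sigma>)" using \<open>k < l\<close> by (metis add_le_mono1 less_imp_le mod_eq_dvd_iff_nat)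
      then have "N dvd l - k" by simp
      then show False using \<open>k < l\<close> kl by (auto dest!: dvd_imp_le)
    qed
  qed auto
  moreover have "(\<lambda>k. (k + \<sigma>) mod N) ` {..<N} \<subseteq> {..<N}" using assms by auto
  ultimately show ?thesis by (simp add: bij_betw_def endo_inj_surj)
qed

text \<open>A generalised inverse. For \<open>m\<close> the normalised distribution function of f on
  a ball, it is the decreasing rearrangement of f on that ball at the fraction \<open>a\<close> of
  its measure.\<close>

definition quantile :: "(ennreal \<Rightarrow> real) \<Rightarrow> real \<Rightarrow> ennreal" where
  "quantile m a = Inf {u. m u \<le> a}"

text \<open>If s lies below the infimum, then m s exceeds (k+1) L / N, which leaves at most N m s /
  L values of k.\<close>

lemma card_quantile_greater:
  assumes "0 < L" "0 < (N::nat)" "0 \<le> m s"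
  shows "real (card {k. k < N \<and> s < quantile m (real (Suc k) * L / real N)}) \<le> real N * m s / L"
proof -
  let ?z = "real N * m s / L"
  have "{k. k < N \<and> s < quantile m (real (Suc k) * L / real N)} \<subseteq> {..<nat \<lfloor>?z\<rfloor>}"
  proof
    fix k assume "k \<in> {k. k < N \<and> s < quantile m (real (Suc k) * L / real N)}"
    moreover have "quantile m (real (Suc k) * L / real N) \<le> s" if "m s \<le> real (Suc k) * L / real N"
      unfolding quantile_def by (rule Inf_lower) (use that in simp)
    ultimately have "\<not> m s \<le> real (Suc k) * L / real N" by auto
    then have "real (Suc k) < ?z" using assms by (simp add: field_simps)
    then show "k \<in> {..<nat \<lfloor>?z\<rfloor>}" by (simp only: lessThan_iff) linarith
  qed
  then have "card {k. k < N \<and> s < quantile m (real (Suc k) * L / real N)} \<le> nat \<lfloor>?z\<rfloor>"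
    by (metis card_lessThan card_mono finite_lessThan)
  also have "real (nat \<lfloor>?z\<rfloor>) \<le> ?z" using assms by (intro of_nat_floor) auto
  finally show ?thesis by simp
qed

text \<open>Every k with (k+1) L / N < m s qualifies by monotonicity, and m s \<le> 1 \<le> L keeps
  such k below N. Since indices start at k + 1 and the bound is rounded, one index may be
  lost.\<close>

lemma card_quantile_at_least:
  assumes "0 < (N::nat)" "m s \<le> 1" "1 \<le> L" and "antimono m"
  shows "real N * m s / L - 1 \<le> real (card {k. k < N \<and> s \<le> quantile m (real (Suc k) * L / real N)})"
proof -
  let ?z = "real N * m s / L"
  have "{..<nat (\<lceil>?z\<rceil> - 1)} \<subseteq> {k. k < N \<and> s \<le> quantile m (real (Suc k) * L / real N)}"
  proof
    fix k assume "k \<in> {..<nat (\<lceil>?z\<rceil> - 1)}"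
    then have k: "real (Suc k) < ?z" by (simp only: lessThan_iff) linarith
    have "real N * m s \<le> real N * L" using assms by (intro mult_left_mono) auto
    then have "?z \<le> real N" using assms by (simp add: field_simps)
    with k have "k < N" by linarith
    have k': "real (Suc k) * L / real N < m s" using k assms by (simp add: field_simps)
    have "s \<le> u" if "m u \<le> real (Suc k) * L / real N" for u
    proof (rule ccontr)
      assume "\<not> s \<le> u"
      then have "m s \<le> m u" using antimonoD[OF assms(4), of u s] by simp
      with that k' show False by linarith
    qed
    then show "k \<in> {k. k < N \<and> s \<le> quantile m (real (Suc k) * L / real N)}"
      unfolding quantile_def using \<open>k < N\<close> by (auto intro: Inf_greatest)
  qed
  then have "nat (\<lceil>?z\<rceil> - 1) \<le> card {k. k < N \<and> s \<le> quantile m (real (Suc k) * L / real N)}"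
    by (subst card_lessThan[symmetric], intro card_mono) auto
  moreover have "?z - 1 \<le> real (nat (\<lceil>?z\<rceil> - 1))" by linarith
  ultimately show ?thesis by linarith
qed

text \<open>Each quantile is the length of the interval of levels below it, so the sum is the
  integral over s of the number of quantiles at least s. The index lost in the count appears as the
  shift L / N, which disappears as N grows.\<close>

lemma sum_quantile_ge:
  assumes N: "0 < (N::nat)" and m: "\<And>s. m s \<le> 1" "antimono m" and L: "1 \<le> L"
    and [measurable]: "(\<lambda>s. m (ennreal s)) \<in> borel_measurable borel"
  shows "ennreal (real N / L) * (\<integral>\<^sup>+s. ennreal (m (ennreal s) - L / real N) * indicator {0<..} s \<partial>lborel)
    \<le> (\<Sum>k<N. quantile m (real (Suc k) * L / real N))"
proof -
  let ?c = "\<lambda>k. quantile m (real (Suc k) * L / real N)"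
  have "ennreal (real N / L) * (\<integral>\<^sup>+s. ennreal (m (ennreal s) - L / real N) * indicator {0<..} s \<partial>lborel) =
      (\<integral>\<^sup>+s. ennreal (real N / L) * (ennreal (m (ennreal s) - L / real N) * indicator {0<..} s) \<partial>lborel)"
    by (rule nn_integral_cmult[symmetric]) measurable
  also have "\<dots> \<le> (\<integral>\<^sup>+s. (\<Sum>k<N. indicator {s. 0 < s \<and> ennreal s \<le> ?c k} s) \<partial>lborel)"
  proof (rule nn_integral_mono)
    fix s :: real
    show "ennreal (real N / L) * (ennreal (m (ennreal s) - L / real N) * indicator {0<..} s) \<le>
        (\<Sum>k<N. indicator {s. 0 < s \<and> ennreal s \<le> ?c k} s)"
    proof (cases "0 < s")
      case True
      have "ennreal (real N / L) * ennreal (m (ennreal s) - L / real N) =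
          ennreal (real N / L * (m (ennreal s) - L / real N))"
        using N L by (subst ennreal_mult') auto
      also have "real N / L * (m (ennreal s) - L / real N) = real N * m (ennreal s) / L - 1"
        using N L by (simp add: field_simps)
      also have "ennreal \<dots> \<le> ennreal (real (card {k. k < N \<and> ennreal s \<le> ?c k}))"
        by (intro ennreal_leI card_quantile_at_least N m L)
      also have "\<dots> = (\<Sum>k\<in>{k. k < N \<and> ennreal s \<le> ?c k}. 1)"
        by (simp add: ennreal_of_nat_eq_real_of_nat)
      also have "\<dots> = (\<Sum>k<N. indicator {s. 0 < s \<and> ennreal s \<le> ?c k} s)"
        using True by (intro sum.mono_neutral_cong_left) (auto simp: indicator_def)
      finally show ?thesis using True by simp
    qed simp
  qed
  also have "\<dots> = (\<Sum>k<N. \<integral>\<^sup>+s. indicator {s. 0 < s \<and> ennreal s \<le> ?c k} s \<partial>lborel)"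
    by (rule nn_integral_sum) measurable
  also have "\<dots> = (\<Sum>k<N. ?c k)"
  proof (rule sum.cong)
    fix k
    have "{s. 0 < s \<and> ennreal s \<le> ?c k} \<in> sets lborel" by measurable
    then show "(\<integral>\<^sup>+s. indicator {s. 0 < s \<and> ennreal s \<le> ?c k} s \<partial>lborel) = ?c k"
      by (simp add: emeasure_lborel_ennreal_below)
  qed simp
  finally show ?thesis .
qed

locale doubling_ri_space = doubling_space M D
  for M :: "'a::metric_space measure" and D +
  fixes \<rho> :: "('a \<Rightarrow> ennreal) \<Rightarrow> ennreal"
  assumes ri: "ri_space M \<rho>"
begin

lemma bfn: "banach_function_norm M \<rho>"
  using ri by (simp add: ri_space_def)

sublocale function_norm M \<rho>
  by (rule banach_function_norm_imp_function_norm[OF bfn])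

text \<open>Assigning each point to the first \<open>q i\<close> within distance t gives a countable
  measurable partition subordinate to the balls \<open>ball (q i) t\<close>.\<close>

definition cell :: "real \<Rightarrow> 'a \<Rightarrow> nat" where "cell t x = (LEAST i. x \<in> ball (q i) t)"

lemma cell: "0 < t \<Longrightarrow> dist (q (cell t x)) x < t"
  unfolding cell_def mem_ball by (rule LeastI_ex[OF q_dense])

lemma measurable_cell [measurable]: "cell t \<in> measurable M (count_space UNIV)"
  unfolding cell_def by measurable

lemma sets_cell [measurable]: "{x. cell t x = i} \<in> sets M"
proof -
  have "{x \<in> space M. cell t x = i} \<in> sets M" by measurable
  then show ?thesis by simp
qed

lemma cell_subset: "0 < t \<Longrightarrow> {x. cell t x = i} \<subseteq> ball (q i) t"
  using cell by auto

lemma fmeasurable_cell: "0 < t \<Longrightarrow> {x. cell t x = i} \<in> fmeasurable M"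
  by (rule fmeasurableI2[OF fmeasurable_ball cell_subset]) auto

text \<open>If y lies in \<open>ball (q i) (2 * t)\<close>, then cell i lies in
  \<open>ball y (3 * t)\<close>, whose volume is at most D^2 times \<open>V (q i) (2 * t)\<close>.
  The cells are disjoint, so their fractions add up to at most D^2 at y; integrating over A gives
  the claim. It is the L^1 bound of averaging over cells.\<close>

lemma cell_overlap:
  assumes t: "0 < t" and A [measurable]: "A \<in> sets M"
  shows "(\<Sum>i. ennreal (measure M {x. cell t x = i} / V (q i) (2 * t)) * emeasure M (ball (q i) (2 * t) \<inter> A))
    \<le> ennreal (D\<^sup>2) * emeasure M A"
proof -
  let ?a = "\<lambda>i. measure M {x. cell t x = i} / V (q i) (2 * t)"
  have pt: "(\<Sum>i. ennreal (?a i) * indicator (ball (q i) (2 * t)) y) \<le> ennreal (D\<^sup>2)" for y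
  proof -
    have "ennreal (?a i) * indicator (ball (q i) (2 * t)) y \<le>
        ennreal (D\<^sup>2 / V y (3 * t)) * emeasure M ({x. cell t x = i} \<inter> ball y (3 * t))" for i
    proof (cases "y \<in> ball (q i) (2 * t)")
      case True
      have sub: "{x. cell t x = i} \<subseteq> ball y (3 * t)"
      proof
        fix x assume "x \<in> {x. cell t x = i}"
        then have "dist (q i) x < t" using cell[OF t, of x] by auto
        then show "x \<in> ball y (3 * t)" using True dist_triangle[of y x "q i"] by (simp add: dist_commute)
      qed
      have "V y (3 * t) \<le> D\<^sup>2 * V (q i) (2 * t)"
        using True t by (intro V_le_pow) auto
      then have "1 / V (q i) (2 * t) \<le> D\<^sup>2 / V y (3 * t)"
        using V_pos[of "2 * t" "q i"] V_pos[of "3 * t" y] t by (simp add: field_simps)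
      then have "?a i \<le> D\<^sup>2 / V y (3 * t) * measure M {x. cell t x = i}"
        using mult_right_mono[of "1 / V (q i) (2 * t)" "D\<^sup>2 / V y (3 * t)" "measure M {x. cell t x = i}"]
        by simp
      then have "ennreal (?a i) \<le> ennreal (D\<^sup>2 / V y (3 * t)) * ennreal (measure M {x. cell t x = i})"
        by (simp add: ennreal_mult[symmetric])
      also have "ennreal (measure M {x. cell t x = i}) = emeasure M {x. cell t x = i}"
        using fmeasurable_cell[OF t, of i] by (intro emeasure_eq_measure2[symmetric]) auto
      finally show ?thesis using True by (simp add: Int_absorb2[OF sub])
    qed simp
    then have "(\<Sum>i. ennreal (?a i) * indicator (ball (q i) (2 * t)) y) \<le>
        (\<Sum>i. ennreal (D\<^sup>2 / V y (3 * t)) * emeasure M ({x. cell t x = i} \<inter> ball y (3 * t)))"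
      by (intro suminf_le) auto
    also have "\<dots> = ennreal (D\<^sup>2 / V y (3 * t)) * (\<Sum>i. emeasure M ({x. cell t x = i} \<inter> ball y (3 * t)))"
      by simp
    also have "(\<Sum>i. emeasure M ({x. cell t x = i} \<inter> ball y (3 * t))) =
        emeasure M (\<Union>i. {x. cell t x = i} \<inter> ball y (3 * t))"
      by (rule suminf_emeasure) (auto simp: disjoint_family_on_def)
    also have "(\<Union>i. {x. cell t x = i} \<inter> ball y (3 * t)) = ball y (3 * t)" by auto
    also have "ennreal (D\<^sup>2 / V y (3 * t)) * emeasure M (ball y (3 * t)) = ennreal (D\<^sup>2)"
      using V_pos[of "3 * t" y] t by (simp add: emeasure_ball ennreal_mult[symmetric])
    finally show ?thesis .
  qed
  have "(\<Sum>i. ennreal (?a i) * emeasure M (ball (q i) (2 * t) \<inter> A)) =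
      (\<Sum>i. \<integral>\<^sup>+y. ennreal (?a i) * indicator (ball (q i) (2 * t)) y * indicator A y \<partial>M)"
    by (intro suminf_cong, subst nn_integral_cmult_indicator[symmetric])
       (auto intro!: nn_integral_cong simp: indicator_def)
  also have "\<dots> = (\<integral>\<^sup>+y. (\<Sum>i. ennreal (?a i) * indicator (ball (q i) (2 * t)) y * indicator A y) \<partial>M)"
    by (rule nn_integral_suminf[symmetric]) measurable
  also have "\<dots> \<le> (\<integral>\<^sup>+y. ennreal (D\<^sup>2) * indicator A y \<partial>M)"
    using pt by (intro nn_integral_mono) (auto intro: mult_right_mono)
  also have "\<dots> = ennreal (D\<^sup>2) * emeasure M A" by (rule nn_integral_cmult_indicator) measurable
  finally show ?thesis .
qed

text \<open>The distribution function of f on the ball \<open>ball (q i) (2 * t)\<close>, normalised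
  to total mass 1.\<close>

definition level :: "('a \<Rightarrow> ennreal) \<Rightarrow> real \<Rightarrow> nat \<Rightarrow> ennreal \<Rightarrow> real" where
  "level f t i s = measure M (ball (q i) (2 * t) \<inter> {x. s < f x}) / V (q i) (2 * t)"

lemma sets_superlevel [measurable]:
  assumes [measurable]: "f \<in> borel_measurable M"
  shows "{x. (s::ennreal) < f x} \<in> sets M"
proof -
  have "{x \<in> space M. s < f x} \<in> sets M" by measurable
  then show ?thesis by simp
qed

lemma level_bounds:
  assumes "0 < t" and [measurable]: "f \<in> borel_measurable M"
  shows "0 \<le> level f t i s" "level f t i s \<le> 1" "antimono (level f t i)"
proof -
  show "0 \<le> level f t i s" by (simp add: level_def)
  have m: "measure M (ball (q i) (2 * t) \<inter> A) \<le> measure M (ball (q i) (2 * t) \<inter> B)"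
    if "A \<subseteq> B" "A \<in> sets M" "B \<in> sets M" for A B
    using that by (intro measure_mono_fmeasurable fmeasurable_Int_fmeasurable) auto
  show "level f t i s \<le> 1"
    using m[of "{x. s < f x}" UNIV] V_pos[of "2 * t" "q i"] assms(1) sets.top[of M] by (simp add: level_def)
  show "antimono (level f t i)"
  proof (rule antimonoI)
    fix r s :: ennreal assume "r \<le> s"
    then have "measure M (ball (q i) (2 * t) \<inter> {x. s < f x}) \<le> measure M (ball (q i) (2 * t) \<inter> {x. r < f x})"
      by (intro m) auto
    then show "level f t i s \<le> level f t i r" by (simp add: level_def divide_right_mono)
  qed
qed

lemma level_measurable:
  assumes t: "0 < t" and f [measurable]: "f \<in> borel_measurable M"
  shows "(\<lambda>s. level f t i (ennreal s)) \<in> borel_measurable borel"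
proof -
  have "mono (\<lambda>s. - level f t i (ennreal s))"
    using antimonoD[OF level_bounds(3)[OF t f, of i], OF ennreal_leI] by (simp add: mono_def)
  then have "(\<lambda>s. - level f t i (ennreal s)) \<in> borel_measurable borel" by (rule borel_measurable_mono)
  then have "(\<lambda>s. - (- level f t i (ennreal s))) \<in> borel_measurable borel" by (rule borel_measurable_uminus)
  then show ?thesis by simp
qed

lemma nn_integral_level:
  assumes t: "0 < t" and f [measurable]: "f \<in> borel_measurable M"
  shows "(\<integral>\<^sup>+s. ennreal (level f t i (ennreal s)) * indicator {0<..} s \<partial>lborel) =
    (\<integral>\<^sup>+x\<in>ball (q i) (2 * t). f x \<partial>M) / emeasure M (ball (q i) (2 * t))"
proof -
  let ?B = "ball (q i) (2 * t)"
  note [measurable] = level_measurable[OF t f]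
  have V: "0 < V (q i) (2 * t)" using V_pos t by simp
  have "(\<integral>\<^sup>+x\<in>?B. f x \<partial>M) =
      (\<integral>\<^sup>+s. emeasure M {x \<in> space M. ennreal s < f x * indicator ?B x} * indicator {0<..} s \<partial>lborel)"
    using nn_integral_layer_cake[of "\<lambda>x. f x * indicator ?B x"] by simp
  also have "\<dots> = (\<integral>\<^sup>+s. ennreal (V (q i) (2 * t)) * (ennreal (level f t i (ennreal s)) * indicator {0<..} s) \<partial>lborel)"
  proof (rule nn_integral_cong)
    fix s :: real
    have "{x \<in> space M. ennreal s < f x * indicator ?B x} = ?B \<inter> {x. ennreal s < f x}"
      by (auto simp: indicator_def)
    moreover have "emeasure M (?B \<inter> {x. ennreal s < f x}) = ennreal (measure M (?B \<inter> {x. ennreal s < f x}))"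
      using fmeasurable_Int_fmeasurable[OF fmeasurable_ball, of "{x. ennreal s < f x}" "q i" "2 * t"]
      by (intro emeasure_eq_measure2) auto
    moreover have "\<dots> = ennreal (V (q i) (2 * t)) * ennreal (level f t i (ennreal s))"
      using V by (simp add: level_def ennreal_mult[symmetric])
    ultimately show "emeasure M {x \<in> space M. ennreal s < f x * indicator ?B x} * indicator {0<..} s =
        ennreal (V (q i) (2 * t)) * (ennreal (level f t i (ennreal s)) * indicator {0<..} s)"
      by (simp add: mult.assoc)
  qed
  also have "\<dots> = ennreal (V (q i) (2 * t)) *
      (\<integral>\<^sup>+s. ennreal (level f t i (ennreal s)) * indicator {0<..} s \<partial>lborel)"
    by (intro nn_integral_cmult) measurable
  finally show ?thesis
    using V unfolding emeasure_ball
    by (simp add: divide_ennreal_eq_times mult.assoc[symmetric] ennreal_mult[symmetric])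
qed

text \<open>The functions obtained from the quantiles of \<open>f\<close> on the balls by cyclic shifts of the pieces
  of the cells are distributionally dominated by \<open>f\<close>, and their mean recovers the averages
  of \<open>f\<close>. This replaces the Hardy--Littlewood--Polya principle, hence duality.\<close>

lemma norm_sum_quantile_le:
  assumes t: "0 < t" and f [measurable]: "f \<in> borel_measurable M" and fin: "\<rho> f < \<infinity>" and N: "0 < N"
  defines "L \<equiv> 2 * D\<^sup>2"
  shows "\<rho> (\<lambda>x. \<Sum>k<N. quantile (level f t (cell t x)) (real (Suc k) * L / real N)) \<le> of_nat N * \<rho> f"
proof -
  \<comment> \<open>In L the 2 pays for the unequal pieces of \<open>equipartition\<close>, the D^2
    for the overlap in \<open>cell_overlap\<close>.\<close>
  have L: "0 < L" using D_ge_1 by (simp add: L_def)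
  have "\<forall>i. \<exists>lab. lab \<in> measurable M (count_space UNIV) \<and> (\<forall>x. lab x < N) \<and>
      (\<forall>k. measure M {x \<in> {x. cell t x = i}. lab x = k} \<le> 2 / real N * measure M {x. cell t x = i})"
  proof
    fix i
    have "emeasure M {x. cell t x = i} < \<infinity>" using fmeasurable_cell[OF t, of i] by (simp add: fmeasurable_def)
    then show "\<exists>lab. lab \<in> measurable M (count_space UNIV) \<and> (\<forall>x. lab x < N) \<and>
      (\<forall>k. measure M {x \<in> {x. cell t x = i}. lab x = k} \<le> 2 / real N * measure M {x. cell t x = i})"
      by (rule equipartition[OF sets_cell _ N])
  qed
  from choice[OF this] obtain lab :: "nat \<Rightarrow> 'a \<Rightarrow> nat" where
    lab0: "\<forall>i. lab i \<in> measurable M (count_space UNIV) \<and> (\<forall>x. lab i x < N) \<and>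
      (\<forall>k. measure M {x \<in> {x. cell t x = i}. lab i x = k} \<le> 2 / real N * measure M {x. cell t x = i})" ..
  then have lab [measurable]: "\<And>i. lab i \<in> measurable M (count_space UNIV)" and lab_less: "\<And>i x. lab i x < N"
    and lab_le: "\<And>i k. measure M {x \<in> {x. cell t x = i}. lab i x = k} \<le> 2 / real N * measure M {x. cell t x = i}"
    by simp_all
  define c where "c i k = quantile (level f t i) (real (Suc k) * L / real N)" for i k
  \<comment> \<open>On the piece with label l the value is the quantile number l + \<sigma> mod N.
    At a fixed point, letting \<sigma> run through all shifts meets every quantile once, so the sum
    over \<sigma> no longer depends on the label.\<close>
  define G where "G \<sigma> x = c (cell t x) ((lab (cell t x) x + \<sigma>) mod N)" for \<sigma> x
  have Gi: "(\<lambda>x. c i ((lab i x + \<sigma>) mod N)) \<in> borel_measurable M" for i \<sigma>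
    by (rule measurable_compose[OF lab, of "\<lambda>l. c i ((l + \<sigma>) mod N)"]) simp
  have G [measurable]: "G \<sigma> \<in> borel_measurable M" for \<sigma>
    unfolding G_def by (rule measurable_compose_countable[OF Gi measurable_cell])
  have dist: "emeasure M {x \<in> space M. s < G \<sigma> x} \<le> emeasure M {x \<in> space M. s < f x}" for s \<sigma>
  proof -
    \<comment> \<open>The labels of the pieces of cell i on which \<open>G \<sigma>\<close> exceeds
      s. Shifting permutes labels, so their number is bounded by the count for unshifted
      quantiles.\<close>
    define K where "K i = {k. k < N \<and> s < c i ((k + \<sigma>) mod N)}" for i
    have cardK: "real (card (K i)) \<le> real N * level f t i s / L" for i
    proof -
      let ?h = "\<lambda>k. (k + \<sigma>) mod N"
      have b: "bij_betw ?h {..<N} {..<N}" by (rule bij_betw_shift_mod[OF N])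
      have "?h ` K i \<subseteq> {k. k < N \<and> s < c i k}" using N by (auto simp: K_def)
      moreover have "inj_on ?h (K i)" by (rule inj_on_subset[OF bij_betw_imp_inj_on[OF b]]) (auto simp: K_def)
      ultimately have "card (K i) \<le> card {k. k < N \<and> s < c i k}" by (intro card_inj_on_le) auto
      also have "real \<dots> \<le> real N * level f t i s / L"
        unfolding c_def by (intro card_quantile_greater L N level_bounds(1) t f)
      finally show ?thesis by simp
    qed
    have piece: "emeasure M ({x. s < G \<sigma> x} \<inter> {x. cell t x = i}) \<le>
        ennreal (1 / D\<^sup>2) * (ennreal (measure M {x. cell t x = i} / V (q i) (2 * t)) *
          emeasure M (ball (q i) (2 * t) \<inter> {x. s < f x}))" for i
    proof -
      let ?Q = "{x. cell t x = i}"
      have fK: "finite (K i)" by (simp add: K_def)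
      have P: "{x \<in> ?Q. lab i x = k} \<in> fmeasurable M" for k
      proof (rule fmeasurableI2[OF fmeasurable_cell[OF t, of i]])
        have "{x \<in> space M. cell t x = i \<and> lab i x = k} \<in> sets M" by measurable
        then show "{x \<in> ?Q. lab i x = k} \<in> sets M" by simp
      qed auto
      have "{x. s < G \<sigma> x} \<inter> ?Q \<subseteq> (\<Union>k\<in>K i. {x \<in> ?Q. lab i x = k})"
        using lab_less by (auto simp: G_def K_def)
      then have "measure M ({x. s < G \<sigma> x} \<inter> ?Q) \<le> measure M (\<Union>k\<in>K i. {x \<in> ?Q. lab i x = k})"
        by (rule measure_mono_fmeasurable) (use P fK in \<open>auto intro!: fmeasurable.finite_UN\<close>)
      also have "\<dots> \<le> (\<Sum>k\<in>K i. measure M {x \<in> ?Q. lab i x = k})"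
        using P fK by (intro measure_UNION_le) (auto simp: fmeasurable_def)
      also have "\<dots> \<le> (\<Sum>k\<in>K i. 2 / real N * measure M ?Q)" by (intro sum_mono lab_le)
      also have "\<dots> = real (card (K i)) * (2 / real N * measure M ?Q)" by simp
      also have "\<dots> \<le> (real N * level f t i s / L) * (2 / real N * measure M ?Q)"
        by (intro mult_right_mono cardK) auto
      also have "\<dots> = 1 / D\<^sup>2 * (measure M ?Q / V (q i) (2 * t) * measure M (ball (q i) (2 * t) \<inter> {x. s < f x}))"
        using N D_ge_1 by (simp add: L_def level_def field_simps)
      finally have *: "measure M ({x. s < G \<sigma> x} \<inter> ?Q) \<le>
        1 / D\<^sup>2 * (measure M ?Q / V (q i) (2 * t) * measure M (ball (q i) (2 * t) \<inter> {x. s < f x}))" .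
      have "emeasure M ({x. s < G \<sigma> x} \<inter> ?Q) = ennreal (measure M ({x. s < G \<sigma> x} \<inter> ?Q))"
        using fmeasurable_Int_fmeasurable[OF fmeasurable_cell[OF t, of i], of "{x. s < G \<sigma> x}"]
        by (intro emeasure_eq_measure2) (auto simp: Int_commute)
      moreover have "emeasure M (ball (q i) (2 * t) \<inter> {x. s < f x}) =
          ennreal (measure M (ball (q i) (2 * t) \<inter> {x. s < f x}))"
        using fmeasurable_Int_fmeasurable[OF fmeasurable_ball, of "{x. s < f x}" "q i" "2 * t"]
        by (intro emeasure_eq_measure2) auto
      ultimately show ?thesis using * by (simp add: ennreal_mult[symmetric] ennreal_leI)
    qed
    have "emeasure M {x. s < G \<sigma> x} = emeasure M (\<Union>i. {x. s < G \<sigma> x} \<inter> {x. cell t x = i})"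
      by (rule arg_cong[where f = "emeasure M"]) auto
    also have "\<dots> \<le> (\<Sum>i. emeasure M ({x. s < G \<sigma> x} \<inter> {x. cell t x = i}))"
      by (rule emeasure_subadditive_countably) auto
    also have "\<dots> \<le> (\<Sum>i. ennreal (1 / D\<^sup>2) * (ennreal (measure M {x. cell t x = i} / V (q i) (2 * t)) *
          emeasure M (ball (q i) (2 * t) \<inter> {x. s < f x})))"
      by (intro suminf_le piece) auto
    also have "\<dots> \<le> ennreal (1 / D\<^sup>2) * (ennreal (D\<^sup>2) * emeasure M {x. s < f x})"
      using cell_overlap[OF t sets_superlevel[OF f, of s]] by (simp add: mult_left_mono)
    also have "\<dots> = emeasure M {x. s < f x}"
      using D_ge_1 by (simp add: mult.assoc[symmetric] ennreal_mult[symmetric])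
    finally show ?thesis by simp
  qed
  have "\<rho> (G \<sigma>) \<le> \<rho> f" for \<sigma> by (rule ri_space_le[OF ri G f fin dist])
  moreover have "\<rho> (\<lambda>x. \<Sum>\<sigma><N. G \<sigma> x) \<le> (\<Sum>\<sigma><N. \<rho> (G \<sigma>))" by (intro finite_sum) auto
  ultimately have "\<rho> (\<lambda>x. \<Sum>\<sigma><N. G \<sigma> x) \<le> (\<Sum>\<sigma><N. \<rho> f)"
    by (meson order_trans sum_mono)
  moreover have "(\<Sum>\<sigma><N. G \<sigma> x) = (\<Sum>k<N. c (cell t x) k)" for x
  proof -
    have "(\<Sum>\<sigma><N. c (cell t x) ((\<sigma> + lab (cell t x) x) mod N)) = (\<Sum>k<N. c (cell t x) k)"
      by (rule sum.reindex_bij_betw[OF bij_betw_shift_mod[OF N]])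
    then show ?thesis by (simp add: G_def add.commute)
  qed
  ultimately show ?thesis by (simp add: c_def)
qed

text \<open>Dividing \<open>norm_sum_quantile_le\<close> by N = n + 1 and using
  \<open>sum_quantile_ge\<close>, the integral of the level function cut down by L / N has norm at
  most L \<rho> f. As n grows these integrals increase to the average over the ball, and the Fatou
  property passes to the limit.\<close>

lemma norm_cell_average_le:
  assumes t: "0 < t" and f [measurable]: "f \<in> borel_measurable M"
  shows "\<rho> (\<lambda>x. (\<integral>\<^sup>+y\<in>ball (q (cell t x)) (2 * t). f y \<partial>M) / emeasure M (ball (q (cell t x)) (2 * t)))
    \<le> ennreal (2 * D\<^sup>2) * \<rho> f"
proof (cases "\<rho> f < \<infinity>")
  case True
  define L where "L = 2 * D\<^sup>2"
  have "1 \<le> D\<^sup>2" using D_ge_1 by (simp add: one_le_power)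
  then have L: "1 \<le> L" by (simp add: L_def)
  define J where "J n i = (\<integral>\<^sup>+s. ennreal (level f t i (ennreal s) - L / real (Suc n)) * indicator {0<..} s \<partial>lborel)" for n i
  note [measurable] = level_measurable[OF t f]
  have J_le: "\<rho> (\<lambda>x. J n (cell t x)) \<le> ennreal L * \<rho> f" for n
  proof -
    have Jm: "(\<lambda>x. J n (cell t x)) \<in> borel_measurable M" by measurable
    have Sm: "(\<lambda>x. \<Sum>k<Suc n. quantile (level f t (cell t x)) (real (Suc k) * L / real (Suc n))) \<in> borel_measurable M"
      by (rule measurable_compose[OF measurable_cell,
            of "\<lambda>i. \<Sum>k<Suc n. quantile (level f t i) (real (Suc k) * L / real (Suc n))"]) simp
    have "ennreal (real (Suc n) / L) * \<rho> (\<lambda>x. J n (cell t x)) =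
        \<rho> (\<lambda>x. ennreal (real (Suc n) / L) * J n (cell t x))"
      using L by (intro scale[symmetric] Jm) auto
    also have "\<dots> \<le> \<rho> (\<lambda>x. \<Sum>k<Suc n. quantile (level f t (cell t x)) (real (Suc k) * L / real (Suc n)))"
      unfolding J_def
      by (rule mono, use Jm in \<open>simp add: J_def\<close>, rule Sm, rule sum_quantile_ge)
         (use level_bounds[OF t f] L in auto)
    also have "\<dots> \<le> of_nat (Suc n) * \<rho> f"
      unfolding L_def by (rule norm_sum_quantile_le[OF t f True]) simp
    finally have "ennreal (L / real (Suc n)) * (ennreal (real (Suc n) / L) * \<rho> (\<lambda>x. J n (cell t x))) \<le>
        ennreal (L / real (Suc n)) * (of_nat (Suc n) * \<rho> f)"
      by (rule mult_left_mono) simp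
    moreover have "ennreal (L / real (Suc n)) * (ennreal (real (Suc n) / L) * y) = y" for y
      using L by (simp add: mult.assoc[symmetric] ennreal_mult[symmetric])
    moreover have "ennreal (L / real (Suc n)) * (of_nat (Suc n) * y) = ennreal L * y" for y
      using L by (simp add: mult.assoc[symmetric] ennreal_mult[symmetric] ennreal_of_nat_eq_real_of_nat
          del: of_nat_Suc)
    ultimately show ?thesis by simp
  qed
  have Jinc: "J n i \<le> J n' i" if "n \<le> n'" for n n' i
    unfolding J_def using that L
    by (intro nn_integral_mono mult_right_mono ennreal_leI diff_left_mono divide_left_mono) auto
  have Jsup: "(SUP n. J n i) = (\<integral>\<^sup>+y\<in>ball (q i) (2 * t). f y \<partial>M) / emeasure M (ball (q i) (2 * t))" for i
  proof -
    have "(SUP n. J n i) = (\<integral>\<^sup>+s. (SUP n. ennreal (level f t i (ennreal s) - L / real (Suc n)) * indicator {0<..} s) \<partial>lborel)"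
      unfolding J_def
      by (rule nn_integral_monotone_convergence_SUP[symmetric])
         (use L in \<open>auto simp: incseq_def le_fun_def intro!: mult_right_mono ennreal_leI divide_left_mono\<close>)
    also have "\<dots> = (\<integral>\<^sup>+s. ennreal (level f t i (ennreal s)) * indicator {0<..} s \<partial>lborel)"
    proof (rule nn_integral_cong)
      fix s :: real
      have "(\<lambda>n. L / real (Suc n)) \<longlonglongrightarrow> 0"
        by (rule LIMSEQ_Suc[OF lim_const_over_n])
      then have "(\<lambda>n. ennreal (level f t i (ennreal s) - L / real (Suc n))) \<longlonglongrightarrow> ennreal (level f t i (ennreal s) - 0)"
        by (intro tendsto_ennrealI tendsto_diff tendsto_const)
      moreover have "incseq (\<lambda>n. ennreal (level f t i (ennreal s) - L / real (Suc n)))"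
        using L by (auto simp: incseq_def intro!: ennreal_leI divide_left_mono)
      ultimately have "(SUP n. ennreal (level f t i (ennreal s) - L / real (Suc n))) = ennreal (level f t i (ennreal s))"
        using LIMSEQ_SUP LIMSEQ_unique by fastforce
      then show "(SUP n. ennreal (level f t i (ennreal s) - L / real (Suc n)) * indicator {0<..} s) =
          ennreal (level f t i (ennreal s)) * indicator {0<..} s"
        by (simp add: SUP_mult_right_ennreal[symmetric])
    qed
    finally show ?thesis by (simp only: nn_integral_level[OF t f])
  qed
  have "\<rho> (\<lambda>x. SUP n. J n (cell t x)) = (SUP n. \<rho> (\<lambda>x. J n (cell t x)))"
    by (rule fatou) (auto simp: incseq_def le_fun_def intro!: Jinc)
  also have "\<dots> \<le> ennreal L * \<rho> f" by (intro SUP_least J_le)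
  finally show ?thesis by (simp add: Jsup L_def)
next
  case False
  then show ?thesis using D_ge_1 by (simp add: not_less top_unique ennreal_mult_top)
qed

section \<open>Averages over balls centred at the point itself\<close>

definition avg :: "real \<Rightarrow> ('a \<Rightarrow> ennreal) \<Rightarrow> 'a \<Rightarrow> ennreal" where
  "avg t f x = (\<integral>\<^sup>+y\<in>ball x t. f y \<partial>M) / emeasure M (ball x t)"

lemma measurable_avg [measurable]:
  assumes [measurable]: "f \<in> borel_measurable M"
  shows "avg t f \<in> borel_measurable M"
proof -
  have "(\<integral>\<^sup>+y\<in>ball x t. f y \<partial>M) = (\<integral>\<^sup>+y. (if dist x y < t then f y else 0) \<partial>M)" for x
    by (intro nn_integral_cong) (auto simp: indicator_def)
  then show ?thesis unfolding avg_def by simp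
qed

text \<open>\<open>ball x t\<close> lies in the ball of radius 2t about the centre of the cell of x,
  whose volume is at most D^2 V(x,t). This factor and the 2 D^2 for cell averages give 2 D^4,
  independently of t.\<close>

lemma norm_avg_le:
  assumes t: "0 < t" and f [measurable]: "f \<in> borel_measurable M"
  shows "\<rho> (avg t f) \<le> ennreal (2 * D ^ 4) * \<rho> f"
proof -
  let ?A = "\<lambda>i. (\<integral>\<^sup>+y\<in>ball (q i) (2 * t). f y \<partial>M) / emeasure M (ball (q i) (2 * t))"
  have Am: "(\<lambda>x. ?A (cell t x)) \<in> borel_measurable M"
    by (rule measurable_compose[OF measurable_cell, of ?A]) simp
  have "avg t f x \<le> ennreal (D\<^sup>2) * ?A (cell t x)" for x
  proof -
    let ?i = "cell t x"
    have d: "dist (q ?i) x < t" by (rule cell[OF t])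
    have "V (q ?i) (2 * t) \<le> D\<^sup>2 * V x t"
      using d t by (intro V_le_pow) (auto simp: dist_commute)
    then have *: "1 / V x t \<le> D\<^sup>2 / V (q ?i) (2 * t)"
      using V_pos[of "2 * t" "q ?i"] V_pos[of t x] t by (simp add: field_simps)
    have sub: "ball x t \<subseteq> ball (q ?i) (2 * t)"
    proof
      fix y assume "y \<in> ball x t"
      then show "y \<in> ball (q ?i) (2 * t)" using d dist_triangle[of "q ?i" y x] by simp
    qed
    have "avg t f x = ennreal (1 / V x t) * (\<integral>\<^sup>+y\<in>ball x t. f y \<partial>M)"
      unfolding avg_def emeasure_ball by (rule divide_ennreal_eq_times[OF V_pos[OF t]])
    also have "\<dots> \<le> ennreal (D\<^sup>2 / V (q ?i) (2 * t)) * (\<integral>\<^sup>+y\<in>ball (q ?i) (2 * t). f y \<partial>M)"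
      using sub by (intro mult_mono ennreal_leI * nn_integral_mono) (auto simp: indicator_def)
    also have "\<dots> = ennreal (D\<^sup>2) * (ennreal (1 / V (q ?i) (2 * t)) * (\<integral>\<^sup>+y\<in>ball (q ?i) (2 * t). f y \<partial>M))"
      using V_pos[of "2 * t" "q ?i"] t by (simp add: mult.assoc[symmetric] ennreal_mult[symmetric])
    also have "\<dots> = ennreal (D\<^sup>2) * ?A ?i"
      unfolding emeasure_ball using V_pos[of "2 * t" "q ?i"] t by (simp add: divide_ennreal_eq_times)
    finally show ?thesis .
  qed
  then have "\<rho> (avg t f) \<le> \<rho> (\<lambda>x. ennreal (D\<^sup>2) * ?A (cell t x))"
    using Am by (intro mono) auto
  also have "\<dots> = ennreal (D\<^sup>2) * \<rho> (\<lambda>x. ?A (cell t x))" by (intro scale Am) simp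
  also have "\<dots> \<le> ennreal (D\<^sup>2) * (ennreal (2 * D\<^sup>2) * \<rho> f)"
    by (intro mult_left_mono norm_cell_average_le t f) simp
  also have "\<dots> = ennreal (D\<^sup>2 * (2 * D\<^sup>2)) * \<rho> f"
    by (simp add: mult.assoc[symmetric] ennreal_mult[symmetric])
  also have "D\<^sup>2 * (2 * D\<^sup>2) = 2 * D ^ 4" by (simp add: power2_eq_square power4_eq_xxxx)
  finally show ?thesis .
qed

end

section \<open>Oscillations and the K-functional\<close>

lemma ennreal_le_mult_INF:
  assumes c: "0 < c" and le: "\<And>i. i \<in> I \<Longrightarrow> y \<le> ennreal c * f i"
  shows "y \<le> ennreal c * (INF i\<in>I. f i)"
proof -
  have inv: "ennreal (1 / c) * (ennreal c * z) = z" "ennreal c * (ennreal (1 / c) * z) = z" for z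
    using c by (simp_all add: mult.assoc[symmetric] ennreal_mult[symmetric])
  have "ennreal (1 / c) * y \<le> (INF i\<in>I. f i)"
  proof (rule INF_greatest)
    fix i assume "i \<in> I"
    then show "ennreal (1 / c) * y \<le> f i"
      using mult_left_mono[OF le, of i "ennreal (1 / c)"] by (simp add: inv)
  qed
  from mult_left_mono[OF this, of "ennreal c"] show ?thesis by (simp add: inv)
qed

lemma function_norm_nn_integral: "function_norm M (\<lambda>f. \<integral>\<^sup>+x. f x \<partial>M)"
proof
  fix f g :: "'a \<Rightarrow> ennreal" assume [measurable]: "f \<in> borel_measurable M"
  show "(\<integral>\<^sup>+x. f x \<partial>M) = 0 \<longleftrightarrow> (AE x in M. f x = 0)" by (rule nn_integral_0_iff_AE) measurable
  show "(\<integral>\<^sup>+x. ennreal a * f x \<partial>M) = ennreal a * (\<integral>\<^sup>+x. f x \<partial>M)" for a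
    by (rule nn_integral_cmult) measurable
  assume [measurable]: "g \<in> borel_measurable M"
  show "(\<integral>\<^sup>+x. f x + g x \<partial>M) \<le> (\<integral>\<^sup>+x. f x \<partial>M) + (\<integral>\<^sup>+x. g x \<partial>M)"
    by (simp add: nn_integral_add)
  show "(\<integral>\<^sup>+x. f x \<partial>M) \<le> (\<integral>\<^sup>+x. g x \<partial>M)" if "AE x in M. f x \<le> g x"
    using that by (rule nn_integral_mono_AE)
next
  fix u :: "nat \<Rightarrow> 'a \<Rightarrow> ennreal"
  assume "\<And>i. u i \<in> borel_measurable M" and "incseq u"
  then show "(\<integral>\<^sup>+x. (SUP i. u i x) \<partial>M) = (SUP i. \<integral>\<^sup>+x. u i x \<partial>M)"
    by (intro nn_integral_monotone_convergence_SUP) auto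
qed

interpretation L1: function_norm M "\<lambda>f. \<integral>\<^sup>+x. f x \<partial>M" for M by (rule function_norm_nn_integral)

lemma L1_plus_Linf_iff:
  "f \<in> L1_plus_Linf M \<longleftrightarrow> (\<exists>f0 f1. L1_norm M f0 < \<infinity> \<and> Linf_norm M f1 < \<infinity> \<and> f = (\<lambda>x. f0 x + f1 x))"
  by (auto simp: L1_plus_Linf_def sum_space_def fspace_def)

lemma L1_plus_Linf_measurable: "f \<in> L1_plus_Linf M \<Longrightarrow> f \<in> borel_measurable M"
  unfolding L1_plus_Linf_iff L1_norm_def
  using L1.space_norm_finite_measurable Linf_norm_measurable by (metis borel_measurable_add)

lemma L1_plus_Linf_diff:
  assumes "f \<in> L1_plus_Linf M" "g \<in> L1_plus_Linf M"
  shows "(\<lambda>x. f x - g x) \<in> L1_plus_Linf M"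
proof -
  obtain f0 f1 g0 g1 where *: "L1_norm M f0 < \<infinity>" "Linf_norm M f1 < \<infinity>" "f = (\<lambda>x. f0 x + f1 x)"
      "L1_norm M g0 < \<infinity>" "Linf_norm M g1 < \<infinity>" "g = (\<lambda>x. g0 x + g1 x)"
    using assms unfolding L1_plus_Linf_iff by blast
  have "L1_norm M (\<lambda>x. f0 x - g0 x) < \<infinity>"
    using L1.space_norm_diff[of M f0 g0] * by (auto simp: L1_norm_def intro: le_less_trans)
  moreover have "Linf_norm M (\<lambda>x. f1 x - g1 x) < \<infinity>"
    using Linf.space_norm_diff[of M f1 g1] * by (auto simp: Linf_norm_def intro: le_less_trans)
  moreover have "(\<lambda>x. f x - g x) = (\<lambda>x. (f0 x - g0 x) + (f1 x - g1 x))" using * by auto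
  ultimately show ?thesis unfolding L1_plus_Linf_iff by blast
qed

lemma L1_plus_Linf_zero: "(\<lambda>x. 0) \<in> L1_plus_Linf M"
  unfolding L1_plus_Linf_iff L1_norm_def Linf_norm_def
  by (intro exI[of _ "\<lambda>x. 0"]) simp

lemma L1_plus_Linf_add:
  assumes "f \<in> L1_plus_Linf M" "g \<in> L1_plus_Linf M"
  shows "(\<lambda>x. f x + g x) \<in> L1_plus_Linf M"
  using L1_plus_Linf_diff[OF assms(1) L1_plus_Linf_diff[OF L1_plus_Linf_zero assms(2)]] by simp

lemma L1_plus_Linf_integrable_on:
  assumes "f \<in> L1_plus_Linf M" and A [measurable]: "A \<in> sets M" and fin: "emeasure M A < \<infinity>"
  shows "(\<integral>\<^sup>+x\<in>A. ennreal \<bar>f x\<bar> \<partial>M) < \<infinity>"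
proof -
  obtain f0 f1 where f01: "L1_norm M f0 < \<infinity>" "Linf_norm M f1 < \<infinity>" "f = (\<lambda>x. f0 x + f1 x)"
    using assms(1) unfolding L1_plus_Linf_iff by blast
  have [measurable]: "f0 \<in> borel_measurable M" "f1 \<in> borel_measurable M"
    using f01 by (auto simp: L1_norm_def intro: L1.space_norm_finite_measurable Linf_norm_measurable)
  have "AE x in M. ennreal \<bar>f1 x\<bar> \<le> Linf_norm M f1" by (subst Linf_norm_le_iff[symmetric]) auto
  then have "AE x in M. ennreal \<bar>f x\<bar> * indicator A x \<le> ennreal \<bar>f0 x\<bar> + Linf_norm M f1 * indicator A x"
  proof eventually_elim
    case (elim x)
    have "ennreal \<bar>f x\<bar> \<le> ennreal \<bar>f0 x\<bar> + ennreal \<bar>f1 x\<bar>"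
      using f01(3) by (simp add: ennreal_plus[symmetric] del: ennreal_plus)
    also have "\<dots> \<le> ennreal \<bar>f0 x\<bar> + Linf_norm M f1" using elim by (rule add_left_mono)
    finally show ?case by (simp add: indicator_def)
  qed
  then have "(\<integral>\<^sup>+x\<in>A. ennreal \<bar>f x\<bar> \<partial>M) \<le> (\<integral>\<^sup>+x. ennreal \<bar>f0 x\<bar> + Linf_norm M f1 * indicator A x \<partial>M)"
    by (rule nn_integral_mono_AE)
  also have "\<dots> = L1_norm M f0 + Linf_norm M f1 * emeasure M A"
    by (subst nn_integral_add) (auto simp: L1_norm_def space_norm_def nn_integral_cmult_indicator)
  also have "\<dots> < \<infinity>" using f01 fin by (simp add: ennreal_mult_less_top)
  finally show ?thesis .
qed

text \<open>The superlevel sets are unions of intervals \<open>(r, t]\<close>, hence open up to countable sets.\<close>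

lemma measurable_half_line_left_lsc:
  fixes \<phi> :: "real \<Rightarrow> ennreal"
  assumes lsc: "\<And>t a. 0 < t \<Longrightarrow> a < \<phi> t \<Longrightarrow> \<exists>r<t. \<forall>s. r < s \<longrightarrow> s \<le> t \<longrightarrow> a < \<phi> s"
  shows "\<phi> \<in> borel_measurable half_line"
proof -
  have "{t \<in> space half_line. a < \<phi> t} \<in> sets half_line" for a
  proof -
    define S where "S = {t. 0 < t \<and> a < \<phi> t}"
    have left: "\<exists>r<t. {r<..t} \<subseteq> S" if t: "t \<in> S" for t
    proof -
      obtain r where r: "r < t" "\<And>s. r < s \<Longrightarrow> s \<le> t \<Longrightarrow> a < \<phi> s" using lsc[of t a] t unfolding S_def by blast
      have "{max r 0<..t} \<subseteq> S" using r by (auto simp: S_def)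
      then show ?thesis using r(1) t by (intro exI[of _ "max r 0"]) (auto simp: S_def)
    qed
    define Z where "Z = S - interior S"
    have "\<forall>t\<in>Z. \<exists>x\<in>\<rat>. x < t \<and> {x<..t} \<subseteq> S"
    proof
      fix t assume "t \<in> Z"
      then obtain r where r: "r < t" "{r<..t} \<subseteq> S" using left by (auto simp: Z_def)
      obtain x where "x \<in> \<rat>" "r < x" "x < t" using Rats_dense_in_real[OF r(1)] by blast
      then show "\<exists>x\<in>\<rat>. x < t \<and> {x<..t} \<subseteq> S" using r by (intro bexI[of _ x]) auto
    qed
    then obtain h where h: "\<And>t. t \<in> Z \<Longrightarrow> h t \<in> \<rat> \<and> h t < t \<and> {h t<..t} \<subseteq> S" by metis
    \<comment> \<open>With a common left end, the smaller of two points would lie in an open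
      interval contained in S, hence in its interior. So rationals enumerate Z.\<close>
    have "inj_on h Z"
    proof (rule linorder_inj_onI)
      fix t u assume tu: "t < u" "t \<in> Z" "u \<in> Z"
      show "h t \<noteq> h u"
      proof
        assume "h t = h u"
        then have "t \<in> {h u<..<u}" using h[OF tu(2)] tu(1) by auto
        moreover have "{h u<..<u} \<subseteq> S" using h[OF tu(3)] by (auto simp: subset_iff)
        ultimately have "t \<in> interior S" by (intro interiorI[of "{h u<..<u}"]) auto
        then show False using tu(2) by (simp add: Z_def)
      qed
    qed auto
    moreover have "countable (h ` Z)"
      using h by (intro countable_subset[OF _ countable_rat]) auto
    ultimately have "countable Z" by (rule countable_image_inj_on[rotated])
    then have "Z \<in> sets borel" by (rule sets.countable[rotated]) simp
    moreover have "S = interior S \<union> Z" using interior_subset[of S] by (auto simp: Z_def)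
    ultimately have "S \<in> sets borel" by (metis borel_open open_interior sets.Un)
    then have "S \<in> sets lebesgue" by (simp add: sets_completionI_sets)
    moreover have "{t \<in> space half_line. a < \<phi> t} = {0<..} \<inter> S" by (auto simp: S_def)
    ultimately show ?thesis unfolding sets_half_line by auto
  qed
  then show ?thesis by (rule borel_measurableI_greater)
qed

section \<open>The oscillation is bounded by the K-functional\<close>

context doubling_ri_space
begin

abbreviation E :: "('a \<Rightarrow> real) \<Rightarrow> real \<Rightarrow> ennreal" where "E f t \<equiv> oscillation_norm M \<rho> f t"

abbreviation osc :: "('a \<Rightarrow> real) \<Rightarrow> real \<Rightarrow> 'a \<Rightarrow> ennreal" where "osc f t \<equiv> mean_oscillation M f t"

lemma measurable_osc [measurable]:
  assumes [measurable]: "f \<in> borel_measurable M"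
  shows "osc f t \<in> borel_measurable M"
proof -
  have "(\<integral>\<^sup>+y\<in>ball x t. ennreal \<bar>f x - f y\<bar> \<partial>M) = (\<integral>\<^sup>+y. (if dist x y < t then ennreal \<bar>f x - f y\<bar> else 0) \<partial>M)" for x
    by (intro nn_integral_cong) (auto simp: indicator_def)
  then show ?thesis unfolding mean_oscillation_def by simp
qed

lemma osc_eq:
  "0 < t \<Longrightarrow> osc f t x = ennreal (1 / V x t) * (\<integral>\<^sup>+y\<in>ball x t. ennreal \<bar>f x - f y\<bar> \<partial>M)"
  unfolding mean_oscillation_def emeasure_ball by (rule divide_ennreal_eq_times[OF V_pos])

lemma avg_const: "0 < t \<Longrightarrow> avg t (\<lambda>y. c) x = c"
  using V_pos[of t x]
  by (simp add: avg_def nn_integral_cmult_indicator emeasure_ball divide_ennreal_eq_times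
      mult.left_commute[of _ c] ennreal_mult[symmetric])

lemma avg_add:
  "f \<in> borel_measurable M \<Longrightarrow> g \<in> borel_measurable M \<Longrightarrow> avg t (\<lambda>y. f y + g y) x = avg t f x + avg t g x"
  by (simp add: avg_def nn_integral_add distrib_right add_divide_distrib_ennreal)

lemma avg_mono_AE:
  "(AE y in M. f y \<le> g y) \<Longrightarrow> avg t f x \<le> avg t g x"
  unfolding avg_def
  by (intro divide_right_mono_ennreal nn_integral_mono_AE)
     (auto elim!: eventually_mono intro: mult_right_mono)

lemma osc_eq_avg: "osc f t x = avg t (\<lambda>y. ennreal \<bar>f x - f y\<bar>) x"
  by (simp add: mean_oscillation_def avg_def)

text \<open>Bound for the identity plus averaging: both the trivial and the gradient estimate of the
  oscillation lead to h + avg h.\<close>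

definition C0 :: real where "C0 = 1 + 2 * D ^ 4"

lemma C0_pos: "0 < C0" using D_ge_1 by (simp add: C0_def add_pos_nonneg)

lemma norm_add_avg_le:
  assumes "0 < t" and [measurable]: "h \<in> borel_measurable M"
  shows "\<rho> (\<lambda>x. h x + avg t h x) \<le> ennreal C0 * \<rho> h"
proof -
  have "\<rho> (\<lambda>x. h x + avg t h x) \<le> \<rho> h + \<rho> (avg t h)" by (rule triangle) measurable
  also have "\<dots> \<le> \<rho> h + ennreal (2 * D ^ 4) * \<rho> h"
    by (intro add_left_mono norm_avg_le assms)
  also have "\<dots> = ennreal C0 * \<rho> h"
    using D_ge_1 by (simp add: C0_def distrib_right)
  finally show ?thesis .
qed

lemma E_le_norm:
  assumes t: "0 < t" and f [measurable]: "f \<in> borel_measurable M"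
  shows "E f t \<le> ennreal C0 * space_norm M \<rho> f"
proof -
  have "osc f t x \<le> ennreal \<bar>f x\<bar> + avg t (\<lambda>y. ennreal \<bar>f y\<bar>) x" for x
  proof -
    have "osc f t x \<le> avg t (\<lambda>y. ennreal \<bar>f x\<bar> + ennreal \<bar>f y\<bar>) x"
      unfolding osc_eq_avg
      by (intro avg_mono_AE AE_I2) (simp add: ennreal_plus[symmetric] del: ennreal_plus)
    also have "\<dots> = ennreal \<bar>f x\<bar> + avg t (\<lambda>y. ennreal \<bar>f y\<bar>) x"
      using t by (subst avg_add) (auto simp: avg_const)
    finally show ?thesis .
  qed
  then have "E f t \<le> \<rho> (\<lambda>x. ennreal \<bar>f x\<bar> + avg t (\<lambda>y. ennreal \<bar>f y\<bar>) x)"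
    unfolding oscillation_norm_def by (intro mono) measurable
  also have "\<dots> \<le> ennreal C0 * \<rho> (\<lambda>x. ennreal \<bar>f x\<bar>)"
    by (rule norm_add_avg_le[OF t]) measurable
  finally show ?thesis by (simp add: space_norm_eq)
qed

lemma E_add:
  assumes [measurable]: "f \<in> borel_measurable M" "g \<in> borel_measurable M"
  shows "E (\<lambda>x. f x + g x) t \<le> E f t + E g t"
proof -
  have "osc (\<lambda>x. f x + g x) t x \<le> osc f t x + osc g t x" for x
  proof -
    have "osc (\<lambda>x. f x + g x) t x \<le> avg t (\<lambda>y. ennreal \<bar>f x - f y\<bar> + ennreal \<bar>g x - g y\<bar>) x"
      unfolding osc_eq_avg
      by (intro avg_mono_AE AE_I2) (simp add: ennreal_plus[symmetric] del: ennreal_plus)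
    then show ?thesis by (subst (asm) avg_add) (auto simp: osc_eq_avg)
  qed
  then have "E (\<lambda>x. f x + g x) t \<le> \<rho> (\<lambda>x. osc f t x + osc g t x)"
    unfolding oscillation_norm_def by (intro mono) measurable
  also have "\<dots> \<le> E f t + E g t"
    unfolding oscillation_norm_def by (rule triangle) measurable
  finally show ?thesis .
qed

text \<open>In a ball of radius t the distance is below t, so the mean oscillation is at most t g
  plus its average. The null set of the gradient inequality is harmless both for x and under the
  integral.\<close>

lemma E_le_gradient:
  assumes t: "0 < t" and f [measurable]: "f \<in> borel_measurable M" and g: "g \<in> one_gradients M f"
  shows "E f t \<le> ennreal C0 * (ennreal t * space_norm M \<rho> g)"
proof -
  have gm [measurable]: "g \<in> borel_measurable M" and g0: "\<And>x. 0 \<le> g x"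
    using g by (auto simp: one_gradients_def)
  obtain N where N: "N \<in> null_sets M"
    "\<And>x y. x \<notin> N \<Longrightarrow> y \<notin> N \<Longrightarrow> \<bar>f x - f y\<bar> \<le> dist x y * (g x + g y)"
    using g by (auto simp: one_gradients_def)
  have aeN: "AE y in M. y \<notin> N" by (rule AE_not_in[OF N(1)])
  let ?h = "\<lambda>y. ennreal t * ennreal (g y)"
  have "osc f t x \<le> ?h x + avg t ?h x" if "x \<notin> N" for x
  proof -
    have "(\<integral>\<^sup>+y\<in>ball x t. ennreal \<bar>f x - f y\<bar> \<partial>M) \<le> (\<integral>\<^sup>+y\<in>ball x t. ?h x + ?h y \<partial>M)"
    proof (intro nn_integral_mono_AE, use aeN in eventually_elim)
      case (elim y)
      show "ennreal \<bar>f x - f y\<bar> * indicator (ball x t) y \<le> (?h x + ?h y) * indicator (ball x t) y"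
      proof (cases "y \<in> ball x t")
        case True
        have "\<bar>f x - f y\<bar> \<le> dist x y * (g x + g y)" by (rule N(2)[OF that elim])
        also have "\<dots> \<le> t * (g x + g y)" using True g0[of x] g0[of y] by (intro mult_right_mono) auto
        finally have "ennreal \<bar>f x - f y\<bar> \<le> ennreal (t * g x + t * g y)"
          by (intro ennreal_leI) (simp add: distrib_left)
        also have "\<dots> = ?h x + ?h y" using t g0[of x] g0[of y] by (simp add: ennreal_mult)
        finally show ?thesis using True by simp
      qed simp
    qed
    then have "osc f t x \<le> avg t (\<lambda>y. ?h x + ?h y) x"
      unfolding mean_oscillation_def avg_def by (rule divide_right_mono_ennreal)
    also have "\<dots> = ?h x + avg t ?h x" using t by (subst avg_add) (auto simp: avg_const)
    finally show ?thesis .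
  qed
  then have "E f t \<le> \<rho> (\<lambda>x. ?h x + avg t ?h x)"
    unfolding oscillation_norm_def using aeN
    by (intro mono_AE) (measurable, auto elim!: eventually_mono)
  also have "\<dots> \<le> ennreal C0 * \<rho> ?h" by (rule norm_add_avg_le[OF t]) measurable
  also have "\<rho> ?h = ennreal t * \<rho> (\<lambda>y. ennreal (g y))" using t by (intro scale) auto
  also have "\<rho> (\<lambda>y. ennreal (g y)) = space_norm M \<rho> g" using g0 by (simp add: space_norm_eq)
  finally show ?thesis .
qed

lemma E_le_hom_sobolev:
  assumes t: "0 < t" and f: "f \<in> borel_measurable M"
  shows "E f t \<le> ennreal C0 * (ennreal t * hom_sobolev_norm M \<rho> f)"
proof (cases "f \<in> L1_plus_Linf M")
  case True
  have "E f t \<le> ennreal (C0 * t) * space_norm M \<rho> g" if "g \<in> one_gradients M f" for g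
    using E_le_gradient[OF t f that] C0_pos t by (simp add: ennreal_mult mult.assoc)
  then have "E f t \<le> ennreal (C0 * t) * (INF g\<in>one_gradients M f. space_norm M \<rho> g)"
    using C0_pos t by (intro ennreal_le_mult_INF) auto
  then show ?thesis using True C0_pos t by (simp add: hom_sobolev_norm_def ennreal_mult mult.assoc)
next
  case False
  then show ?thesis using C0_pos t by (simp add: hom_sobolev_norm_def ennreal_mult_top)
qed

lemma E_le_K:
  assumes t: "0 < t" and f [measurable]: "f \<in> borel_measurable M"
  shows "E f t \<le> ennreal C0 * K_functional (space_norm M \<rho>) (hom_sobolev_norm M \<rho>) f t"
proof -
  have "E f t \<le> ennreal C0 * (space_norm M \<rho> f0 + ennreal t * hom_sobolev_norm M \<rho> (\<lambda>x. f x - f0 x))" for f0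
  proof (cases "f0 \<in> borel_measurable M")
    case True
    then have [measurable]: "f0 \<in> borel_measurable M" .
    have "E f t = E (\<lambda>x. f0 x + (f x - f0 x)) t" by simp
    also have "\<dots> \<le> E f0 t + E (\<lambda>x. f x - f0 x) t" by (rule E_add) measurable
    also have "\<dots> \<le> ennreal C0 * space_norm M \<rho> f0 +
        ennreal C0 * (ennreal t * hom_sobolev_norm M \<rho> (\<lambda>x. f x - f0 x))"
      by (intro add_mono E_le_norm E_le_hom_sobolev t) measurable
    finally show ?thesis by (simp add: distrib_left)
  next
    case False
    then show ?thesis using C0_pos by (simp add: space_norm_def ennreal_mult_top)
  qed
  then show ?thesis
    unfolding K_functional_def using C0_pos by (intro ennreal_le_mult_INF) auto
qed

lemma osc_le_double:
  assumes r: "0 < r" "r \<le> s" "s \<le> 2 * r"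
  shows "osc f r x \<le> ennreal D * osc f s x"
proof -
  have V: "V x s \<le> D ^ 1 * V x r" using r by (intro V_le_pow) auto
  have "osc f r x = ennreal (1 / V x r) * (\<integral>\<^sup>+y\<in>ball x r. ennreal \<bar>f x - f y\<bar> \<partial>M)"
    using r by (intro osc_eq) auto
  also have "\<dots> \<le> ennreal (D / V x s) * (\<integral>\<^sup>+y\<in>ball x s. ennreal \<bar>f x - f y\<bar> \<partial>M)"
  proof (rule mult_mono[OF ennreal_leI nn_integral_mono])
    show "1 / V x r \<le> D / V x s" using V V_pos[of r x] V_pos[of s x] r by (simp add: field_simps)
    show "ennreal \<bar>f x - f y\<bar> * indicator (ball x r) y \<le> ennreal \<bar>f x - f y\<bar> * indicator (ball x s) y" for y
      using r by (auto simp: indicator_def)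
  qed auto
  also have "\<dots> = ennreal D * osc f s x"
    using r D_ge_1 V_pos[of s x] by (simp add: osc_eq mult.assoc[symmetric] ennreal_mult[symmetric])
  finally show ?thesis .
qed

text \<open>A substitute for monotonicity in the radius: enlarging the ball by a factor at most 2
  costs only the change of volume. It will compare a value at a dyadic scale with an integral over
  the next dyadic interval.\<close>

lemma E_le_double:
  assumes r: "0 < r" "r \<le> s" "s \<le> 2 * r" and [measurable]: "f \<in> borel_measurable M"
  shows "E f r \<le> ennreal D * E f s"
proof -
  have "E f r \<le> \<rho> (\<lambda>x. ennreal D * osc f s x)"
    unfolding oscillation_norm_def by (intro mono osc_le_double r) measurable
  also have "\<dots> = ennreal D * E f s"
    unfolding oscillation_norm_def using D_ge_1 by (intro scale) auto
  finally show ?thesis .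
qed

text \<open>Left lower semicontinuity: balls of radius r < t increase to the open ball of radius t
  as r tends to t, and the Fatou property carries this over to the norm.\<close>

lemma measurable_E:
  assumes [measurable]: "f \<in> borel_measurable M"
  shows "E f \<in> borel_measurable half_line"
proof (rule measurable_half_line_left_lsc)
  fix t :: real and a assume t: "0 < t" and a: "a < E f t"
  define r where "r n = t - 1 / real (Suc n)" for n
  \<comment> \<open>Only the domain of integration shrinks; the denominator stays at radius t. This
    makes \<open>u\<close> increasing, and \<open>u n x \<le> osc f s x\<close> for r n < s \<le> t
    because V(x,s) \<le> V(x,t).\<close>
  define u where "u n x = (\<integral>\<^sup>+y\<in>ball x (r n). ennreal \<bar>f x - f y\<bar> \<partial>M) / emeasure M (ball x t)" for n x
  have um [measurable]: "u n \<in> borel_measurable M" for n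
  proof -
    have "(\<integral>\<^sup>+y\<in>ball x (r n). ennreal \<bar>f x - f y\<bar> \<partial>M) =
        (\<integral>\<^sup>+y. (if dist x y < r n then ennreal \<bar>f x - f y\<bar> else 0) \<partial>M)" for x
      by (intro nn_integral_cong) (auto simp: indicator_def)
    then show ?thesis unfolding u_def by simp
  qed
  have rinc: "r n \<le> r n'" if "n \<le> n'" for n n'
    using that by (simp add: r_def field_simps)
  have inc: "incseq u"
    unfolding incseq_def le_fun_def u_def
    by (intro allI impI divide_right_mono_ennreal nn_integral_mono)
       (auto simp: indicator_def dest!: rinc)
  have sup: "(SUP n. u n x) = osc f t x" for x
  proof -
    have "(SUP n. u n x) = (SUP n. \<integral>\<^sup>+y\<in>ball x (r n). ennreal \<bar>f x - f y\<bar> \<partial>M) / emeasure M (ball x t)"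
      unfolding u_def divide_ennreal_def by (rule SUP_mult_right_ennreal[symmetric])
    also have "(SUP n. \<integral>\<^sup>+y\<in>ball x (r n). ennreal \<bar>f x - f y\<bar> \<partial>M) =
        (\<integral>\<^sup>+y. (SUP n. ennreal \<bar>f x - f y\<bar> * indicator (ball x (r n)) y) \<partial>M)"
      by (rule nn_integral_monotone_convergence_SUP[symmetric])
         (auto simp: incseq_def le_fun_def indicator_def dest!: rinc)
    also have "\<dots> = (\<integral>\<^sup>+y\<in>ball x t. ennreal \<bar>f x - f y\<bar> \<partial>M)"
    proof (rule nn_integral_cong)
      fix y
      have "(SUP n. indicator (ball x (r n)) y) = (indicator (ball x t) y :: ennreal)"
      proof (cases "dist x y < t")
        case True
        then obtain n where "1 / real (Suc n) < t - dist x y" by (metis nat_approx_posE diff_gt_0_iff_gt)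
        then have "dist x y < r n" by (simp add: r_def)
        then have "(1::ennreal) \<le> (SUP n. indicator (ball x (r n)) y)"
          by (intro SUP_upper2[of n]) auto
        moreover have "(SUP n. indicator (ball x (r n)) y) \<le> (1::ennreal)"
          by (intro SUP_least) (simp add: indicator_def)
        ultimately have "(SUP n. indicator (ball x (r n)) y) = (1::ennreal)" by (rule antisym[rotated])
        then show ?thesis using True by simp
      next
        case False
        have "r n < t" for n by (simp add: r_def)
        then have "\<not> dist x y < r n" for n using False by (meson less_trans)
        then show ?thesis using False by simp
      qed
      then show "(SUP n. ennreal \<bar>f x - f y\<bar> * indicator (ball x (r n)) y) = ennreal \<bar>f x - f y\<bar> * indicator (ball x t) y"
        by (simp add: SUP_mult_left_ennreal[symmetric])
    qed
    finally show ?thesis by (simp add: mean_oscillation_def)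
  qed
  have "E f t = (SUP n. \<rho> (u n))"
    unfolding oscillation_norm_def using fatou[OF um inc] by (simp add: sup)
  then obtain n where n: "a < \<rho> (u n)" using a by (auto simp: less_SUP_iff)
  have "a < E f s" if "max 0 (r n) < s" "s \<le> t" for s
  proof -
    have "u n x \<le> osc f s x" for x
    proof -
      have "V x s \<le> V x t" using that by (intro V_mono) auto
      moreover have "0 < V x s" using that by (intro V_pos) auto
      ultimately have "1 / V x t \<le> 1 / V x s" by (simp add: frac_le)
      have "u n x = ennreal (1 / V x t) * (\<integral>\<^sup>+y\<in>ball x (r n). ennreal \<bar>f x - f y\<bar> \<partial>M)"
        unfolding u_def emeasure_ball by (rule divide_ennreal_eq_times[OF V_pos[OF t]])
      also have "\<dots> \<le> ennreal (1 / V x s) * (\<integral>\<^sup>+y\<in>ball x s. ennreal \<bar>f x - f y\<bar> \<partial>M)"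
        using that by (intro mult_mono ennreal_leI \<open>1 / V x t \<le> 1 / V x s\<close> nn_integral_mono)
          (auto simp: indicator_def)
      also have "\<dots> = osc f s x" using that by (simp add: osc_eq)
      finally show ?thesis .
    qed
    then have "\<rho> (u n) \<le> E f s" unfolding oscillation_norm_def by (intro mono) measurable
    with n show ?thesis by (rule less_le_trans)
  qed
  moreover have "max 0 (r n) < t" using t by (simp add: r_def)
  ultimately show "\<exists>r<t. \<forall>s. r < s \<longrightarrow> s \<le> t \<longrightarrow> a < E f s" by blast
qed

text \<open>If all sets {|f| > n} had infinite measure, f would dominate n times the indicator of a
  unit ball in distribution for each n, and its norm would be infinite. On a superlevel set of
  finite measure f is integrable by the local L^1 bound of the norm; off it f is bounded.\<close>

lemma norm_finite_imp_L1_plus_Linf: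
  assumes fin: "space_norm M \<rho> f < \<infinity>"
  shows "f \<in> L1_plus_Linf M"
proof -
  have [measurable]: "f \<in> borel_measurable M" by (rule space_norm_finite_measurable[OF fin])
  let ?B = "ball (q 0) 1"
  have Bfin: "\<rho> (indicator ?B) < \<infinity>"
    by (rule banach_function_normD(6)[OF bfn sets_ball ball_finite])
  have B0: "\<rho> (indicator ?B) \<noteq> 0"
  proof
    assume "\<rho> (indicator ?B) = 0"
    then have "AE x in M. indicator ?B x = (0::ennreal)" by (subst (asm) zero_iff) auto
    then have "AE x in M. x \<notin> ?B" by (auto elim!: eventually_mono simp: indicator_def split: if_splits)
    then have "emeasure M ?B = 0" by (subst (asm) AE_iff_measurable[of ?B]) auto
    then show False using ball_pos[of 1 "q 0"] by simp
  qed
  have "\<exists>n::nat. emeasure M {x. real n < \<bar>f x\<bar>} < \<infinity>"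
  proof (rule ccontr)
    assume "\<not> ?thesis"
    then have inf: "emeasure M {x. real n < \<bar>f x\<bar>} = \<infinity>" for n :: nat by (metis infinity_ennreal_def less_top)
    have "of_nat n * \<rho> (indicator ?B) \<le> space_norm M \<rho> f" for n
    proof -
      have "emeasure M {x \<in> space M. s < of_nat n * indicator ?B x} \<le> emeasure M {x \<in> space M. s < ennreal \<bar>f x\<bar>}" for s :: ennreal
      proof (cases "s < of_nat n")
        case True
        have "{x. real n < \<bar>f x\<bar>} \<subseteq> {x \<in> space M. s < ennreal \<bar>f x\<bar>}"
        proof
          fix x assume "x \<in> {x. real n < \<bar>f x\<bar>}"
          then have "ennreal (real n) \<le> ennreal \<bar>f x\<bar>" by (intro ennreal_leI) simp
          then have "s < ennreal \<bar>f x\<bar>"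
            by (rule less_le_trans[OF True[unfolded ennreal_of_nat_eq_real_of_nat]])
          then show "x \<in> {x \<in> space M. s < ennreal \<bar>f x\<bar>}" by simp
        qed
        then have "emeasure M {x. real n < \<bar>f x\<bar>} \<le> emeasure M {x \<in> space M. s < ennreal \<bar>f x\<bar>}"
          by (rule emeasure_mono) measurable
        then show ?thesis using inf[of n] by (simp add: top_unique)
      next
        case False
        then have "{x \<in> space M. s < of_nat n * indicator ?B x} = {}"
          by (auto simp: indicator_def)
        then show ?thesis by (simp only: emeasure_empty zero_le)
      qed
      then have "\<rho> (\<lambda>x. of_nat n * indicator ?B x) \<le> \<rho> (\<lambda>x. ennreal \<bar>f x\<bar>)"
        using fin by (intro ri_space_le[OF ri]) (auto simp: space_norm_eq)
      moreover have "\<rho> (\<lambda>x. of_nat n * indicator ?B x) = of_nat n * \<rho> (indicator ?B)"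
        using scale[of "indicator ?B" "real n"] by (simp add: ennreal_of_nat_eq_real_of_nat)
      ultimately show ?thesis by (simp add: space_norm_eq)
    qed
    then have "(SUP n. of_nat n * \<rho> (indicator ?B)) \<le> space_norm M \<rho> f" by (rule SUP_least)
    moreover have "(SUP n. of_nat n * \<rho> (indicator ?B)) = \<infinity>"
      using B0 by (simp add: SUP_mult_right_ennreal[symmetric] ennreal_SUP_of_nat_eq_top ennreal_top_mult)
    ultimately show False using fin by simp
  qed
  then obtain n :: nat where n: "emeasure M {x. real n < \<bar>f x\<bar>} < \<infinity>" by blast
  let ?A = "{x. real n < \<bar>f x\<bar>}"
  have A: "?A \<in> sets M"
  proof -
    have "{x \<in> space M. real n < \<bar>f x\<bar>} \<in> sets M" by measurable
    then show ?thesis by simp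
  qed
  obtain C :: real where "\<And>f. f \<in> borel_measurable M \<Longrightarrow> (\<integral>\<^sup>+x\<in>?A. f x \<partial>M) \<le> ennreal C * \<rho> f"
    using banach_function_normD(7)[OF bfn A n] by blast
  from this[of "\<lambda>x. ennreal \<bar>f x\<bar>"]
  have "(\<integral>\<^sup>+x\<in>?A. ennreal \<bar>f x\<bar> \<partial>M) \<le> ennreal C * space_norm M \<rho> f" by (simp add: space_norm_eq)
  then have int: "(\<integral>\<^sup>+x\<in>?A. ennreal \<bar>f x\<bar> \<partial>M) < \<infinity>"
    using fin by (auto simp: ennreal_mult_less_top intro: le_less_trans)
  let ?f0 = "\<lambda>x. f x * indicator ?A x" and ?f1 = "\<lambda>x. f x * indicator (- ?A) x"
  note [measurable] = A
  have "L1_norm M ?f0 = (\<integral>\<^sup>+x\<in>?A. ennreal \<bar>f x\<bar> \<partial>M)"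
    unfolding L1_norm_def by (subst L1.space_norm_eq) (auto intro!: nn_integral_cong simp: indicator_def)
  moreover have "Linf_norm M ?f1 \<le> ennreal (real n)"
    by (subst Linf_norm_le_iff) (measurable, auto simp: indicator_def intro!: AE_I2 ennreal_leI)
  moreover have "f = (\<lambda>x. ?f0 x + ?f1 x)" by (auto simp: indicator_def)
  ultimately show ?thesis
    unfolding L1_plus_Linf_iff using int by (intro exI[of _ ?f0] exI[of _ ?f1]) (auto intro: le_less_trans)
qed

end

section \<open>Smoothing\<close>

context doubling_ri_space
begin

lemma integrable_kernel:
  assumes f: "f \<in> L1_plus_Linf M" and [measurable]: "k \<in> borel_measurable M"
    and k: "\<And>y. \<bar>k y\<bar> \<le> c * indicator (ball x r) y"
  shows "integrable M (\<lambda>y. k y * f y)"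
proof -
  have [measurable]: "f \<in> borel_measurable M" by (rule L1_plus_Linf_measurable[OF f])
  have "integrable M (\<lambda>y. indicator (ball x r) y * f y)"
  proof (rule integrableI_bounded)
    have "(\<integral>\<^sup>+y. ennreal (norm (indicator (ball x r) y * f y)) \<partial>M) = (\<integral>\<^sup>+y\<in>ball x r. ennreal \<bar>f y\<bar> \<partial>M)"
      by (intro nn_integral_cong) (auto simp: indicator_def)
    also have "\<dots> < \<infinity>" by (rule L1_plus_Linf_integrable_on[OF f sets_ball ball_finite])
    finally show "(\<integral>\<^sup>+y. ennreal (norm (indicator (ball x r) y * f y)) \<partial>M) < \<infinity>" .
  qed measurable
  then have "integrable M (\<lambda>y. c * (indicator (ball x r) y * f y))" by simp
  then show ?thesis
  proof (rule Bochner_Integration.integrable_bound)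
    show "AE y in M. norm (k y * f y) \<le> norm (c * (indicator (ball x r) y * f y))"
    proof (rule AE_I2)
      fix y
      have "\<bar>k y\<bar> \<le> \<bar>c * indicator (ball x r) y\<bar>" using k[of y] by linarith
      then show "norm (k y * f y) \<le> norm (c * (indicator (ball x r) y * f y))"
        by (simp add: abs_mult mult.assoc[symmetric] mult_right_mono)
    qed
  qed measurable
qed

lemma L1_plus_Linf_const: "(\<lambda>y. c) \<in> L1_plus_Linf M"
proof -
  have "Linf_norm M (\<lambda>y. c) \<le> ennreal \<bar>c\<bar>" by (subst Linf_norm_le_iff) auto
  then have "Linf_norm M (\<lambda>y. c) < \<infinity>" by (rule le_less_trans) simp
  then show ?thesis
    unfolding L1_plus_Linf_iff by (intro exI[of _ "\<lambda>x. 0"] exI[of _ "\<lambda>x. c"]) (simp add: L1_norm_def)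
qed

definition osc_integral :: "('a \<Rightarrow> real) \<Rightarrow> real \<Rightarrow> 'a \<Rightarrow> real \<Rightarrow> real" where
  "osc_integral f c x r = (\<integral>y. indicator (ball x r) y * \<bar>f y - c\<bar> \<partial>M)"

text \<open>Real-valued form of \<open>mean_oscillation\<close>. For f in L^1 + L^\<infinity> and r
  > 0 they agree at every x, so pointwise estimates can use real arithmetic.\<close>

definition rosc :: "('a \<Rightarrow> real) \<Rightarrow> real \<Rightarrow> 'a \<Rightarrow> real" where
  "rosc f r x = osc_integral f (f x) x r / V x r"

lemma rosc_nonneg: "0 \<le> rosc f r x"
  unfolding rosc_def osc_integral_def by (intro divide_nonneg_nonneg integral_nonneg_AE AE_I2) auto

context
  fixes f :: "'a \<Rightarrow> real"
  assumes f: "f \<in> L1_plus_Linf M"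
begin

lemma f_meas [measurable]: "f \<in> borel_measurable M"
  by (rule L1_plus_Linf_measurable[OF f])

lemma f_diff: "(\<lambda>y. f y - c) \<in> L1_plus_Linf M"
  by (rule L1_plus_Linf_diff[OF f L1_plus_Linf_const])

lemma integrable_osc: "integrable M (\<lambda>y. indicator (ball x r) y * \<bar>f y - c\<bar>)"
proof -
  have "integrable M (\<lambda>y. indicator (ball x r) y * (f y - c))"
    by (rule integrable_kernel[OF f_diff, of _ 1 x r]) (auto simp: indicator_def)
  then have "integrable M (\<lambda>y. \<bar>indicator (ball x r) y * (f y - c)\<bar>)" by (rule integrable_abs)
  then show ?thesis by (simp add: abs_mult)
qed

lemma kernel_bound:
  assumes [measurable]: "k \<in> borel_measurable M" and k: "\<And>y. \<bar>k y\<bar> \<le> c * indicator (ball x r) y"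
  shows "\<bar>\<integral>y. k y * (f y - a) \<partial>M\<bar> \<le> c * osc_integral f a x r"
proof -
  have "\<bar>\<integral>y. k y * (f y - a) \<partial>M\<bar> \<le> (\<integral>y. \<bar>k y * (f y - a)\<bar> \<partial>M)"
    by (rule integral_abs_bound)
  also have "\<dots> \<le> (\<integral>y. c * (indicator (ball x r) y * \<bar>f y - a\<bar>) \<partial>M)"
  proof (rule integral_mono)
    show "integrable M (\<lambda>y. \<bar>k y * (f y - a)\<bar>)"
      by (intro integrable_abs integrable_kernel[OF f_diff _ k]) measurable
    show "integrable M (\<lambda>y. c * (indicator (ball x r) y * \<bar>f y - a\<bar>))" using integrable_osc by simp
    show "\<bar>k y * (f y - a)\<bar> \<le> c * (indicator (ball x r) y * \<bar>f y - a\<bar>)" for y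
      using mult_right_mono[OF k[of y], of "\<bar>f y - a\<bar>"] by (simp add: abs_mult mult.assoc)
  qed
  finally show ?thesis by (simp add: osc_integral_def)
qed

lemma osc_eq_rosc: "0 < r \<Longrightarrow> osc f r x = ennreal (rosc f r x)"
proof -
  assume r: "0 < r"
  have "(\<integral>\<^sup>+y\<in>ball x r. ennreal \<bar>f x - f y\<bar> \<partial>M) = (\<integral>\<^sup>+y. ennreal (indicator (ball x r) y * \<bar>f y - f x\<bar>) \<partial>M)"
    by (intro nn_integral_cong) (auto simp: indicator_def abs_minus_commute)
  also have "\<dots> = ennreal (osc_integral f (f x) x r)"
    unfolding osc_integral_def by (rule nn_integral_eq_integral[OF integrable_osc]) auto
  finally have "osc f r x = ennreal (1 / V x r) * ennreal (osc_integral f (f x) x r)" by (simp add: osc_eq[OF r])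
  also have "\<dots> = ennreal (1 / V x r * osc_integral f (f x) x r)"
    by (rule ennreal_mult'[symmetric]) simp
  finally show ?thesis by (simp add: rosc_def)
qed

lemma osc_integral_eq: "0 < r \<Longrightarrow> osc_integral f (f x) x r = V x r * rosc f r x"
  using V_pos[of r x] by (simp add: rosc_def)

text \<open>A tent instead of the indicator of the ball: psi changes by at most d(x,y) when its
  centre moves from x to y, so the average is Lipschitz at scale t even where volumes of balls
  jump.\<close>

definition psi :: "real \<Rightarrow> 'a \<Rightarrow> 'a \<Rightarrow> real" where "psi t x y = max 0 (t - dist x y)"

definition Psi :: "real \<Rightarrow> 'a \<Rightarrow> real" where "Psi t x = (\<integral>y. psi t x y \<partial>M)"

definition smooth :: "real \<Rightarrow> 'a \<Rightarrow> real" where "smooth t x = (\<integral>y. psi t x y * f y \<partial>M) / Psi t x"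

lemma measurable_psi [measurable (raw)]:
  assumes [measurable]: "u \<in> measurable L M" "v \<in> measurable L M"
  shows "(\<lambda>z. psi t (u z) (v z)) \<in> borel_measurable L"
  unfolding psi_def by measurable

lemma psi_le: "0 < t \<Longrightarrow> \<bar>psi t x y\<bar> \<le> t * indicator (ball x t) y"
  by (auto simp: psi_def indicator_def)

lemma integrable_psi: "0 < t \<Longrightarrow> integrable M (psi t x)"
proof -
  assume t: "0 < t"
  have "integrable M (\<lambda>y. psi t x y * 1)"
    by (rule integrable_kernel[OF L1_plus_Linf_const _ psi_le[OF t]]) measurable
  then show ?thesis by simp
qed

lemma Psi_ge:
  assumes t: "0 < t"
  shows "t / 2 * V x (t / 2) \<le> Psi t x"
proof -
  have "t / 2 * V x (t / 2) = (\<integral>y. t / 2 * indicator (ball x (t / 2)) y \<partial>M)" by simp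
  also have "\<dots> \<le> Psi t x"
    unfolding Psi_def
  proof (rule integral_mono)
    show "integrable M (\<lambda>y. t / 2 * indicator (ball x (t / 2)) y)"
      using ball_finite by (intro integrable_mult_right integrable_real_indicator) auto
    show "t / 2 * indicator (ball x (t / 2)) y \<le> psi t x y" for y
      using t by (auto simp: psi_def indicator_def)
  qed (rule integrable_psi[OF t])
  finally show ?thesis .
qed

lemma Psi_pos: "0 < t \<Longrightarrow> 0 < Psi t x"
proof -
  assume t: "0 < t"
  then have "0 < t / 2 * V x (t / 2)" using V_pos[of "t / 2" x] by (intro mult_pos_pos) auto
  then show ?thesis using Psi_ge[OF t, of x] by linarith
qed

text \<open>A normalised average reproduces constants, so any reference value may be subtracted; it
  is taken to be f(x), which turns the integrals into mean oscillations.\<close>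

lemma smooth_eq:
  assumes t: "0 < t"
  shows "smooth t x = c + (\<integral>y. psi t x y * (f y - c) \<partial>M) / Psi t x"
proof -
  have "(\<integral>y. psi t x y * (f y - c) \<partial>M) = (\<integral>y. psi t x y * f y - c * psi t x y \<partial>M)"
    by (simp add: algebra_simps)
  also have "\<dots> = (\<integral>y. psi t x y * f y \<partial>M) - c * Psi t x"
    unfolding Psi_def
    by (subst Bochner_Integration.integral_diff)
       (auto intro!: integrable_kernel[OF f _ psi_le[OF t]] integrable_psi[OF t] integrable_mult_right)
  finally show ?thesis using Psi_pos[OF t, of x] by (simp add: smooth_def field_simps)
qed

lemma measurable_smooth [measurable]: "smooth t \<in> borel_measurable M"
  unfolding smooth_def Psi_def by measurable

lemma smooth_diff_le:
  assumes t: "0 < t"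
  shows "\<bar>smooth t x - f x\<bar> \<le> 2 * D * rosc f t x"
proof -
  have P: "0 < Psi t x" by (rule Psi_pos[OF t])
  have "\<bar>smooth t x - f x\<bar> = \<bar>\<integral>y. psi t x y * (f y - f x) \<partial>M\<bar> / Psi t x"
    using P by (subst smooth_eq[OF t, of x "f x"]) simp
  also have "\<dots> \<le> (t * osc_integral f (f x) x t) / Psi t x"
    using P by (intro divide_right_mono kernel_bound psi_le t) auto
  also have "\<dots> = t * (V x t * rosc f t x) / Psi t x" using t by (simp add: osc_integral_eq)
  also have "\<dots> \<le> 2 * D * rosc f t x"
  proof -
    \<comment> \<open>The tent is at least t/2 on the half ball, which carries at least 1/D of the
      volume: the origin of 2 D.\<close>
    have "V x t \<le> D ^ 1 * V x (t / 2)" using t by (intro V_le_pow) auto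
    then have "t * V x t \<le> 2 * D * (t / 2 * V x (t / 2))" using t by (simp add: field_simps)
    also have "\<dots> \<le> 2 * D * Psi t x" using D_ge_1 Psi_ge[OF t] by (intro mult_left_mono) auto
    finally have "t * V x t * rosc f t x \<le> 2 * D * Psi t x * rosc f t x"
      by (rule mult_right_mono) (rule rosc_nonneg)
    then show ?thesis using P by (simp add: field_simps)
  qed
  finally show ?thesis .
qed

text \<open>Both averages are measured against the same value f(x) on the same ball of radius 2t
  about x. Then only the tent and its normalisation vary, each in proportion to d(x,y).\<close>

lemma smooth_lipschitz:
  assumes t: "0 < t" and d: "dist x y < t"
  shows "\<bar>smooth t x - smooth t y\<bar> \<le> 6 * D ^ 5 * dist x y / t * rosc f (2 * t) x"
proof -
  define a where "a = V x (2 * t)"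
  define R where "R = rosc f (2 * t) x"
  have a: "0 < a" unfolding a_def using t by (intro V_pos) auto
  have R: "0 \<le> R" unfolding R_def by (rule rosc_nonneg)
  have Px: "0 < Psi t x" and Py: "0 < Psi t y" using Psi_pos[OF t] by auto
  have "a \<le> D ^ 2 * V x (t / 2)" unfolding a_def using t by (intro V_le_pow) auto
  then have "t * a \<le> 2 * D ^ 2 * (t / 2 * V x (t / 2))" using t by (simp add: field_simps)
  also have "\<dots> \<le> 2 * D ^ 2 * Psi t x" using D_ge_1 Psi_ge[OF t, of x] by (intro mult_left_mono) auto
  finally have ix: "1 / Psi t x \<le> 2 * D ^ 2 / (t * a)" using Px t a by (simp add: field_simps)
  have "a \<le> D ^ 3 * V y (t / 2)"
    unfolding a_def using t d by (intro V_le_pow) (auto simp: dist_commute)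
  then have "t * a \<le> 2 * D ^ 3 * (t / 2 * V y (t / 2))" using t by (simp add: field_simps)
  also have "\<dots> \<le> 2 * D ^ 3 * Psi t y" using D_ge_1 Psi_ge[OF t, of y] by (intro mult_left_mono) auto
  finally have iy: "1 / Psi t y \<le> 2 * D ^ 3 / (t * a)" using Py t a by (simp add: field_simps)
  have sub: "z \<in> ball x (2 * t)" if "dist x z < t \<or> dist y z < t" for z
    using that d dist_triangle[of x z y] t by auto
  have diff: "\<bar>psi t x z - psi t y z\<bar> \<le> dist x y * indicator (ball x (2 * t)) z" for z
  proof (cases "dist x z < t \<or> dist y z < t")
    case True
    have "\<bar>dist x z - dist y z\<bar> \<le> dist x y"
      using dist_triangle[of x z y] dist_triangle[of y z x] by (simp add: abs_le_iff dist_commute)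
    then have "\<bar>psi t x z - psi t y z\<bar> \<le> dist x y"
      unfolding psi_def max_def by (auto simp: abs_le_iff)
    then show ?thesis using sub[OF True] by simp
  next
    case False
    then have "psi t x z = 0" "psi t y z = 0" by (auto simp: psi_def)
    then show ?thesis by simp
  qed
  have psiy: "\<bar>psi t y z\<bar> \<le> t * indicator (ball x (2 * t)) z" for z
    using sub[of z] t by (cases "dist y z < t") (auto simp: psi_def indicator_def)
  define A where "A = (\<integral>z. (psi t x z - psi t y z) * (f z - f x) \<partial>M)"
  define B where "B = (\<integral>z. psi t y z * (f z - f x) \<partial>M)"
  have A_le: "\<bar>A\<bar> \<le> dist x y * (a * R)"
    unfolding A_def a_def R_def using kernel_bound[OF _ diff, of "f x"] t by (simp add: osc_integral_eq)
  have B_le: "\<bar>B\<bar> \<le> t * (a * R)"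
    unfolding B_def a_def R_def using kernel_bound[OF _ psiy, of "f x"] t by (simp add: osc_integral_eq)
  have P_le: "\<bar>Psi t y - Psi t x\<bar> \<le> dist x y * a"
  proof -
    have "Psi t x - Psi t y = (\<integral>z. psi t x z - psi t y z \<partial>M)"
      unfolding Psi_def
      by (rule Bochner_Integration.integral_diff[OF integrable_psi[OF t] integrable_psi[OF t], symmetric])
    then have "\<bar>Psi t y - Psi t x\<bar> = \<bar>\<integral>z. psi t x z - psi t y z \<partial>M\<bar>"
      by (metis abs_minus_commute)
    also have "\<dots> \<le> (\<integral>z. \<bar>psi t x z - psi t y z\<bar> \<partial>M)" by (rule integral_abs_bound)
    also have "\<dots> \<le> (\<integral>z. dist x y * indicator (ball x (2 * t)) z \<partial>M)"
    proof (rule integral_mono)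
      show "integrable M (\<lambda>z. \<bar>psi t x z - psi t y z\<bar>)"
        by (intro integrable_abs Bochner_Integration.integrable_diff integrable_psi t)
      show "integrable M (\<lambda>z. dist x y * indicator (ball x (2 * t)) z)"
        using ball_finite by (intro integrable_mult_right integrable_real_indicator) auto
    qed (rule diff)
    finally show ?thesis by (simp add: a_def)
  qed
  have "(\<integral>z. psi t x z * (f z - f x) \<partial>M) = A + B"
  proof -
    have "A = (\<integral>z. psi t x z * (f z - f x) - psi t y z * (f z - f x) \<partial>M)"
      unfolding A_def by (simp add: algebra_simps)
    also have "\<dots> = (\<integral>z. psi t x z * (f z - f x) \<partial>M) - B"
      unfolding B_def
      by (rule Bochner_Integration.integral_diff)
         (auto intro!: integrable_kernel[OF f_diff _ psi_le[OF t]])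
    finally show ?thesis by simp
  qed
  then have "smooth t x - smooth t y = (A + B) / Psi t x - B / Psi t y"
    using smooth_eq[OF t, of x "f x"] smooth_eq[OF t, of y "f x"] by (simp add: B_def)
  \<comment> \<open>Separates the change of the numerator from the change of the normalising
    factor.\<close>
  also have "\<dots> = A * (1 / Psi t x) + B * (Psi t y - Psi t x) * (1 / Psi t x) * (1 / Psi t y)"
    using Px Py by (simp add: field_simps)
  finally have "\<bar>smooth t x - smooth t y\<bar> \<le>
      \<bar>A\<bar> * (1 / Psi t x) + \<bar>B\<bar> * \<bar>Psi t y - Psi t x\<bar> * (1 / Psi t x) * (1 / Psi t y)"
    using Px Py by (metis abs_mult abs_of_pos abs_triangle_ineq zero_less_divide_1_iff)
  also have "\<dots> \<le> (dist x y * (a * R)) * (2 * D ^ 2 / (t * a)) +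
      (t * (a * R)) * (dist x y * a) * (2 * D ^ 2 / (t * a)) * (2 * D ^ 3 / (t * a))"
    using A_le B_le P_le ix iy Px Py t a R D_ge_1
    by (intro add_mono mult_mono) auto
  also have "\<dots> = (2 * D ^ 2 + 4 * D ^ 5) * (dist x y / t * R)"
    using t a by (simp add: field_simps power2_eq_square power3_eq_cube eval_nat_numeral)
  \<comment> \<open>D^2 compares V(x,2t) with V(x,t/2), and D^3 compares it with V(y,t/2); their
    product occurs in the second term and dominates.\<close>
  also have "\<dots> \<le> (6 * D ^ 5) * (dist x y / t * R)"
  proof (rule mult_right_mono)
    have "D ^ 2 \<le> D ^ 5" using D_ge_1 by (intro power_increasing) auto
    then show "2 * D ^ 2 + 4 * D ^ 5 \<le> 6 * D ^ 5" by simp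
  qed (use t R in auto)
  finally show ?thesis by (simp add: R_def)
qed

text \<open>Average |f(x) - f(z)| + |f(z) - f(y)| over z in \<open>ball x r\<close>, then enlarge
  the ball to \<open>ball y (2 * r)\<close> in the second term, at the cost of D^2 in
  volume.\<close>

lemma diff_le_rosc:
  assumes r: "0 < r" and d: "dist x y = r"
  shows "\<bar>f x - f y\<bar> \<le> rosc f r x + D ^ 2 * rosc f (2 * r) y"
proof -
  have sub: "ball x r \<subseteq> ball y (2 * r)"
  proof
    fix z assume "z \<in> ball x r"
    then show "z \<in> ball y (2 * r)" using d dist_triangle[of y z x] by (simp add: dist_commute)
  qed
  have "V x r * \<bar>f x - f y\<bar> = (\<integral>z. indicator (ball x r) z * \<bar>f x - f y\<bar> \<partial>M)" by simp
  also have "\<dots> \<le> (\<integral>z. indicator (ball x r) z * \<bar>f z - f x\<bar> + indicator (ball y (2 * r)) z * \<bar>f z - f y\<bar> \<partial>M)"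
  proof (rule integral_mono)
    show "integrable M (\<lambda>z. indicator (ball x r) z * \<bar>f x - f y\<bar>)"
      using ball_finite by (intro integrable_mult_left integrable_real_indicator) auto
    show "integrable M (\<lambda>z. indicator (ball x r) z * \<bar>f z - f x\<bar> + indicator (ball y (2 * r)) z * \<bar>f z - f y\<bar>)"
      by (intro Bochner_Integration.integrable_add integrable_osc)
    show "indicator (ball x r) z * \<bar>f x - f y\<bar> \<le>
        indicator (ball x r) z * \<bar>f z - f x\<bar> + indicator (ball y (2 * r)) z * \<bar>f z - f y\<bar>" for z
      using sub by (auto simp: indicator_def)
  qed
  also have "\<dots> = V x r * rosc f r x + V y (2 * r) * rosc f (2 * r) y"
    using r by (subst Bochner_Integration.integral_add[OF integrable_osc integrable_osc])
      (simp add: osc_integral_def[symmetric] osc_integral_eq)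
  also have "\<dots> \<le> V x r * rosc f r x + (D ^ 2 * V x r) * rosc f (2 * r) y"
  proof (intro add_left_mono mult_right_mono rosc_nonneg)
    show "V y (2 * r) \<le> D ^ 2 * V x r" using r d by (intro V_le_pow) auto
  qed
  finally have "V x r * \<bar>f x - f y\<bar> \<le> V x r * (rosc f r x + D ^ 2 * rosc f (2 * r) y)"
    by (simp add: algebra_simps)
  then show ?thesis using V_pos[OF r, of x] by simp
qed

lemma rosc_le_double:
  assumes "0 < r" "r \<le> s" "s \<le> 2 * r"
  shows "rosc f r x \<le> D * rosc f s x"
proof -
  have "ennreal (rosc f r x) \<le> ennreal (D * rosc f s x)"
    using osc_le_double[OF assms, of f x] assms D_ge_1
    by (simp add: osc_eq_rosc ennreal_mult rosc_nonneg)
  then show ?thesis using D_ge_1 by (simp add: rosc_nonneg)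
qed

section \<open>A gradient for the smoothed function\<close>

definition osc_sum :: "real \<Rightarrow> 'a \<Rightarrow> ennreal" where
  "osc_sum t x = (\<Sum>j. ennreal ((1 / 2) ^ j) * osc f (2 ^ j * t) x)"

lemma measurable_osc_sum [measurable]: "osc_sum t \<in> borel_measurable M"
  unfolding osc_sum_def by measurable

lemma rosc_le_osc_sum:
  assumes t: "0 < t" and s: "osc_sum t x = ennreal s" "0 \<le> s"
  shows "rosc f (2 ^ j * t) x \<le> 2 ^ j * s"
proof -
  have "(\<Sum>j\<in>{j}. ennreal ((1 / 2) ^ j) * osc f (2 ^ j * t) x) \<le> osc_sum t x"
    unfolding osc_sum_def by (rule sum_le_suminf) auto
  then have "ennreal ((1 / 2) ^ j) * ennreal (rosc f (2 ^ j * t) x) \<le> ennreal s"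
    using t s(1) by (simp add: osc_eq_rosc)
  then have "(1 / 2) ^ j * rosc f (2 ^ j * t) x \<le> s"
    using s(2) by (simp add: ennreal_mult[symmetric] rosc_nonneg)
  then show ?thesis by (simp add: power_divide field_simps)
qed

text \<open>For d(x,y) < t the Lipschitz estimate uses only the term at scale 2t. For r = d(x,y)
  \<ge> t one goes through f: replacing the average by f costs an oscillation at scale t, affordable
  since 1 \<le> r/t, and f(x) - f(y) costs oscillations at scales r and 2r, which the weighted sum
  controls with a factor comparable to r/t.\<close>

lemma smooth_diff_le_osc_sum:
  assumes t: "0 < t"
    and sx: "osc_sum t x = ennreal sx" "0 \<le> sx" and sy: "osc_sum t y = ennreal sy" "0 \<le> sy"
  shows "\<bar>smooth t x - smooth t y\<bar> \<le> dist x y * (12 * D ^ 5 / t * sx + 12 * D ^ 5 / t * sy)"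
proof (cases "dist x y < t")
  case True
  have "\<bar>smooth t x - smooth t y\<bar> \<le> 6 * D ^ 5 * dist x y / t * rosc f (2 * t) x"
    by (rule smooth_lipschitz[OF t True])
  also have "\<dots> \<le> 6 * D ^ 5 * dist x y / t * (2 * sx)"
    using rosc_le_osc_sum[OF t sx, of 1] t D_ge_1 by (intro mult_left_mono) auto
  also have "\<dots> = dist x y * (12 * D ^ 5 / t * sx)" by (simp add: field_simps)
  also have "\<dots> \<le> dist x y * (12 * D ^ 5 / t * sx + 12 * D ^ 5 / t * sy)"
    using t D_ge_1 sy by (intro mult_left_mono) auto
  finally show ?thesis .
next
  case False
  define r where "r = dist x y"
  have r: "t \<le> r" "0 < r" using False t by (auto simp: r_def)
  \<comment> \<open>Scales r and 2r are rounded up to the dyadic scales j+1 and j+2; the weights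
    there cost at most 2 r/t and 4 r/t.\<close>
  obtain j where j: "2 ^ j * t \<le> r" "r < 2 ^ Suc j * t"
  proof -
    obtain n :: nat where n: "r / t < 2 ^ n" using real_arch_pow[of 2 "r / t"] by auto
    define m where "m = (LEAST n. r / t < 2 ^ n)"
    have m: "r / t < 2 ^ m" unfolding m_def by (rule LeastI[of "\<lambda>n. r / t < 2 ^ n", OF n])
    have "m \<noteq> 0" using m r t by (intro notI) (simp add: field_simps)
    then obtain j where mj: "m = Suc j" by (cases m) auto
    have "\<not> r / t < 2 ^ j" using not_less_Least[of j "\<lambda>n. r / t < 2 ^ n"] mj by (simp add: m_def)
    then show thesis using m mj t by (intro that[of j]) (auto simp: field_simps)
  qed
  have x1: "rosc f t x \<le> sx" and y1: "rosc f t y \<le> sy"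
    using rosc_le_osc_sum[OF t sx, of 0] rosc_le_osc_sum[OF t sy, of 0] by auto
  have q1: "1 \<le> r / t" using r t by simp
  have q2: "2 ^ j \<le> r / t" using j t by (simp add: field_simps)
  have "rosc f r x \<le> D * rosc f (2 ^ Suc j * t) x"
    using r j by (intro rosc_le_double) (simp_all add: mult_ac)
  also have "\<dots> \<le> D * (2 ^ Suc j * sx)"
    using D_ge_1 by (intro mult_left_mono rosc_le_osc_sum t sx) auto
  also have "\<dots> \<le> D * (2 * (r / t) * sx)" using D_ge_1 q2 sx(2) by (intro mult_left_mono mult_right_mono) auto
  finally have x2: "rosc f r x \<le> 2 * D * (r / t) * sx" by (simp add: mult_ac)
  have "rosc f (2 * r) y \<le> D * rosc f (2 ^ Suc (Suc j) * t) y"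
    using r j by (intro rosc_le_double) (simp_all add: mult_ac)
  also have "\<dots> \<le> D * (2 ^ Suc (Suc j) * sy)"
    using D_ge_1 by (intro mult_left_mono rosc_le_osc_sum t sy) auto
  also have "\<dots> \<le> D * (4 * (r / t) * sy)" using D_ge_1 q2 sy(2) by (intro mult_left_mono mult_right_mono) auto
  finally have "D ^ 2 * rosc f (2 * r) y \<le> D ^ 2 * (D * (4 * (r / t) * sy))"
    using D_ge_1 by (intro mult_left_mono) auto
  then have y2: "D ^ 2 * rosc f (2 * r) y \<le> 4 * D ^ 3 * (r / t) * sy"
    by (simp add: power2_eq_square power3_eq_cube mult_ac)
  have fx: "\<bar>smooth t x - f x\<bar> \<le> 2 * D * (r / t) * sx"
  proof -
    have "\<bar>smooth t x - f x\<bar> \<le> 2 * D * rosc f t x" by (rule smooth_diff_le[OF t])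
    also have "\<dots> \<le> 2 * D * ((r / t) * sx)"
      using x1 q1 mult_right_mono[OF q1 sx(2)] D_ge_1 by (intro mult_left_mono) auto
    finally show ?thesis by simp
  qed
  have fy: "\<bar>smooth t y - f y\<bar> \<le> 2 * D * (r / t) * sy"
  proof -
    have "\<bar>smooth t y - f y\<bar> \<le> 2 * D * rosc f t y" by (rule smooth_diff_le[OF t])
    also have "\<dots> \<le> 2 * D * ((r / t) * sy)"
      using y1 q1 mult_right_mono[OF q1 sy(2)] D_ge_1 by (intro mult_left_mono) auto
    finally show ?thesis by simp
  qed
  \<comment> \<open>The far case needs only 4 D and 2 D + 4 D^3; the constant 12 D^5 is dictated by
    the near case, 6 D^5 times the weight 2 of scale 2t.\<close>
  have "D ^ 1 \<le> D ^ 5" "D ^ 3 \<le> D ^ 5" using D_ge_1 by (intro power_increasing; simp)+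
  then have D5: "2 * D + 2 * D \<le> 12 * D ^ 5" "2 * D + 4 * D ^ 3 \<le> 12 * D ^ 5" using D_ge_1 by auto
  have "\<bar>smooth t x - smooth t y\<bar> \<le> \<bar>smooth t x - f x\<bar> + \<bar>smooth t y - f y\<bar> + \<bar>f x - f y\<bar>" by linarith
  also have "\<dots> \<le> 2 * D * (r / t) * sx + 2 * D * (r / t) * sy + (2 * D * (r / t) * sx + 4 * D ^ 3 * (r / t) * sy)"
    using fx fy x2 y2 diff_le_rosc[OF r(2) r_def[symmetric]] by linarith
  also have "\<dots> = (2 * D + 2 * D) * (r / t * sx) + (2 * D + 4 * D ^ 3) * (r / t * sy)"
    by (simp add: algebra_simps)
  also have "\<dots> \<le> (12 * D ^ 5) * (r / t * sx) + (12 * D ^ 5) * (r / t * sy)"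
    using D5 r t sx sy by (intro add_mono mult_right_mono) auto
  also have "\<dots> = dist x y * (12 * D ^ 5 / t * sx + 12 * D ^ 5 / t * sy)"
    unfolding r_def by (simp add: field_simps)
  finally show ?thesis .
qed

lemma smooth_decomposition:
  assumes t: "0 < t"
  defines "S \<equiv> (\<Sum>j. ennreal ((1 / 2) ^ j) * E f (2 ^ j * t))"
  shows "space_norm M \<rho> (\<lambda>x. f x - smooth t x) \<le> ennreal (2 * D) * E f t"
    and "S < \<infinity> \<Longrightarrow> ennreal t * hom_sobolev_norm M \<rho> (smooth t) \<le> ennreal (12 * D ^ 5) * S"
proof -
  show 1: "space_norm M \<rho> (\<lambda>x. f x - smooth t x) \<le> ennreal (2 * D) * E f t"
  proof -
    have "ennreal \<bar>f x - smooth t x\<bar> \<le> ennreal (2 * D) * osc f t x" for x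
      using ennreal_leI[OF smooth_diff_le[OF t, of x]] t D_ge_1
      by (simp add: osc_eq_rosc ennreal_mult rosc_nonneg abs_minus_commute)
    then have "space_norm M \<rho> (\<lambda>x. f x - smooth t x) \<le> \<rho> (\<lambda>x. ennreal (2 * D) * osc f t x)"
      by (subst space_norm_eq) (measurable, intro mono, auto)
    also have "\<dots> = ennreal (2 * D) * E f t"
      unfolding oscillation_norm_def using D_ge_1 by (intro scale) auto
    finally show ?thesis .
  qed
  assume fin: "S < \<infinity>"
  have "\<rho> (osc_sum t) \<le> (\<Sum>j. \<rho> (\<lambda>x. ennreal ((1 / 2) ^ j) * osc f (2 ^ j * t) x))"
    unfolding osc_sum_def by (rule norm_suminf_le) measurable
  also have "\<dots> = S"
    unfolding S_def oscillation_norm_def by (intro suminf_cong scale) auto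
  finally have S: "\<rho> (osc_sum t) \<le> S" .
  then have ae: "AE x in M. osc_sum t x < \<infinity>"
    using fin by (intro finite_AE) (auto intro: le_less_trans)
  define g where "g x = 12 * D ^ 5 / t * enn2real (osc_sum t x)" for x
  have gm [measurable]: "g \<in> borel_measurable M" unfolding g_def by measurable
  have g0: "0 \<le> g x" for x using D_ge_1 t by (simp add: g_def)
  have grad: "g \<in> one_gradients M (smooth t)"
  proof -
    let ?N = "{x \<in> space M. \<not> osc_sum t x < \<infinity>}"
    have N: "?N \<in> null_sets M"
      by (rule AE_iff_null[THEN iffD1, OF _ ae]) measurable
    have "\<bar>smooth t x - smooth t y\<bar> \<le> dist x y * (g x + g y)" if "x \<notin> ?N" "y \<notin> ?N" for x y
      unfolding g_def using that
      by (intro smooth_diff_le_osc_sum[OF t]) (auto simp: less_top)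
    then show ?thesis unfolding one_gradients_def using N gm g0 by blast
  qed
  have "space_norm M \<rho> (\<lambda>x. f x - smooth t x) < \<infinity>"
  proof -
    have "(\<Sum>j\<in>{0}. ennreal ((1 / 2) ^ j) * E f (2 ^ j * t)) \<le> S"
      unfolding S_def by (rule sum_le_suminf) auto
    then have "E f t < \<infinity>" using fin by (auto intro: le_less_trans)
    then show ?thesis using 1 by (auto simp: ennreal_mult_less_top intro: le_less_trans)
  qed
  \<comment> \<open>\<open>hom_sobolev_norm\<close> is infinite off L^1 + L^\<infinity>. The
    smoothed function lies there because f does and the difference has finite norm.\<close>
  then have "(\<lambda>x. f x - (f x - smooth t x)) \<in> L1_plus_Linf M"
    by (intro L1_plus_Linf_diff f norm_finite_imp_L1_plus_Linf)
  then have "hom_sobolev_norm M \<rho> (smooth t) \<le> space_norm M \<rho> g"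
    unfolding hom_sobolev_norm_def using grad by (auto intro: INF_lower)
  also have "\<dots> \<le> \<rho> (\<lambda>x. ennreal (12 * D ^ 5 / t) * osc_sum t x)"
  proof -
    have "AE x in M. ennreal \<bar>g x\<bar> \<le> ennreal (12 * D ^ 5 / t) * osc_sum t x"
      using ae
    proof eventually_elim
      case (elim x)
      have "0 \<le> 12 * D ^ 5 / t" using D_ge_1 t by simp
      then have "ennreal \<bar>g x\<bar> = ennreal (12 * D ^ 5 / t) * ennreal (enn2real (osc_sum t x))"
        using g0[of x] unfolding g_def by (simp only: abs_of_nonneg ennreal_mult enn2real_nonneg)
      then show ?case using elim by simp
    qed
    then show ?thesis by (subst space_norm_eq[OF gm], intro mono_AE) measurable
  qed
  also have "\<dots> = ennreal (12 * D ^ 5 / t) * \<rho> (osc_sum t)"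
    using t D_ge_1 by (intro scale) auto
  also have "\<dots> \<le> ennreal (12 * D ^ 5 / t) * S" by (intro mult_left_mono S) simp
  finally have "ennreal t * hom_sobolev_norm M \<rho> (smooth t) \<le> ennreal t * (ennreal (12 * D ^ 5 / t) * S)"
    by (rule mult_left_mono) simp
  also have "\<dots> = ennreal (12 * D ^ 5) * S"
    using t D_ge_1 by (simp add: mult.assoc[symmetric] ennreal_mult[symmetric])
  finally show "ennreal t * hom_sobolev_norm M \<rho> (smooth t) \<le> ennreal (12 * D ^ 5) * S" .
qed

end

end

section \<open>Convexification\<close>

lemma epowr_ennreal: "0 \<le> r \<Longrightarrow> epowr (ennreal r) p = ennreal (r powr p)"
  by (simp add: epowr_def)

lemma epowr_top [simp]: "epowr top p = top"
  by (simp add: epowr_def)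

lemma epowr_0 [simp]: "epowr 0 p = 0"
  by (simp add: epowr_def)

lemma epowr_1 [simp]: "epowr 1 p = 1"
  by (simp add: epowr_def)

lemma epowr_epowr: "0 < p \<Longrightarrow> epowr (epowr x p) (1 / p) = x"
  by (cases x) (simp_all add: epowr_ennreal powr_powr)

lemma epowr_epowr': "0 < p \<Longrightarrow> epowr (epowr x (1 / p)) p = x"
  using epowr_epowr[of "1 / p" x] by simp

lemma epowr_mono: "0 < p \<Longrightarrow> x \<le> y \<Longrightarrow> epowr x p \<le> epowr y p"
  by (cases x; cases y) (auto simp: epowr_ennreal top_unique intro!: ennreal_leI powr_mono2)

lemma epowr_le_iff: "0 < p \<Longrightarrow> epowr x p \<le> epowr y p \<longleftrightarrow> x \<le> y"
  using epowr_mono[of p x y] epowr_mono[of "1 / p" "epowr x p" "epowr y p"] by (auto simp: epowr_epowr)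

lemma epowr_less_iff: "0 < p \<Longrightarrow> epowr x p < epowr y p \<longleftrightarrow> x < y"
  by (simp add: less_le_not_le epowr_le_iff)

lemma epowr_eq_0_iff: "0 < p \<Longrightarrow> epowr x p = 0 \<longleftrightarrow> x = 0"
  using epowr_le_iff[of p x 0] by simp

lemma epowr_less_top_iff: "epowr x p < top \<longleftrightarrow> x < top"
  by (cases x) (simp_all add: epowr_ennreal)

lemma epowr_mult: "0 \<le> a \<Longrightarrow> epowr (ennreal a * x) p = ennreal (a powr p) * epowr x p"
  by (cases x; cases "a = 0") (simp_all add: epowr_ennreal ennreal_mult[symmetric] powr_mult ennreal_mult_top)

text \<open>The power map is an order isomorphism of [0,\<infinity>] whose inverse has exponent 1/p,
  hence preserves suprema.\<close>

lemma epowr_SUP: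
  assumes "0 < p"
  shows "epowr (SUP i. u i) p = (SUP i. epowr (u i) p)"
proof (rule antisym)
  have "u i \<le> epowr (SUP i. epowr (u i) p) (1 / p)" for i
  proof -
    have "epowr (u i) p \<le> epowr (epowr (SUP i. epowr (u i) p) (1 / p)) p"
      unfolding epowr_epowr'[OF assms] by (rule SUP_upper) simp
    then show ?thesis by (simp add: epowr_le_iff assms)
  qed
  then have "(SUP i. u i) \<le> epowr (SUP i. epowr (u i) p) (1 / p)" by (rule SUP_least)
  then have "epowr (SUP i. u i) p \<le> epowr (epowr (SUP i. epowr (u i) p) (1 / p)) p"
    by (simp only: epowr_le_iff assms)
  then show "epowr (SUP i. u i) p \<le> (SUP i. epowr (u i) p)" by (simp add: epowr_epowr' assms)
  show "(SUP i. epowr (u i) p) \<le> epowr (SUP i. u i) p"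
    by (intro SUP_least epowr_mono[OF assms] SUP_upper) simp
qed

lemma measurable_epowr [measurable (raw)]:
  assumes [measurable]: "f \<in> borel_measurable M"
  shows "(\<lambda>x. epowr (f x) p) \<in> borel_measurable M"
  unfolding epowr_def by measurable

text \<open>As an order isomorphism the power map carries the admissible levels for f to those for
  its power, so it commutes with the rearrangement.\<close>

lemma decr_rearrangement_epowr_le:
  assumes p: "0 < p" and le: "decr_rearrangement M f s \<le> decr_rearrangement M g s"
  shows "decr_rearrangement M (\<lambda>x. epowr (f x) p) s \<le> decr_rearrangement M (\<lambda>x. epowr (g x) p) s"
proof -
  have eq: "decr_rearrangement M (\<lambda>x. epowr (h x) p) s = epowr (decr_rearrangement M h s) p" for h
  proof (rule antisym)
    have "epowr (decr_rearrangement M (\<lambda>x. epowr (h x) p) s) (1 / p) \<le> decr_rearrangement M h s"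
      unfolding decr_rearrangement_def[of M h]
    proof (rule Inf_greatest)
      fix t assume "t \<in> {t. emeasure M {x \<in> space M. t < h x} \<le> ennreal s}"
      then have "decr_rearrangement M (\<lambda>x. epowr (h x) p) s \<le> epowr t p"
        unfolding decr_rearrangement_def by (intro Inf_lower) (simp add: epowr_less_iff p)
      then have "epowr (decr_rearrangement M (\<lambda>x. epowr (h x) p) s) (1 / p) \<le> epowr (epowr t p) (1 / p)"
        using p by (simp only: epowr_le_iff zero_less_divide_1_iff)
      then show "epowr (decr_rearrangement M (\<lambda>x. epowr (h x) p) s) (1 / p) \<le> t"
        by (simp only: epowr_epowr p)
    qed
    then have "epowr (epowr (decr_rearrangement M (\<lambda>x. epowr (h x) p) s) (1 / p)) p \<le> epowr (decr_rearrangement M h s) p"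
      by (simp only: epowr_le_iff p)
    then show "decr_rearrangement M (\<lambda>x. epowr (h x) p) s \<le> epowr (decr_rearrangement M h s) p"
      by (simp only: epowr_epowr' p)
    show "epowr (decr_rearrangement M h s) p \<le> decr_rearrangement M (\<lambda>x. epowr (h x) p) s"
      unfolding decr_rearrangement_def[of M "\<lambda>x. epowr (h x) p"]
    proof (rule Inf_greatest)
      fix t assume t: "t \<in> {t. emeasure M {x \<in> space M. t < epowr (h x) p} \<le> ennreal s}"
      have "t < epowr y p \<longleftrightarrow> epowr t (1 / p) < y" for y
        using epowr_less_iff[OF p, of "epowr t (1 / p)" y] by (simp only: epowr_epowr' p)
      then have "decr_rearrangement M h s \<le> epowr t (1 / p)"
        using t unfolding decr_rearrangement_def by (intro Inf_lower) simp
      then have "epowr (decr_rearrangement M h s) p \<le> epowr (epowr t (1 / p)) p"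
        by (simp only: epowr_le_iff p)
      then show "epowr (decr_rearrangement M h s) p \<le> t" by (simp only: epowr_epowr' p)
    qed
  qed
  show ?thesis using le by (simp only: eq epowr_le_iff p)
qed

text \<open>Jensen for (x + y)/(a + b) as the mean of x/a and y/b with weights a/(a+b) and b/(a+b).
  With a and b bounds for two norms, this is Minkowski's inequality in pointwise form.\<close>

lemma powr_add_le:
  assumes xy: "0 \<le> x" "0 \<le> (y::real)" and ab: "0 < a" "0 < b" and p: "1 \<le> p"
  shows "(x + y) powr p \<le> (a + b) powr p * (a / (a + b) * (1 / a powr p) * x powr p + b / (a + b) * (1 / b powr p) * y powr p)"
proof -
  have one: "z powr p \<le> (c + d) powr p * (c / (c + d) * (1 / c powr p) * z powr p)" if "0 < c" "0 < d" for c d z :: real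
  proof -
    have "((c + d) / c) powr 1 \<le> ((c + d) / c) powr p" using that p by (intro powr_mono) auto
    then have "(c + d) / c \<le> (c + d) powr p / c powr p" using that by (simp add: powr_divide)
    then have "c / (c + d) * ((c + d) / c) \<le> c / (c + d) * ((c + d) powr p / c powr p)"
      using that by (intro mult_left_mono) auto
    moreover have "c / (c + d) * ((c + d) / c) = 1" using that by simp
    moreover have "c / (c + d) * ((c + d) powr p / c powr p) = (c + d) powr p * (c / (c + d) * (1 / c powr p))"
      by simp
    ultimately have "1 \<le> (c + d) powr p * (c / (c + d) * (1 / c powr p))" by linarith
    from mult_right_mono[OF this, of "z powr p"] show ?thesis by (simp add: mult_ac)
  qed
  \<comment> \<open>Convexity is applied at positive arguments; if one summand vanishes,
    \<open>one\<close> suffices, which rests on ((c + d)/c)^p \<ge> (c + d)/c.\<close>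
  consider "x = 0" | "y = 0" | "0 < x" "0 < y" using xy by linarith
  then show ?thesis
  proof cases
    case 1
    then show ?thesis using one[OF ab(2,1), of y] by (simp add: add.commute)
  next
    case 2
    then show ?thesis using one[OF ab, of x] by simp
  next
    case 3
    let ?t = "b / (a + b)"
    have t: "0 \<le> ?t" "?t \<le> 1" "1 - ?t = a / (a + b)" using ab by (auto simp: field_simps)
    have "((1 - ?t) *\<^sub>R (x / a) + ?t *\<^sub>R (y / b)) powr p \<le> (1 - ?t) * (x / a) powr p + ?t * (y / b) powr p"
      using 3 ab by (intro convex_onD[OF powr_convex[OF p]] t) auto
    also have "(1 - ?t) *\<^sub>R (x / a) + ?t *\<^sub>R (y / b) = (x + y) / (a + b)"
      unfolding t(3) using ab by (simp add: add_divide_distrib)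
    finally have "(a + b) powr p * ((x + y) / (a + b)) powr p \<le>
        (a + b) powr p * ((1 - ?t) * (x / a) powr p + ?t * (y / b) powr p)"
      by (rule mult_left_mono) simp
    moreover have "(a + b) powr p * ((x + y) / (a + b)) powr p = (x + y) powr p"
      using 3 ab by (simp add: powr_divide)
    ultimately show ?thesis unfolding t(3) using 3 ab by (simp add: powr_divide)
  qed
qed

lemma ennreal_linear:
  "0 \<le> A \<Longrightarrow> 0 \<le> B \<Longrightarrow> 0 \<le> x \<Longrightarrow> 0 \<le> y \<Longrightarrow>
   ennreal (A * x + B * y) = ennreal A * ennreal x + ennreal B * ennreal y"
  by (simp add: ennreal_mult)

lemma epowr_add_le:
  assumes ab: "0 < a" "0 < b" and p: "1 \<le> p"
  shows "epowr (x + y) p \<le> ennreal ((a + b) powr p * (a / (a + b) * (1 / a powr p))) * epowr x p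
    + ennreal ((a + b) powr p * (b / (a + b) * (1 / b powr p))) * epowr y p"
proof (cases "x = top \<or> y = top")
  case True
  then show ?thesis using ab by (auto simp: ennreal_mult_top)
next
  case False
  then obtain r s where rs: "x = ennreal r" "0 \<le> r" "y = ennreal s" "0 \<le> s" by (cases x; cases y) auto
  have "epowr (x + y) p = ennreal ((r + s) powr p)"
    using rs by (simp add: epowr_ennreal ennreal_plus[symmetric] del: ennreal_plus)
  also have "\<dots> \<le> ennreal ((a + b) powr p * (a / (a + b) * (1 / a powr p)) * r powr p +
      (a + b) powr p * (b / (a + b) * (1 / b powr p)) * s powr p)"
    using powr_add_le[OF rs(2,4) ab p] by (intro ennreal_leI) (simp add: algebra_simps)
  also have "\<dots> = ennreal ((a + b) powr p * (a / (a + b) * (1 / a powr p))) * epowr x p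
    + ennreal ((a + b) powr p * (b / (a + b) * (1 / b powr p))) * epowr y p"
    unfolding rs(1,3) epowr_ennreal[OF rs(2)] epowr_ennreal[OF rs(4)]
    using ab by (intro ennreal_linear) auto
  finally show ?thesis .
qed

text \<open>Testing with positive finite bounds avoids dividing by a norm that is 0 or
  \<infinity>.\<close>

lemma ennreal_le_by_upper_bounds:
  assumes C: "0 < C" and le: "\<And>a. 0 < a \<Longrightarrow> y \<le> ennreal a \<Longrightarrow> z \<le> ennreal (C * a)"
  shows "z \<le> ennreal C * y"
proof (cases y)
  case (real r)
  show ?thesis
  proof (rule ennreal_le_epsilon)
    fix e :: real assume e: "0 < e"
    have "z \<le> ennreal (C * (r + e / C))"
      using real C e by (intro le) (auto simp: add_nonneg_pos)
    also have "C * (r + e / C) = C * r + e" using C by (simp add: field_simps)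
    also have "ennreal (C * r + e) = ennreal C * y + ennreal e"
      using real C e by (simp add: ennreal_mult)
    finally show "z \<le> ennreal C * y + ennreal e" .
  qed
qed (use C in \<open>simp add: ennreal_mult_top\<close>)

text \<open>The triangle inequality and local integrability are read off from the unit balls.\<close>

lemma convexification_le_iff:
  "0 < p \<Longrightarrow> 0 \<le> a \<Longrightarrow> convexification p \<rho> f \<le> ennreal a \<longleftrightarrow> \<rho> (\<lambda>x. epowr (f x) p) \<le> ennreal (a powr p)"
  using epowr_le_iff[of p "convexification p \<rho> f" "ennreal a"]
  by (simp add: convexification_def epowr_epowr' epowr_ennreal)

text \<open>Positivity, monotonicity, the Fatou property and rearrangement invariance transfer
  because the power map is an order isomorphism; p \<ge> 1 is needed for convexity and for the local
  bound.\<close>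

lemma ri_space_convexification:
  assumes ri: "ri_space M \<rho>" and p: "1 \<le> p"
  shows "ri_space M (convexification p \<rho>)"
proof -
  have p0: "0 < p" and p1: "0 < 1 / p" using p by auto
  have bfn: "banach_function_norm M \<rho>" using ri by (simp add: ri_space_def)
  interpret function_norm M \<rho> by (rule banach_function_norm_imp_function_norm[OF bfn])
  let ?c = "convexification p \<rho>"
  have zero': "?c f = 0 \<longleftrightarrow> (AE x in M. f x = 0)" if [measurable]: "f \<in> borel_measurable M" for f
    using zero_iff[of "\<lambda>x. epowr (f x) p"] that
    by (simp add: convexification_def epowr_eq_0_iff p0 p1)
  have scale': "?c (\<lambda>x. ennreal a * f x) = ennreal a * ?c f"
    if [measurable]: "f \<in> borel_measurable M" and a: "0 \<le> a" for f a
  proof -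
    have "?c (\<lambda>x. ennreal a * f x) = epowr (ennreal (a powr p) * \<rho> (\<lambda>x. epowr (f x) p)) (1 / p)"
      unfolding convexification_def using a by (simp add: epowr_mult scale)
    also have "\<dots> = ennreal a * ?c f"
      using a p0 by (subst epowr_mult) (auto simp: convexification_def powr_powr)
    finally show ?thesis .
  qed
  have mono': "?c f \<le> ?c g"
    if [measurable]: "f \<in> borel_measurable M" "g \<in> borel_measurable M" and "AE x in M. f x \<le> g x" for f g
    unfolding convexification_def epowr_le_iff[OF p1] using that(3)
    by (intro mono_AE) (auto simp: epowr_le_iff p0)
  have triangle': "?c (\<lambda>x. f x + g x) \<le> ?c f + ?c g"
    if [measurable]: "f \<in> borel_measurable M" "g \<in> borel_measurable M" for f g
  proof -
    have ab: "?c (\<lambda>x. f x + g x) \<le> ennreal (a + b)"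
      if ab: "0 < a" "0 < b" "?c f \<le> ennreal a" "?c g \<le> ennreal b" for a b
    proof -
      \<comment> \<open>Chosen so that the bounds a^p and b^p for the two terms recombine to exactly
        (a + b)^p.\<close>
      let ?A = "(a + b) powr p * (a / (a + b) * (1 / a powr p))"
      let ?B = "(a + b) powr p * (b / (a + b) * (1 / b powr p))"
      have "\<rho> (\<lambda>x. epowr (f x + g x) p) \<le> \<rho> (\<lambda>x. ennreal ?A * epowr (f x) p + ennreal ?B * epowr (g x) p)"
        by (intro mono epowr_add_le ab p) measurable
      also have "\<dots> \<le> \<rho> (\<lambda>x. ennreal ?A * epowr (f x) p) + \<rho> (\<lambda>x. ennreal ?B * epowr (g x) p)"
        by (rule triangle) measurable
      also have "\<dots> = ennreal ?A * \<rho> (\<lambda>x. epowr (f x) p) + ennreal ?B * \<rho> (\<lambda>x. epowr (g x) p)"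
        using ab by (subst (1 2) scale) auto
      also have "\<dots> \<le> ennreal ?A * ennreal (a powr p) + ennreal ?B * ennreal (b powr p)"
        using ab p0 by (intro add_mono mult_left_mono) (auto simp: convexification_le_iff)
      also have "\<dots> = ennreal (?A * a powr p + ?B * b powr p)"
        using ab by (intro ennreal_linear[symmetric]) auto
      also have "?A * a powr p + ?B * b powr p = (a + b) powr p"
      proof -
        have A1: "?A * a powr p = (a + b) powr p * (a / (a + b))"
          and B1: "?B * b powr p = (a + b) powr p * (b / (a + b))" using ab by simp_all
        have "a / (a + b) + b / (a + b) = 1" using ab by (simp add: add_divide_distrib[symmetric])
        then show ?thesis unfolding A1 B1 distrib_left[symmetric] by simp
      qed
      finally show ?thesis using ab p0 by (subst convexification_le_iff) auto
    qed
    show ?thesis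
    proof (cases "?c f < top \<and> ?c g < top")
      case True
      then obtain r s where rs: "?c f = ennreal r" "0 \<le> r" "?c g = ennreal s" "0 \<le> s"
        by (cases "?c f"; cases "?c g") auto
      show ?thesis
      proof (rule ennreal_le_epsilon)
        fix e :: real assume e: "0 < e"
        have "?c (\<lambda>x. f x + g x) \<le> ennreal ((r + e / 2) + (s + e / 2))"
          using rs e by (intro ab) (auto intro: ennreal_leI)
        also have "\<dots> = ?c f + ?c g + ennreal e"
          using rs e by (simp add: ennreal_plus[symmetric] del: ennreal_plus)
        finally show "?c (\<lambda>x. f x + g x) \<le> ?c f + ?c g + ennreal e" .
      qed
    next
      case False
      then have "?c f = top \<or> ?c g = top" by (auto simp: not_less top_unique)
      then have "?c f + ?c g = top" by (metis ennreal_add_eq_top)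
      then show ?thesis by (metis top_greatest)
    qed
  qed
  have fatou': "?c f = (SUP i. ?c (u i))"
    if [measurable]: "f \<in> borel_measurable M" "\<And>i::nat. u i \<in> borel_measurable M"
      and u: "AE x in M. incseq (\<lambda>i. u i x) \<and> f x = (SUP i. u i x)" for f u
  proof -
    have "AE x in M. incseq (\<lambda>i. epowr (u i x) p) \<and> epowr (f x) p = (SUP i. epowr (u i x) p)"
      using u by eventually_elim (auto simp: incseq_def epowr_le_iff epowr_SUP p0)
    then have "\<rho> (\<lambda>x. epowr (f x) p) = (SUP i. \<rho> (\<lambda>x. epowr (u i x) p))"
      by (intro banach_function_normD(5)[OF bfn]) measurable
    then show ?thesis by (simp add: convexification_def epowr_SUP[OF p1])
  qed
  have ind': "?c (indicator A) < \<infinity>" if "A \<in> sets M" "emeasure M A < \<infinity>" for A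
  proof -
    have "(\<lambda>x. epowr (indicator A x) p) = (indicator A :: 'a \<Rightarrow> ennreal)" by (auto simp: indicator_def)
    then show ?thesis
      using banach_function_normD(6)[OF bfn that] by (simp add: convexification_def epowr_less_top_iff)
  qed
  have local': "\<exists>C>0::real. \<forall>f\<in>borel_measurable M. (\<integral>\<^sup>+x\<in>A. f x \<partial>M) \<le> ennreal C * ?c f"
    if A [measurable]: "A \<in> sets M" and fin: "emeasure M A < \<infinity>" for A
  proof -
    obtain C :: real where C: "C > 0" "\<And>f. f \<in> borel_measurable M \<Longrightarrow> (\<integral>\<^sup>+x\<in>A. f x \<partial>M) \<le> ennreal C * \<rho> f"
      using banach_function_normD(7)[OF bfn A fin] by blast
    have "(\<integral>\<^sup>+x\<in>A. f x \<partial>M) \<le> ennreal (measure M A + C) * ?c f" if [measurable]: "f \<in> borel_measurable M" for f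
    proof (rule ennreal_le_by_upper_bounds)
      show "0 < measure M A + C" using C(1) by (simp add: add_nonneg_pos)
      fix a :: real assume a: "0 < a" "?c f \<le> ennreal a"
      \<comment> \<open>Where f exceeds a, the ratio f/a is at most its p-th power; elsewhere f
        \<le> a. The first term integrates to a times the measure of A, the second is controlled by
        the norm of the power.\<close>
      have pt: "f x \<le> ennreal a + ennreal (a / a powr p) * epowr (f x) p" for x
      proof (cases "f x")
        case (real r)
        have "r \<le> a + a / a powr p * r powr p"
        proof (cases "r \<le> a")
          case True
          then show ?thesis using a by (simp add: add_increasing2)
        next
          case False
          then have "1 \<le> r / a" using a by simp
          then have "(r / a) powr 1 \<le> (r / a) powr p" using p by (intro powr_mono) auto
          then have "r / a \<le> r powr p / a powr p" using False a by (simp add: powr_divide)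
          then have "a * (r / a) \<le> a * (r powr p / a powr p)" using a by (intro mult_left_mono) auto
          then show ?thesis using a by simp
        qed
        then show ?thesis
          using real a by (simp add: epowr_ennreal ennreal_mult[symmetric] ennreal_plus[symmetric] ennreal_leI
              del: ennreal_plus)
      next
        case top
        then show ?thesis using a by (simp add: ennreal_mult_top)
      qed
      have "(\<integral>\<^sup>+x\<in>A. f x \<partial>M) \<le> (\<integral>\<^sup>+x. ennreal a * indicator A x + ennreal (a / a powr p) * (epowr (f x) p * indicator A x) \<partial>M)"
        using pt by (intro nn_integral_mono) (auto simp: indicator_def)
      also have "\<dots> = ennreal a * emeasure M A + ennreal (a / a powr p) * (\<integral>\<^sup>+x\<in>A. epowr (f x) p \<partial>M)"
        by (simp add: nn_integral_add nn_integral_cmult nn_integral_cmult_indicator)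
      also have "\<dots> \<le> ennreal a * emeasure M A + ennreal (a / a powr p) * (ennreal C * ennreal (a powr p))"
      proof (intro add_left_mono mult_left_mono)
        have "(\<integral>\<^sup>+x\<in>A. epowr (f x) p \<partial>M) \<le> ennreal C * \<rho> (\<lambda>x. epowr (f x) p)" by (rule C(2)) measurable
        also have "\<dots> \<le> ennreal C * ennreal (a powr p)"
          using a p0 by (intro mult_left_mono) (auto simp: convexification_le_iff)
        finally show "(\<integral>\<^sup>+x\<in>A. epowr (f x) p \<partial>M) \<le> ennreal C * ennreal (a powr p)" .
      qed auto
      also have "\<dots> = ennreal ((measure M A + C) * a)"
      proof -
        have "emeasure M A = ennreal (measure M A)" using fin by (intro emeasure_eq_ennreal_measure) auto
        then show ?thesis
          using a C(1) by (simp add: ennreal_mult[symmetric] ennreal_plus[symmetric] algebra_simps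
              del: ennreal_plus)
      qed
      finally show "(\<integral>\<^sup>+x\<in>A. f x \<partial>M) \<le> ennreal ((measure M A + C) * a)" .
    qed
    moreover have "0 < measure M A + C" using C(1) by (simp add: add_nonneg_pos)
    ultimately show ?thesis by blast
  qed
  have ri': "?c f \<le> ?c g"
    if [measurable]: "f \<in> borel_measurable M" "g \<in> borel_measurable M" and fin: "?c g < \<infinity>"
      and le: "AE s in half_line. decr_rearrangement M f s \<le> decr_rearrangement M g s" for f g
  proof -
    have "AE s in half_line. decr_rearrangement M (\<lambda>x. epowr (f x) p) s \<le> decr_rearrangement M (\<lambda>x. epowr (g x) p) s"
      using le by eventually_elim (rule decr_rearrangement_epowr_le[OF p0])
    moreover have "\<rho> (\<lambda>x. epowr (g x) p) < \<infinity>"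
      using fin by (simp add: convexification_def epowr_less_top_iff)
    moreover have "(\<lambda>x. epowr (f x) p) \<in> borel_measurable M" "(\<lambda>x. epowr (g x) p) \<in> borel_measurable M"
      by measurable
    ultimately have "\<rho> (\<lambda>x. epowr (f x) p) \<le> \<rho> (\<lambda>x. epowr (g x) p)"
      using conjunct2[OF ri[unfolded ri_space_def]] by blast
    then show ?thesis by (simp only: convexification_def epowr_le_iff p1)
  qed
  have "banach_function_norm M ?c"
    unfolding banach_function_norm_def
  proof (intro conjI ballI allI impI)
    fix f :: "'a \<Rightarrow> ennreal" assume f: "f \<in> borel_measurable M"
    show "?c f = 0 \<longleftrightarrow> (AE x in M. f x = 0)" by (rule zero'[OF f])
    show "?c (\<lambda>x. ennreal a * f x) = ennreal a * ?c f" if "0 \<le> a" for a by (rule scale'[OF f that])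
    fix g :: "'a \<Rightarrow> ennreal" assume g: "g \<in> borel_measurable M"
    show "?c (\<lambda>x. f x + g x) \<le> ?c f + ?c g" by (rule triangle'[OF f g])
    show "?c f \<le> ?c g" if "AE x in M. f x \<le> g x" by (rule mono'[OF f g that])
  next
    fix f :: "'a \<Rightarrow> ennreal" and u :: "nat \<Rightarrow> 'a \<Rightarrow> ennreal"
    assume "f \<in> borel_measurable M" "\<forall>i. u i \<in> borel_measurable M"
      "AE x in M. incseq (\<lambda>i. u i x) \<and> f x = (SUP i. u i x)"
    then show "?c f = (SUP i. ?c (u i))" using fatou'[of f u] by simp
  next
    fix A assume A: "A \<in> sets M" "emeasure M A < \<infinity>"
    show "?c (indicator A) < \<infinity>" by (rule ind'[OF A])
    show "\<exists>C>0::real. \<forall>f\<in>borel_measurable M. (\<integral>\<^sup>+x\<in>A. f x \<partial>M) \<le> ennreal C * ?c f" by (rule local'[OF A])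
  qed
  then show ?thesis
    unfolding ri_space_def
  proof (intro conjI ballI impI)
    fix f g :: "'a \<Rightarrow> ennreal" assume "f \<in> borel_measurable M" "g \<in> borel_measurable M" "?c g < \<infinity>"
      "AE s in half_line. decr_rearrangement M f s \<le> decr_rearrangement M g s"
    then show "?c f \<le> ?c g" by (rule ri')
  qed
qed

section \<open>Two-sided estimates of the K-functional\<close>

lemma K_functional_mono: "s \<le> t \<Longrightarrow> K_functional N0 N1 f s \<le> K_functional N0 N1 f t"
  unfolding K_functional_def by (intro INF_mono' add_left_mono mult_right_mono ennreal_leI) auto

lemma K_functional_le: "K_functional N0 N1 f t \<le> N0 f0 + ennreal t * N1 (\<lambda>x. f x - f0 x)"
  unfolding K_functional_def by (rule INF_lower) simp

text \<open>Multiplying the cost of a decomposition at 1 by min(1,t) brings both terms below their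
  cost at t. This bounds the weighted norm of K from below by K(f,1).\<close>

lemma K_functional_min_1:
  assumes "0 < t"
  shows "ennreal (min 1 t) * K_functional N0 N1 f 1 \<le> K_functional N0 N1 f t"
proof -
  have "ennreal (min 1 t) * K_functional N0 N1 f 1 \<le> N0 f0 + ennreal t * N1 (\<lambda>x. f x - f0 x)" for f0
  proof -
    have "ennreal (min 1 t) * K_functional N0 N1 f 1 \<le> ennreal (min 1 t) * (N0 f0 + ennreal 1 * N1 (\<lambda>x. f x - f0 x))"
      by (intro mult_left_mono K_functional_le) simp
    also have "\<dots> = ennreal (min 1 t) * N0 f0 + ennreal (min 1 t) * N1 (\<lambda>x. f x - f0 x)"
      by (simp add: distrib_left)
    also have "\<dots> \<le> 1 * N0 f0 + ennreal t * N1 (\<lambda>x. f x - f0 x)"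
      using assms by (intro add_mono mult_right_mono) (auto intro: ennreal_leI)
    finally show ?thesis by simp
  qed
  then show ?thesis unfolding K_functional_def[of N0 N1 f t] by (intro INF_greatest) auto
qed

lemma K_functional_finite:
  assumes "f \<in> sum_space N0 N1"
  shows "K_functional N0 N1 f t < \<infinity>"
proof -
  obtain f0 f1 where *: "N0 f0 < \<infinity>" "N1 f1 < \<infinity>" "f = (\<lambda>x. f0 x + f1 x)"
    using assms by (auto simp: sum_space_def fspace_def)
  have "K_functional N0 N1 f t \<le> N0 f0 + ennreal t * N1 (\<lambda>x. f x - f0 x)" by (rule K_functional_le)
  also have "\<dots> < \<infinity>" using * by (simp add: ennreal_mult_less_top)
  finally show ?thesis .
qed

lemma measurable_K_functional:
  assumes "f \<in> sum_space N0 N1"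
  shows "K_functional N0 N1 f \<in> borel_measurable half_line"
proof -
  have "mono (\<lambda>t. enn2real (K_functional N0 N1 f t))"
    using K_functional_finite[OF assms] by (auto simp: mono_def intro!: enn2real_mono K_functional_mono)
  then have "(\<lambda>t. enn2real (K_functional N0 N1 f t)) \<in> borel_measurable half_line"
    by (intro borel_half_lineI borel_measurable_mono)
  then have "(\<lambda>t. ennreal (enn2real (K_functional N0 N1 f t))) \<in> borel_measurable half_line" by measurable
  moreover have "(\<lambda>t. ennreal (enn2real (K_functional N0 N1 f t))) = K_functional N0 N1 f"
    using K_functional_finite[OF assms] by auto
  ultimately show ?thesis by simp
qed

lemma same_space_equiv_normsI:
  assumes "0 < c" "0 < C" and 1: "\<And>f. N f \<le> ennreal C * N' f" and 2: "\<And>f. N' f \<le> ennreal c * N f"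
  shows "same_space_equiv_norms N N'"
proof -
  have "N f < \<infinity> \<longleftrightarrow> N' f < \<infinity>" for f
    using 1[of f] 2[of f] by (auto simp: ennreal_mult_less_top intro: le_less_trans)
  moreover have "ennreal (1 / c) * N' f \<le> N f" for f
  proof -
    have "ennreal (1 / c) * N' f \<le> ennreal (1 / c) * (ennreal c * N f)" by (intro mult_left_mono 2) simp
    also have "\<dots> = N f" using \<open>0 < c\<close> by (simp add: mult.assoc[symmetric] ennreal_mult[symmetric])
    finally show ?thesis .
  qed
  ultimately show ?thesis
    unfolding same_space_equiv_norms_def fspace_def using assms(1,2) 1
    by (intro conjI exI[of _ "1 / c"] exI[of _ C]) auto
qed

lemma emeasure_half_line_interval: "0 < r \<Longrightarrow> emeasure half_line {r<..<2 * r} = ennreal r"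
  unfolding half_line_def by (subst emeasure_restrict_space) auto

lemma sets_half_line_interval: "0 \<le> a \<Longrightarrow> {a<..<b} \<in> sets half_line"
  unfolding half_line_def by (subst sets_restrict_space_iff) auto

lemma hardy_kernel_1: "0 < t \<Longrightarrow> t < s \<Longrightarrow> hardy_kernel 1 t s = t / s\<^sup>2"
  by (simp add: hardy_kernel_def power2_eq_square)

section \<open>The K-functional is bounded by the Hardy operator of the oscillation\<close>

context doubling_ri_space
begin

text \<open>With r = 2^j t, term j is t/r^2 times E(f,r) times the length of (r,2r). On that
  interval t/r^2 \<le> 4 t/s^2 and E(f,r) \<le> D E(f,s), whence 4 D; the intervals are
  disjoint.\<close>

lemma osc_series_le_hardy:
  assumes t: "0 < t" and f [measurable]: "f \<in> borel_measurable M"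
  shows "(\<Sum>j. ennreal ((1 / 2) ^ j) * E f (2 ^ j * t)) \<le> ennreal (4 * D) * hardy 1 (E f) t"
proof -
  note [measurable] = measurable_E[OF f]
  let ?A = "\<lambda>j::nat. {2 ^ j * t<..<2 * (2 ^ j * t)}"
  let ?h = "\<lambda>s. ennreal (4 * D) * (ennreal (hardy_kernel 1 t s) * E f s)"
  have A [measurable]: "?A j \<in> sets half_line" for j using t by (intro sets_half_line_interval) simp
  have disj: "disjoint_family ?A"
  proof -
    have "?A j \<inter> ?A k = {}" if "j < k" for j k
    proof -
      have "(2::real) ^ Suc j \<le> 2 ^ k" using that by (intro power_increasing) auto
      then have "2 * (2 ^ j * t) \<le> 2 ^ k * t" using t by simp
      then show ?thesis by auto
    qed
    then show ?thesis unfolding disjoint_family_on_def by (metis Int_commute linorder_neqE_nat)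
  qed
  have term_le: "ennreal ((1 / 2) ^ j) * E f (2 ^ j * t) \<le> (\<integral>\<^sup>+s. ?h s * indicator (?A j) s \<partial>half_line)" for j
  proof -
    define r where "r = 2 ^ j * t"
    have r: "0 < r" using t by (simp add: r_def)
    have "ennreal ((1 / 2) ^ j) * E f r = ennreal (t / r\<^sup>2) * E f r * emeasure half_line {r<..<2 * r}"
    proof -
      have eq: "(1 / 2) ^ j = t / r\<^sup>2 * r" using t by (simp add: r_def power2_eq_square power_divide)
      have "ennreal (t / r\<^sup>2 * r) = ennreal (t / r\<^sup>2) * ennreal r" using r t by (intro ennreal_mult) auto
      then show ?thesis unfolding eq emeasure_half_line_interval[OF r] by (simp only: mult_ac)
    qed
    also have "\<dots> = (\<integral>\<^sup>+s. ennreal (t / r\<^sup>2) * E f r * indicator {r<..<2 * r} s \<partial>half_line)"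
      using r by (intro nn_integral_cmult_indicator[symmetric] sets_half_line_interval) simp
    also have "\<dots> \<le> (\<integral>\<^sup>+s. ?h s * indicator {r<..<2 * r} s \<partial>half_line)"
    proof (rule nn_integral_mono)
      fix s
      show "ennreal (t / r\<^sup>2) * E f r * indicator {r<..<2 * r} s \<le> ?h s * indicator {r<..<2 * r} s"
      proof (cases "s \<in> {r<..<2 * r}")
        case True
        have "t \<le> r" using t by (simp add: r_def)
        then have ts: "t < s" using True by simp
        have "s\<^sup>2 \<le> (2 * r)\<^sup>2" using True r by (intro power_mono) auto
        then have "t * s\<^sup>2 \<le> t * (4 * r\<^sup>2)" using t by (simp add: power_mult_distrib)
        then have "t / r\<^sup>2 \<le> 4 * (t / s\<^sup>2)" using r True by (simp add: field_simps)
        then have "ennreal (t / r\<^sup>2) * E f r \<le> ennreal (4 * (t / s\<^sup>2)) * (ennreal D * E f s)"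
          using True r by (intro mult_mono ennreal_leI E_le_double f) auto
        also have "\<dots> = ?h s"
        proof -
          have "ennreal (4 * (t / s\<^sup>2)) = ennreal 4 * ennreal (t / s\<^sup>2)" using t by (intro ennreal_mult) auto
          moreover have "ennreal (4 * D) = ennreal 4 * ennreal D" using D_ge_1 by (intro ennreal_mult) auto
          ultimately show ?thesis unfolding hardy_kernel_1[OF t ts] by (simp only: mult_ac)
        qed
        finally show ?thesis using True by simp
      qed simp
    qed
    finally show ?thesis by (simp add: r_def)
  qed
  have "(\<Sum>j. ennreal ((1 / 2) ^ j) * E f (2 ^ j * t)) \<le> (\<Sum>j. \<integral>\<^sup>+s. ?h s * indicator (?A j) s \<partial>half_line)"
    by (intro suminf_le term_le) auto
  also have "\<dots> = (\<integral>\<^sup>+s. (\<Sum>j. ?h s * indicator (?A j) s) \<partial>half_line)"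
    by (rule nn_integral_suminf[symmetric]) measurable
  also have "\<dots> \<le> (\<integral>\<^sup>+s. ?h s \<partial>half_line)"
  proof (rule nn_integral_mono)
    fix s
    have "(\<Sum>j. indicator (?A j) s :: ennreal) = indicator (\<Union>j. ?A j) s"
      by (rule suminf_indicator[OF disj])
    then have "(\<Sum>j. ?h s * indicator (?A j) s) = ?h s * indicator (\<Union>j. ?A j) s"
      by (simp only: ennreal_suminf_cmult)
    then show "(\<Sum>j. ?h s * indicator (?A j) s) \<le> ?h s" by (simp add: indicator_def)
  qed
  also have "\<dots> = ennreal (4 * D) * hardy 1 (E f) t"
    unfolding hardy_def by (rule nn_integral_cmult) measurable
  finally show ?thesis .
qed

abbreviation Y :: "('a \<Rightarrow> real) \<Rightarrow> ennreal" where "Y \<equiv> space_norm M \<rho>"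
abbreviation HS :: "('a \<Rightarrow> real) \<Rightarrow> ennreal" where "HS \<equiv> hom_sobolev_norm M \<rho>"
abbreviation SN :: "('a \<Rightarrow> real) \<Rightarrow> ennreal" where "SN \<equiv> sobolev_norm M \<rho>"

lemma hom_sobolev_zero: "HS (\<lambda>x. 0) = 0"
proof -
  have "(\<lambda>x. 0) \<in> one_gradients M (\<lambda>x. 0)" by (auto simp: one_gradients_def intro!: bexI[of _ "{}"])
  then have "(INF g\<in>one_gradients M (\<lambda>x. 0). Y g) \<le> Y (\<lambda>x. 0)" by (rule INF_lower)
  then show ?thesis by (simp add: hom_sobolev_norm_def L1_plus_Linf_zero)
qed

text \<open>The constants 2 D and 12 D^5 of the two parts of the decomposition, times the 4 D of the
  passage from series to integral.\<close>

definition C1 :: real where "C1 = 4 * D * (2 * D + 12 * D ^ 5)"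

lemma C1_pos: "0 < C1"
proof -
  have "0 < D" using D_ge_1 by simp
  then show ?thesis unfolding C1_def by (intro mult_pos_pos add_pos_pos) auto
qed

text \<open>The separate bound for \<open>Y f0\<close> serves the inhomogeneous couple, where
  \<open>Y\<close> of the smoothed part must be estimated too.\<close>

lemma exists_smoothing:
  assumes t: "0 < t" and f: "f \<in> L1_plus_Linf M" and H: "hardy 1 (E f) t < \<infinity>"
  obtains f0 where "Y f0 + ennreal t * HS (\<lambda>x. f x - f0 x) \<le> ennreal C1 * hardy 1 (E f) t"
    and "Y f0 \<le> ennreal C1 * hardy 1 (E f) t"
proof -
  let ?S = "\<Sum>j. ennreal ((1 / 2) ^ j) * E f (2 ^ j * t)"
  have S: "?S \<le> ennreal (4 * D) * hardy 1 (E f) t"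
    by (rule osc_series_le_hardy[OF t L1_plus_Linf_measurable[OF f]])
  then have fin: "?S < \<infinity>" using H by (auto simp: ennreal_mult_less_top intro: le_less_trans)
  have "(\<Sum>j\<in>{0}. ennreal ((1 / 2) ^ j) * E f (2 ^ j * t)) \<le> ?S" by (rule sum_le_suminf) auto
  then have E: "E f t \<le> ?S" by simp
  define f0 where "f0 x = f x - smooth f t x" for x
  have "Y f0 \<le> ennreal (2 * D) * E f t"
    unfolding f0_def by (rule smooth_decomposition(1)[OF f t])
  also have "\<dots> \<le> ennreal (2 * D) * ?S" by (intro mult_left_mono E) simp
  finally have Y: "Y f0 \<le> ennreal (2 * D) * ?S" .
  have "(\<lambda>x. f x - f0 x) = smooth f t" by (auto simp: f0_def)
  then have "ennreal t * HS (\<lambda>x. f x - f0 x) \<le> ennreal (12 * D ^ 5) * ?S"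
    using smooth_decomposition(2)[OF f t fin] by simp
  with Y have "Y f0 + ennreal t * HS (\<lambda>x. f x - f0 x) \<le> ennreal (2 * D) * ?S + ennreal (12 * D ^ 5) * ?S"
    by (rule add_mono)
  also have "\<dots> = ennreal (2 * D + 12 * D ^ 5) * ?S"
    using D_ge_1 by (simp add: distrib_right)
  also have "\<dots> \<le> ennreal (2 * D + 12 * D ^ 5) * (ennreal (4 * D) * hardy 1 (E f) t)"
    by (intro mult_left_mono S) simp
  also have "\<dots> = ennreal C1 * hardy 1 (E f) t"
  proof -
    have "ennreal C1 = ennreal (4 * D) * ennreal (2 * D + 12 * D ^ 5)"
      unfolding C1_def using D_ge_1 by (intro ennreal_mult) auto
    then show ?thesis by (simp only: mult_ac)
  qed
  finally have *: "Y f0 + ennreal t * HS (\<lambda>x. f x - f0 x) \<le> ennreal C1 * hardy 1 (E f) t" .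
  have "Y f0 \<le> Y f0 + ennreal t * HS (\<lambda>x. f x - f0 x)" by simp
  from this * have "Y f0 \<le> ennreal C1 * hardy 1 (E f) t" by (rule order_trans)
  with * show thesis by (rule that)
qed

lemma K_hom_le:
  assumes t: "0 < t" and f: "f \<in> L1_plus_Linf M"
  shows "K_functional Y HS f t \<le> ennreal C1 * hardy 1 (E f) t"
proof (cases "hardy 1 (E f) t < \<infinity>")
  case True
  from exists_smoothing[OF t f this]
  obtain f0 where "Y f0 + ennreal t * HS (\<lambda>x. f x - f0 x) \<le> ennreal C1 * hardy 1 (E f) t" by blast
  then show ?thesis by (rule order_trans[OF K_functional_le])
next
  case False
  then show ?thesis using C1_pos by (simp add: not_less top_unique ennreal_mult_top)
qed

lemma sum_space_hom:
  assumes f: "f \<in> L1_plus_Linf M" and H: "hardy 1 (E f) 1 < \<infinity>"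
  shows "f \<in> sum_space Y HS"
proof -
  from exists_smoothing[OF _ f H] obtain f0 where
    "Y f0 + ennreal 1 * HS (\<lambda>x. f x - f0 x) \<le> ennreal C1 * hardy 1 (E f) 1" by auto
  also have "\<dots> < \<infinity>" using H by (simp add: ennreal_mult_less_top)
  finally have "Y f0 < \<infinity>" "HS (\<lambda>x. f x - f0 x) < \<infinity>" by auto
  then show ?thesis
    unfolding sum_space_def fspace_def
    by (intro CollectI bexI[of _ f0] bexI[of _ "\<lambda>x. f x - f0 x"]) auto
qed

lemma sum_space_hom_imp: "f \<in> sum_space Y HS \<Longrightarrow> f \<in> L1_plus_Linf M"
proof -
  assume "f \<in> sum_space Y HS"
  then obtain f0 f1 where *: "Y f0 < \<infinity>" "HS f1 < \<infinity>" "f = (\<lambda>x. f0 x + f1 x)"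
    by (auto simp: sum_space_def fspace_def)
  have "f1 \<in> L1_plus_Linf M" using *(2) by (auto simp: hom_sobolev_norm_def split: if_splits)
  then show ?thesis
    unfolding *(3) by (rule L1_plus_Linf_add[OF norm_finite_imp_L1_plus_Linf[OF *(1)]])
qed

text \<open>For s > 1 the oscillation is at most C0 \<open>Y f\<close>, and the kernel t/s^2 has
  integral at most t over that range.\<close>

lemma hardy_truncate:
  assumes t: "0 < t" and f: "f \<in> borel_measurable M"
  shows "hardy 1 (E f) t \<le> hardy 1 (\<lambda>s. indicator {0<..<1} s * E f s) t + ennreal t * (ennreal C0 * Y f)"
proof -
  note [measurable] = measurable_E[OF f]
  have ind [measurable]: "(\<lambda>s. indicator {0<..<1} s :: ennreal) \<in> borel_measurable half_line"
    by (rule borel_half_lineI) measurable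
  have "hardy 1 (E f) t \<le> (\<integral>\<^sup>+s. ennreal (hardy_kernel 1 t s) * (indicator {0<..<1} s * E f s) +
      ennreal t * ennreal (hardy_kernel 1 1 s) * (ennreal C0 * Y f) \<partial>half_line)"
    unfolding hardy_def
  proof (intro nn_integral_mono_AE, use AE_half_line_neq[of 1] AE_space in eventually_elim)
    case (elim s)
    then consider "0 < s" "s < 1" | "1 < s" by fastforce
    then show "ennreal (hardy_kernel 1 t s) * E f s \<le> ennreal (hardy_kernel 1 t s) * (indicator {0<..<1} s * E f s) +
      ennreal t * ennreal (hardy_kernel 1 1 s) * (ennreal C0 * Y f)"
    proof cases
      case 2
      have "hardy_kernel 1 t s \<le> t * hardy_kernel 1 1 s"
        using 2 t by (cases "t < s") (auto simp: hardy_kernel_def power2_eq_square)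
      then have "ennreal (hardy_kernel 1 t s) \<le> ennreal t * ennreal (hardy_kernel 1 1 s)"
        using t by (simp add: ennreal_mult[symmetric] hardy_kernel_nonneg ennreal_leI)
      moreover have "E f s \<le> ennreal C0 * Y f" using 2 by (intro E_le_norm f) auto
      ultimately have "ennreal (hardy_kernel 1 t s) * E f s \<le> ennreal t * ennreal (hardy_kernel 1 1 s) * (ennreal C0 * Y f)"
        by (rule mult_mono) auto
      then show ?thesis by (rule order_trans) simp
    qed simp
  qed
  also have "\<dots> = hardy 1 (\<lambda>s. indicator {0<..<1} s * E f s) t +
      (\<integral>\<^sup>+s. ennreal t * ennreal (hardy_kernel 1 1 s) * (ennreal C0 * Y f) \<partial>half_line)"
    unfolding hardy_def by (rule nn_integral_add) measurable
  also have "(\<integral>\<^sup>+s. ennreal t * ennreal (hardy_kernel 1 1 s) * (ennreal C0 * Y f) \<partial>half_line) =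
      ennreal t * (\<integral>\<^sup>+s. ennreal (hardy_kernel 1 1 s) \<partial>half_line) * (ennreal C0 * Y f)"
    by (subst nn_integral_multc, measurable, subst nn_integral_cmult) measurable
  also have "\<dots> = ennreal t * (ennreal C0 * Y f)"
    by (subst nn_integral_hardy_kernel_tail) auto
  finally show ?thesis .
qed

definition C2 :: real where "C2 = 2 * C1 * (1 + C0) + 1"

lemma C2_pos: "0 < C2"
  using C1_pos C0_pos unfolding C2_def by (intro add_pos_pos mult_pos_pos) auto

text \<open>For t \<ge> 1 take f0 = f, so that the second term vanishes. For t < 1 the smoothing is
  used: the additional cost is at most t \<open>Y f\<close> + t \<open>Y f0\<close>, and t
  \<open>Y f0\<close> \<le> \<open>Y f0\<close> is bounded like the rest.\<close>

lemma K_inhom_le: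
  assumes t: "0 < t" and f: "Y f < \<infinity>"
  shows "K_functional Y SN f t \<le> ennreal C2 * (hardy 1 (\<lambda>s. indicator {0<..<1} s * E f s) t + ennreal (min 1 t) * Y f)"
proof (cases "t < 1")
  case False
  have "K_functional Y SN f t \<le> Y f + ennreal t * SN (\<lambda>x. f x - f x)" by (rule K_functional_le)
  also have "\<dots> = 1 * (ennreal (min 1 t) * Y f)" using False by (simp add: sobolev_norm_def hom_sobolev_zero)
  also have "\<dots> \<le> ennreal C2 * (hardy 1 (\<lambda>s. indicator {0<..<1} s * E f s) t + ennreal (min 1 t) * Y f)"
  proof (rule mult_mono)
    have "0 \<le> 2 * C1 * (1 + C0)" using C1_pos C0_pos by simp
    then have "ennreal 1 \<le> ennreal C2" unfolding C2_def by (intro ennreal_leI) simp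
    then show "1 \<le> ennreal C2" by simp
  qed auto
  finally show ?thesis .
next
  case True
  let ?H = "hardy 1 (E f) t" and ?H' = "hardy 1 (\<lambda>s. indicator {0<..<1} s * E f s) t"
  have fL: "f \<in> L1_plus_Linf M" by (rule norm_finite_imp_L1_plus_Linf[OF f])
  have fm: "f \<in> borel_measurable M" by (rule space_norm_finite_measurable[OF f])
  show ?thesis
  proof (cases "?H' < \<infinity>")
    case H': True
    have H_le: "?H \<le> ?H' + ennreal t * (ennreal C0 * Y f)" by (rule hardy_truncate[OF t fm])
    also have "\<dots> < \<infinity>" using H' f by (simp add: ennreal_mult_less_top)
    finally have H: "?H < \<infinity>" .
    from exists_smoothing[OF t fL H] obtain f0 where
      f0: "Y f0 + ennreal t * HS (\<lambda>x. f x - f0 x) \<le> ennreal C1 * ?H" "Y f0 \<le> ennreal C1 * ?H" by blast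
    have "K_functional Y SN f t \<le> Y f0 + ennreal t * SN (\<lambda>x. f x - f0 x)" by (rule K_functional_le)
    also have "\<dots> = (Y f0 + ennreal t * HS (\<lambda>x. f x - f0 x)) + ennreal t * Y (\<lambda>x. f x - f0 x)"
      by (simp add: sobolev_norm_def distrib_left add_ac)
    also have "\<dots> \<le> ennreal C1 * ?H + ennreal t * (Y f + Y f0)"
      by (intro add_mono f0 mult_left_mono space_norm_diff) simp
    also have "\<dots> \<le> ennreal C1 * ?H + (ennreal t * Y f + 1 * (ennreal C1 * ?H))"
      unfolding distrib_left using True by (intro add_left_mono mult_mono f0) auto
    also have "\<dots> = ennreal (2 * C1) * ?H + ennreal t * Y f"
    proof -
      have "ennreal (2 * C1) = ennreal C1 + ennreal C1"
        using C1_pos by (simp add: ennreal_plus[symmetric] del: ennreal_plus)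
      then show ?thesis by (simp only: distrib_right mult_1 add_ac)
    qed
    also have "\<dots> \<le> ennreal (2 * C1) * (?H' + ennreal t * (ennreal C0 * Y f)) + ennreal t * Y f"
      by (intro add_right_mono mult_left_mono H_le) simp
    also have "\<dots> = ennreal (2 * C1) * ?H' + ennreal (2 * C1 * C0 + 1) * (ennreal t * Y f)"
    proof -
      have "ennreal (2 * C1 * C0 + 1) = ennreal (2 * C1) * ennreal C0 + 1"
        using C1_pos C0_pos by (simp add: ennreal_mult)
      then show ?thesis by (simp only: distrib_left distrib_right mult_ac add_ac mult_1)
    qed
    also have "\<dots> \<le> ennreal C2 * ?H' + ennreal C2 * (ennreal t * Y f)"
      using C1_pos C0_pos unfolding C2_def
      by (intro add_mono mult_right_mono ennreal_leI) (auto simp: algebra_simps)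
    also have "\<dots> = ennreal C2 * (?H' + ennreal (min 1 t) * Y f)"
      using True by (simp add: distrib_left)
    finally show ?thesis .
  next
    case False
    then show ?thesis using C2_pos by (simp add: not_less top_unique ennreal_mult_top)
  qed
qed

lemma norm_le_K_inhom: "Y f \<le> K_functional Y SN f 1"
proof -
  have "Y f \<le> Y f0 + ennreal 1 * SN (\<lambda>x. f x - f0 x)" for f0
  proof -
    have "Y f \<le> Y f0 + Y (\<lambda>x. f x - f0 x)" using space_norm_triangle[of f0 "\<lambda>x. f x - f0 x"] by simp
    also have "\<dots> \<le> Y f0 + ennreal 1 * SN (\<lambda>x. f x - f0 x)"
      by (intro add_left_mono) (simp add: sobolev_norm_def)
    finally show ?thesis .
  qed
  then show ?thesis unfolding K_functional_def by (intro INF_greatest) auto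
qed

lemma K_hom_le_K_inhom: "K_functional Y HS f t \<le> K_functional Y SN f t"
  unfolding K_functional_def
  by (intro INF_mono' add_left_mono mult_left_mono) (auto simp: sobolev_norm_def)

text \<open>\<open>SN\<close> dominates \<open>Y\<close>, so the sum adds nothing to the larger
  space.\<close>

lemma sum_space_inhom_iff: "f \<in> sum_space Y SN \<longleftrightarrow> Y f < \<infinity>"
proof
  assume "f \<in> sum_space Y SN"
  then have "K_functional Y SN f 1 < \<infinity>" by (rule K_functional_finite)
  with norm_le_K_inhom show "Y f < \<infinity>" by (rule le_less_trans)
next
  assume "Y f < \<infinity>"
  moreover have "SN (\<lambda>x. 0) < \<infinity>" by (simp add: sobolev_norm_def hom_sobolev_zero)
  moreover have "f = (\<lambda>x. f x + 0)" by simp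
  ultimately show "f \<in> sum_space Y SN"
    unfolding sum_space_def fspace_def by (intro CollectI bexI[of _ f] bexI[of _ "\<lambda>x. 0"]) auto
qed

end

section \<open>Weights and the equivalence of norms\<close>

text \<open>\<open>w_kernel\<close> lets the weight pass under the Hardy integral at the price of
  lowering the exponent from 1 to \<delta>. The last two conditions put min(1,t) w(t) into both end
  point spaces, hence into every space the functor can produce from them.\<close>

locale weight =
  fixes w :: "real \<Rightarrow> real" and \<delta> C3 :: real
  assumes w_measurable [measurable]: "w \<in> borel_measurable half_line"
    and w_pos: "0 < t \<Longrightarrow> 0 < w t"
    and \<delta>_pos: "0 < \<delta>" and C3_pos: "0 < C3"
    and w_kernel: "0 < t \<Longrightarrow> t < s \<Longrightarrow> w t * (t / s) \<le> C3 * ((t / s) powr \<delta> * w s)"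
    and w_L1: "L1_tilde_norm (\<lambda>t. min 1 t * w t) < \<infinity>"
    and w_Linf: "Linf_norm half_line (\<lambda>t. min 1 t * w t) < \<infinity>"
begin

lemma weight_hardy:
  assumes t: "0 < t" and g [measurable]: "g \<in> borel_measurable half_line"
  shows "ennreal (w t) * hardy 1 g t \<le> ennreal C3 * hardy \<delta> (\<lambda>s. ennreal (w s) * g s) t"
proof -
  have "ennreal (w t) * hardy 1 g t = (\<integral>\<^sup>+s. ennreal (w t) * (ennreal (hardy_kernel 1 t s) * g s) \<partial>half_line)"
    unfolding hardy_def by (rule nn_integral_cmult[symmetric]) measurable
  also have "\<dots> \<le> (\<integral>\<^sup>+s. ennreal C3 * (ennreal (hardy_kernel \<delta> t s) * (ennreal (w s) * g s)) \<partial>half_line)"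
  proof (rule nn_integral_mono)
    fix s
    show "ennreal (w t) * (ennreal (hardy_kernel 1 t s) * g s) \<le>
        ennreal C3 * (ennreal (hardy_kernel \<delta> t s) * (ennreal (w s) * g s))"
    proof (cases "t < s")
      case True
      have "w t * (t / s) / s \<le> C3 * ((t / s) powr \<delta> * w s) / s"
        using t True by (intro divide_right_mono w_kernel) auto
      then have "w t * hardy_kernel 1 t s \<le> C3 * hardy_kernel \<delta> t s * w s"
        using t True by (simp add: hardy_kernel_def)
      then have "ennreal (w t * hardy_kernel 1 t s) * g s \<le> ennreal (C3 * hardy_kernel \<delta> t s * w s) * g s"
        by (intro mult_right_mono ennreal_leI) auto
      moreover have "ennreal (w t * hardy_kernel 1 t s) = ennreal (w t) * ennreal (hardy_kernel 1 t s)"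
        using w_pos[OF t] by (intro ennreal_mult hardy_kernel_nonneg) auto
      moreover have "ennreal (C3 * hardy_kernel \<delta> t s * w s) = ennreal C3 * ennreal (hardy_kernel \<delta> t s) * ennreal (w s)"
        using w_pos[of s] t True C3_pos by (simp add: ennreal_mult hardy_kernel_nonneg)
      ultimately show ?thesis by (simp only: mult.assoc)
    qed (simp add: hardy_kernel_def)
  qed
  also have "\<dots> = ennreal C3 * hardy \<delta> (\<lambda>s. ennreal (w s) * g s) t"
    unfolding hardy_def by (rule nn_integral_cmult) measurable
  finally show ?thesis .
qed

end

section \<open>Power weights with a slowly varying factor\<close>

lemma slowly_varying_almost_mono:
  assumes b: "slowly_varying b" and e: "0 < e"
  obtains K where "0 < K" "\<And>t s. 0 < t \<Longrightarrow> t \<le> s \<Longrightarrow> t powr e * b t \<le> K * (s powr e * b s)"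
proof -
  note B = conjunct2[OF conjunct2[OF b[unfolded slowly_varying_def]], THEN spec, THEN mp, OF e]
  obtain \<phi> c C where "0 < c \<and> 0 < C \<and> mono_on {0<..} \<phi> \<and>
    (\<forall>t>0. c * \<phi> t \<le> t powr e * b t \<and> t powr e * b t \<le> C * \<phi> t)"
    using conjunct1[OF B] by (elim exE)
  then have *: "0 < c" "0 < C" "mono_on {0<..} \<phi>"
    "\<And>t. 0 < t \<Longrightarrow> c * \<phi> t \<le> t powr e * b t \<and> t powr e * b t \<le> C * \<phi> t"
    by simp_all
  have "t powr e * b t \<le> C / c * (s powr e * b s)" if "0 < t" "t \<le> s" for t s
  proof -
    have "t powr e * b t \<le> C * \<phi> t" using *(4)[OF that(1)] by simp
    also have "\<dots> \<le> C * \<phi> s" using that *(2) by (intro mult_left_mono mono_onD[OF *(3)]) auto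
    also have "\<dots> = C / c * (c * \<phi> s)" using *(1) by simp
    also have "\<dots> \<le> C / c * (s powr e * b s)" using *(1,2,4) that by (intro mult_left_mono) auto
    finally show ?thesis .
  qed
  with *(1,2) show thesis by (intro that[of "C / c"]) auto
qed

lemma slowly_varying_almost_antimono:
  assumes b: "slowly_varying b" and e: "0 < e"
  obtains K where "0 < K" "\<And>t s. 0 < t \<Longrightarrow> t \<le> s \<Longrightarrow> s powr (- e) * b s \<le> K * (t powr (- e) * b t)"
proof -
  note B = conjunct2[OF conjunct2[OF b[unfolded slowly_varying_def]], THEN spec, THEN mp, OF e]
  obtain \<phi> c C where "0 < c \<and> 0 < C \<and> antimono_on {0<..} \<phi> \<and>
    (\<forall>t>0. c * \<phi> t \<le> t powr (- e) * b t \<and> t powr (- e) * b t \<le> C * \<phi> t)"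
    using conjunct2[OF B] by (elim exE)
  then have *: "0 < c" "0 < C" "antimono_on {0<..} \<phi>"
    "\<And>t. 0 < t \<Longrightarrow> c * \<phi> t \<le> t powr (- e) * b t \<and> t powr (- e) * b t \<le> C * \<phi> t"
    by simp_all
  have "s powr (- e) * b s \<le> C / c * (t powr (- e) * b t)" if "0 < t" "t \<le> s" for t s
  proof -
    have "s powr (- e) * b s \<le> C * \<phi> s" using *(4)[of s] that by simp
    also have "\<dots> \<le> C * \<phi> t" using that *(2) by (intro mult_left_mono monotone_onD[OF *(3)]) auto
    also have "\<dots> = C / c * (c * \<phi> t)" using *(1) by simp
    also have "\<dots> \<le> C / c * (t powr (- e) * b t)" using *(1,2,4) that by (intro mult_left_mono) auto
    finally show ?thesis .
  qed
  with *(1,2) show thesis by (intro that[of "C / c"]) auto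
qed

lemma slowly_varying_weight:
  assumes b: "slowly_varying b" and \<theta>: "0 < \<theta>" "\<theta> < 1"
  obtains C3 where "weight (\<lambda>t. t powr (- \<theta>) * b t) ((1 - \<theta>) / 2) C3"
proof -
  \<comment> \<open>Half of each power is spent on making b almost monotone. The other half,
    t^\<delta> near 0 and t^(-\<eta>) near infinity, gives integrability against dt/t.\<close>
  define \<delta> \<eta> where "\<delta> = (1 - \<theta>) / 2" and "\<eta> = \<theta> / 2"
  have pos: "0 < \<delta>" "0 < \<eta>" using \<theta> by (auto simp: \<delta>_def \<eta>_def)
  obtain K where K: "0 < K" "\<And>t s. 0 < t \<Longrightarrow> t \<le> s \<Longrightarrow> t powr \<delta> * b t \<le> K * (s powr \<delta> * b s)"
    using slowly_varying_almost_mono[OF b pos(1)] by blast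
  obtain K' where K': "0 < K'" "\<And>t s. 0 < t \<Longrightarrow> t \<le> s \<Longrightarrow> s powr (- \<eta>) * b s \<le> K' * (t powr (- \<eta>) * b t)"
    using slowly_varying_almost_antimono[OF b pos(2)] by blast
  have bm [measurable]: "b \<in> borel_measurable half_line" and b_pos: "\<And>t. 0 < t \<Longrightarrow> 0 < b t"
    using b by (auto simp: slowly_varying_def)
  let ?w = "\<lambda>t. t powr (- \<theta>) * b t"
  have split: "t powr (- \<theta>) = t powr \<delta> * t powr \<delta> / t" if "0 < t" for t
  proof -
    have "t powr \<delta> * t powr \<delta> = t powr (1 - \<theta>)" by (simp add: \<delta>_def powr_add[symmetric])
    also have "\<dots> = t * t powr (- \<theta>)" using that by (simp add: powr_diff powr_minus divide_inverse)
    finally show ?thesis using that by simp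
  qed
  define A where "A = (K + K') * b 1"
  have A: "0 < A" using K K' b_pos[of 1] by (simp add: A_def)
  have le1: "min 1 t * ?w t \<le> A * t powr \<delta>" if "0 < t" "t \<le> 1" for t
  proof -
    have "min 1 t * ?w t = t powr \<delta> * (t powr \<delta> * b t)" using that by (simp add: split)
    also have "\<dots> \<le> t powr \<delta> * (K * b 1)" using K(2)[of t 1] that by (intro mult_left_mono) auto
    also have "\<dots> \<le> t powr \<delta> * A" using K' b_pos[of 1] by (intro mult_left_mono) (auto simp: A_def distrib_right)
    finally show ?thesis by (simp add: mult.commute)
  qed
  have le2: "min 1 t * ?w t \<le> A * t powr (- \<eta>)" if "1 \<le> t" for t
  proof -
    have "min 1 t * ?w t = t powr (- \<eta>) * (t powr (- \<eta>) * b t)"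
      using that by (simp add: \<eta>_def powr_add[symmetric] mult.assoc[symmetric])
    also have "\<dots> \<le> t powr (- \<eta>) * (K' * b 1)" using K'(2)[of 1 t] that by (intro mult_left_mono) auto
    also have "\<dots> \<le> t powr (- \<eta>) * A" using K b_pos[of 1] by (intro mult_left_mono) (auto simp: A_def distrib_right)
    finally show ?thesis by (simp add: mult.commute)
  qed
  have nonneg: "0 \<le> min 1 t * ?w t" if "0 < t" for t using that b_pos[of t] by simp
  show thesis
  proof (rule that[of K], fold \<delta>_def, unfold_locales)
    show wm: "?w \<in> borel_measurable half_line" by measurable
    show "0 < ?w t" if "0 < t" for t using that b_pos[of t] by simp
    show "?w t * (t / s) \<le> K * ((t / s) powr \<delta> * ?w s)" if "0 < t" "t < s" for t s
    proof -
      have "?w t * (t / s) = t powr \<delta> / s * (t powr \<delta> * b t)" using that by (simp add: split)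
      also have "\<dots> \<le> t powr \<delta> / s * (K * (s powr \<delta> * b s))"
        using that by (intro mult_left_mono K) auto
      also have "\<dots> = K * ((t / s) powr \<delta> * ?w s)" using that by (simp add: split powr_divide)
      finally show ?thesis .
    qed
    have "min 1 t * ?w t \<le> A" if "0 < t" for t
    proof (cases "t \<le> 1")
      case True
      have "t powr \<delta> \<le> 1" using True that pos by (intro powr_le1) auto
      then have "A * t powr \<delta> \<le> A * 1" using A by (intro mult_left_mono) auto
      with le1[OF that True] show ?thesis by linarith
    next
      case False
      then have "t powr (- \<eta>) \<le> t powr 0" using pos by (intro powr_mono) simp_all
      then have "A * t powr (- \<eta>) \<le> A * 1" using A that by (intro mult_left_mono) simp_all
      with le2[of t] False show ?thesis by linarith
    qed
    then have "Linf_norm half_line (\<lambda>t. min 1 t * ?w t) \<le> ennreal A"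
      using nonneg by (subst Linf_norm_le_iff) (measurable, auto intro!: AE_I2 ennreal_leI)
    then show "Linf_norm half_line (\<lambda>t. min 1 t * ?w t) < \<infinity>" by (rule le_less_trans) simp
    have "L1_tilde_norm (\<lambda>t. min 1 t * ?w t) = (\<integral>\<^sup>+t. ennreal \<bar>min 1 t * ?w t\<bar> * ennreal (1 / t) \<partial>half_line)"
      by (rule L1_tilde_norm_eq) measurable
    \<comment> \<open>The majorants t^\<delta> on (0,1) and t^(-\<eta>) on (1,\<infinity>), against
      dt/t, are Hardy kernels with one variable equal to 1, so their integrals are already
      known.\<close>
    also have "\<dots> \<le> (\<integral>\<^sup>+t. ennreal A * (ennreal (hardy_kernel \<delta> t 1) * ennreal (1 / t) + ennreal (hardy_kernel \<eta> 1 t)) \<partial>half_line)"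
    proof (intro nn_integral_mono_AE, use AE_half_line_neq[of 1] AE_space in eventually_elim)
      case (elim t)
      then have t: "0 < t" by simp
      have "min 1 t * ?w t * (1 / t) \<le> A * (hardy_kernel \<delta> t 1 * (1 / t) + hardy_kernel \<eta> 1 t)"
      proof (cases "t < 1")
        case True
        have "min 1 t * ?w t * (1 / t) \<le> A * t powr \<delta> * (1 / t)"
          using le1[of t] t True by (intro mult_right_mono) auto
        then show ?thesis using t True by (simp add: hardy_kernel_def)
      next
        case False
        then have t1: "1 < t" using elim by simp
        have "min 1 t * ?w t * (1 / t) \<le> A * t powr (- \<eta>) * (1 / t)"
          using le2[of t] t1 by (intro mult_right_mono) auto
        also have "\<dots> = A * hardy_kernel \<eta> 1 t"
          using t1 by (simp add: hardy_kernel_def powr_divide powr_minus_divide)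
        finally show ?thesis using t1 by (simp add: hardy_kernel_def)
      qed
      then have "ennreal (min 1 t * ?w t * (1 / t)) \<le> ennreal (A * (hardy_kernel \<delta> t 1 * (1 / t) + hardy_kernel \<eta> 1 t))"
        by (rule ennreal_leI)
      moreover have "ennreal (min 1 t * ?w t * (1 / t)) = ennreal \<bar>min 1 t * ?w t\<bar> * ennreal (1 / t)"
        unfolding abs_of_nonneg[OF nonneg[OF t]] by (rule ennreal_mult[OF nonneg[OF t]]) (use t in simp)
      moreover have "ennreal (A * (hardy_kernel \<delta> t 1 * (1 / t) + hardy_kernel \<eta> 1 t)) =
          ennreal A * (ennreal (hardy_kernel \<delta> t 1) * ennreal (1 / t) + ennreal (hardy_kernel \<eta> 1 t))"
        using A t by (subst ennreal_mult, simp_all add: hardy_kernel_nonneg)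
          (subst ennreal_mult[symmetric], simp_all add: hardy_kernel_nonneg)
      ultimately show "ennreal \<bar>min 1 t * ?w t\<bar> * ennreal (1 / t) \<le>
          ennreal A * (ennreal (hardy_kernel \<delta> t 1) * ennreal (1 / t) + ennreal (hardy_kernel \<eta> 1 t))"
        by simp
    qed
    also have "\<dots> = ennreal A * ((\<integral>\<^sup>+t. ennreal (hardy_kernel \<delta> t 1) * ennreal (1 / t) \<partial>half_line) +
        (\<integral>\<^sup>+t. ennreal (hardy_kernel \<eta> 1 t) \<partial>half_line))"
      by (subst nn_integral_cmult, measurable, subst nn_integral_add) measurable
    also have "\<dots> < \<infinity>"
      using pos by (simp add: nn_integral_hardy_kernel_head nn_integral_hardy_kernel_tail ennreal_mult_less_top)
    finally show "L1_tilde_norm (\<lambda>t. min 1 t * ?w t) < \<infinity>" .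
  qed (use pos K in auto)
qed

locale besov_interpolation =
  doubling_ri_space M D \<rho> + functor_norm F + weight w \<delta> C3
  for M :: "'a::metric_space measure" and D \<rho> F w \<delta> C3
begin

abbreviation TN :: "(real \<Rightarrow> ennreal) \<Rightarrow> ennreal" where "TN \<equiv> tilde_norm F"

text \<open>This and the next two definitions repeat the norms of the statement with an abstract
  weight in place of t^(-\<theta>) b(t).\<close>

definition hom_besov :: "('a \<Rightarrow> real) \<Rightarrow> ennreal" where
  "hom_besov f = (if f \<in> L1_plus_Linf M then TN (\<lambda>t. ennreal (w t) * E f t) else \<infinity>)"

definition interp :: "(('a \<Rightarrow> real) \<Rightarrow> ennreal) \<Rightarrow> ('a \<Rightarrow> real) \<Rightarrow> ennreal" where
  "interp N1 f = (if f \<in> sum_space Y N1 then TN (\<lambda>t. ennreal (w t) * K_functional Y N1 f t) else \<infinity>)"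

definition inhom_besov :: "('a \<Rightarrow> real) \<Rightarrow> ennreal" where
  "inhom_besov f = (if f \<in> fspace hom_besov \<inter> fspace Y
    then TN (\<lambda>t. indicator {0<..<1} t * (ennreal (w t) * E f t)) + Y f else \<infinity>)"

lemma measurable_wE:
  assumes "f \<in> borel_measurable M"
  shows "(\<lambda>t. ennreal (w t) * E f t) \<in> borel_measurable half_line"
  using measurable_E[OF assms] by measurable

lemma measurable_wK:
  assumes "f \<in> sum_space Y N1"
  shows "(\<lambda>t. ennreal (w t) * K_functional Y N1 f t) \<in> borel_measurable half_line"
  using measurable_K_functional[OF assms] by measurable

lemma hom_besov_le: "hom_besov f \<le> ennreal C0 * interp HS f"
proof (cases "f \<in> sum_space Y HS")
  case True
  have f: "f \<in> L1_plus_Linf M" by (rule sum_space_hom_imp[OF True])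
  have fm: "f \<in> borel_measurable M" by (rule L1_plus_Linf_measurable[OF f])
  have "TN (\<lambda>t. ennreal (w t) * E f t) \<le> ennreal C0 * TN (\<lambda>t. ennreal (w t) * K_functional Y HS f t)"
  proof (rule tilde_norm_mono[OF measurable_wE[OF fm] _ C0_pos], rule AE_I2)
    fix t assume "t \<in> space half_line"
    then have "ennreal (w t) * E f t \<le> ennreal (w t) * (ennreal C0 * K_functional Y HS f t)"
      by (intro mult_left_mono E_le_K fm) auto
    then show "ennreal (w t) * E f t \<le> ennreal C0 * (ennreal (w t) * K_functional Y HS f t)"
      by (simp only: mult.left_commute)
  qed
  then show ?thesis using f True by (simp add: hom_besov_def interp_def)
next
  case False
  then show ?thesis using C0_pos by (simp add: interp_def ennreal_mult_top)
qed

lemma interp_hom_le: "interp HS f \<le> ennreal (C1 * C3 / \<delta>) * hom_besov f"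
proof (cases "hom_besov f < \<infinity>")
  case True
  then have f: "f \<in> L1_plus_Linf M" by (auto simp: hom_besov_def split: if_splits)
  have fm: "f \<in> borel_measurable M" by (rule L1_plus_Linf_measurable[OF f])
  let ?g = "\<lambda>t. ennreal (w t) * E f t"
  note gm = measurable_wE[OF fm]
  have fin: "TN ?g < \<infinity>" using True f by (simp add: hom_besov_def)
  \<comment> \<open>\<open>interp\<close> is \<infinity> outside the sum space, so membership must
    be established first; one decomposition, at t = 1, is enough.\<close>
  have H: "hardy 1 (E f) 1 < \<infinity>"
  proof -
    have "ennreal (w 1) * hardy 1 (E f) 1 \<le> ennreal C3 * hardy \<delta> ?g 1"
      by (rule weight_hardy[OF _ measurable_E[OF fm]]) simp
    also have "\<dots> < \<infinity>"
      using tilde_norm_hardy(2)[OF gm \<delta>_pos fin, of 1] by (simp add: ennreal_mult_less_top)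
    finally show ?thesis using w_pos[of 1] by (auto simp: ennreal_mult_less_top)
  qed
  have sum: "f \<in> sum_space Y HS" by (rule sum_space_hom[OF f H])
  have "TN (\<lambda>t. ennreal (w t) * K_functional Y HS f t) \<le> ennreal (C1 * C3) * TN (hardy \<delta> ?g)"
  proof (rule tilde_norm_mono[OF measurable_wK[OF sum]], rule AE_I2)
    show "0 < C1 * C3" using C1_pos C3_pos by simp
    fix t assume "t \<in> space half_line"
    then have t: "0 < t" by simp
    have "ennreal (w t) * K_functional Y HS f t \<le> ennreal (w t) * (ennreal C1 * hardy 1 (E f) t)"
      by (intro mult_left_mono K_hom_le f t) simp
    also have "\<dots> = ennreal C1 * (ennreal (w t) * hardy 1 (E f) t)" by (simp only: mult.left_commute)
    also have "\<dots> \<le> ennreal C1 * (ennreal C3 * hardy \<delta> ?g t)"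
      by (intro mult_left_mono weight_hardy t measurable_E fm) simp
    also have "\<dots> = ennreal (C1 * C3) * hardy \<delta> ?g t"
      using C1_pos C3_pos by (simp add: ennreal_mult mult.assoc)
    finally show "ennreal (w t) * K_functional Y HS f t \<le> ennreal (C1 * C3) * hardy \<delta> ?g t" .
  qed
  also have "\<dots> \<le> ennreal (C1 * C3) * (ennreal (1 / \<delta>) * TN ?g)"
    by (intro mult_left_mono tilde_norm_hardy(1) gm \<delta>_pos) simp
  also have "\<dots> = ennreal (C1 * C3 / \<delta>) * TN ?g"
  proof -
    have "ennreal (C1 * C3 / \<delta>) = ennreal (C1 * C3) * ennreal (1 / \<delta>)"
      using C1_pos C3_pos \<delta>_pos by (subst ennreal_mult[symmetric]) auto
    then show ?thesis by (simp only: mult.assoc)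
  qed
  finally show ?thesis using sum f by (simp add: interp_def hom_besov_def)
next
  case False
  then show ?thesis using C1_pos C3_pos \<delta>_pos by (simp add: not_less top_unique ennreal_mult_top)
qed

lemma hom_besov_equiv: "same_space_equiv_norms hom_besov (interp HS)"
  by (rule same_space_equiv_normsI[OF _ C0_pos hom_besov_le interp_hom_le])
     (use C1_pos C3_pos \<delta>_pos in simp)

text \<open>The norm of min(1,t) w(t), the profile of the smallest K-functional with K(f,1) = 1. Its
  finiteness bounds the term min(1,t) \<open>Y f\<close> from above, its positivity recovers
  \<open>Y f\<close> from the interpolation norm.\<close>

definition \<tau> :: ennreal where "\<tau> = TN (\<lambda>t. ennreal (min 1 t * w t))"

lemma \<tau>_finite: "\<tau> < \<infinity>" and \<tau>_pos: "\<tau> \<noteq> 0"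
proof -
  have eq: "\<tau> = N (\<lambda>t. enn2real (ennreal (min 1 t * w t)))"
    unfolding \<tau>_def by (rule tilde_norm_eq) simp
  have "\<tau> \<le> N (\<lambda>t. min 1 t * w t)"
    unfolding eq using w_pos
    by (intro N_mono_AE AE_I2) (measurable, simp add: less_imp_le)
  also have "\<dots> < \<infinity>" by (rule N_finite_pos[OF w_L1 w_Linf])
  finally show "\<tau> < \<infinity>" .
  show "\<tau> \<noteq> 0"
  proof
    assume "\<tau> = 0"
    then have "AE t in half_line. enn2real (ennreal (min 1 t * w t)) = 0"
      unfolding eq by (rule N_eq_0D)
    with AE_space have "AE t in half_line. False"
    proof eventually_elim
      case (elim t)
      then show ?case using w_pos[of t] by simp
    qed
    then show False using not_AE_half_line_False by simp
  qed
qed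

definition \<tau>r :: real where "\<tau>r = enn2real \<tau>"

lemma \<tau>r: "\<tau> = ennreal \<tau>r" "0 < \<tau>r"
proof -
  show *: "\<tau> = ennreal \<tau>r" using \<tau>_finite by (simp add: \<tau>r_def)
  show "0 < \<tau>r" using \<tau>_pos unfolding * by (simp add: ennreal_eq_0_iff)
qed

lemma TN_min_times_const: "c < \<infinity> \<Longrightarrow> TN (\<lambda>t. ennreal (min 1 t * w t) * c) \<le> \<tau> * c"
proof -
  assume "c < \<infinity>"
  then obtain r where r: "c = ennreal r" "0 \<le> r" by (cases c) auto
  show ?thesis
  proof (cases "r = 0")
    case True
    have "TN (\<lambda>t. 0) = N (\<lambda>t. 0)" by (subst tilde_norm_eq) auto
    then show ?thesis using True r by (simp add: N_zero)
  next
    case False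
    then have "TN (\<lambda>t. ennreal (min 1 t * w t) * c) \<le> ennreal r * TN (\<lambda>t. ennreal (min 1 t * w t))"
      using r by (intro tilde_norm_mono) (measurable, auto simp: mult.commute)
    then show ?thesis by (simp add: r \<tau>_def mult.commute)
  qed
qed

definition C4 :: real where "C4 = C2 * (C3 / \<delta> + \<tau>r)"

lemma C4_pos: "0 < C4"
  using C2_pos C3_pos \<delta>_pos \<tau>r(2) by (simp add: C4_def add_pos_pos)

text \<open>\<open>K_inhom_le\<close> splits K into a Hardy integral of the truncated oscillation,
  estimated as in the homogeneous case, and min(1,t) \<open>Y f\<close>, whose weighted norm is at
  most \<tau> \<open>Y f\<close>.\<close>

lemma interp_inhom_le: "interp SN f \<le> ennreal C4 * inhom_besov f"
proof (cases "f \<in> fspace hom_besov \<inter> fspace Y")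
  case True
  then have Yf: "Y f < \<infinity>" by (simp add: fspace_def)
  have fm: "f \<in> borel_measurable M" by (rule space_norm_finite_measurable[OF Yf])
  have sum: "f \<in> sum_space Y SN" using Yf by (simp add: sum_space_inhom_iff)
  note [measurable] = measurable_E[OF fm]
  have ind [measurable]: "(\<lambda>s. indicator {0<..<1} s :: ennreal) \<in> borel_measurable half_line"
    by (rule borel_half_lineI) measurable
  let ?G = "\<lambda>t. indicator {0<..<1} t * (ennreal (w t) * E f t)"
  have Gm [measurable]: "?G \<in> borel_measurable half_line" by measurable
  have hm [measurable]: "hardy \<delta> ?G \<in> borel_measurable half_line" by (rule measurable_hardy[OF Gm])
  let ?h = "\<lambda>t. ennreal C3 * hardy \<delta> ?G t + ennreal (min 1 t * w t) * Y f"
  have "TN (\<lambda>t. ennreal (w t) * K_functional Y SN f t) \<le> ennreal C2 * TN ?h"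
  proof (rule tilde_norm_mono[OF measurable_wK[OF sum] _ C2_pos], rule AE_I2)
    fix t assume "t \<in> space half_line"
    then have t: "0 < t" by simp
    let ?H = "hardy 1 (\<lambda>s. indicator {0<..<1} s * E f s) t"
    have "ennreal (w t) * K_functional Y SN f t \<le> ennreal (w t) * (ennreal C2 * (?H + ennreal (min 1 t) * Y f))"
      by (intro mult_left_mono K_inhom_le t Yf) simp
    also have "\<dots> = ennreal C2 * (ennreal (w t) * ?H + ennreal (w t) * ennreal (min 1 t) * Y f)"
      by (simp only: distrib_left mult_ac)
    also have "ennreal (w t) * ennreal (min 1 t) = ennreal (min 1 t * w t)"
      using t w_pos[OF t] by (simp add: ennreal_mult[symmetric] mult.commute)
    also have "ennreal C2 * (ennreal (w t) * ?H + ennreal (min 1 t * w t) * Y f) \<le> ennreal C2 * ?h t"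
    proof (intro mult_left_mono add_right_mono)
      have "ennreal (w t) * ?H \<le> ennreal C3 * hardy \<delta> (\<lambda>s. ennreal (w s) * (indicator {0<..<1} s * E f s)) t"
        by (intro weight_hardy t) measurable
      then show "ennreal (w t) * ?H \<le> ennreal C3 * hardy \<delta> ?G t" by (simp only: mult.left_commute)
    qed simp
    finally show "ennreal (w t) * K_functional Y SN f t \<le> ennreal C2 * ?h t" .
  qed
  also have "\<dots> \<le> ennreal C2 * (ennreal (C3 / \<delta>) * TN ?G + ennreal \<tau>r * Y f)"
  proof (rule mult_left_mono)
    have "TN ?h \<le> TN (\<lambda>t. ennreal C3 * hardy \<delta> ?G t) + TN (\<lambda>t. ennreal (min 1 t * w t) * Y f)"
      by (rule tilde_norm_add) measurable
    also have "TN (\<lambda>t. ennreal C3 * hardy \<delta> ?G t) \<le> ennreal C3 * TN (hardy \<delta> ?G)"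
      using C3_pos by (intro tilde_norm_mono) auto
    also have "\<dots> \<le> ennreal C3 * (ennreal (1 / \<delta>) * TN ?G)"
      by (intro mult_left_mono tilde_norm_hardy(1) Gm \<delta>_pos) simp
    also have "\<dots> = ennreal (C3 / \<delta>) * TN ?G"
    proof -
      have "ennreal (C3 / \<delta>) = ennreal C3 * ennreal (1 / \<delta>)"
        using C3_pos \<delta>_pos by (subst ennreal_mult[symmetric]) auto
      then show ?thesis by (simp only: mult.assoc)
    qed
    also have "TN (\<lambda>t. ennreal (min 1 t * w t) * Y f) \<le> ennreal \<tau>r * Y f"
      using TN_min_times_const[OF Yf] by (simp only: \<tau>r(1))
    finally show "TN ?h \<le> ennreal (C3 / \<delta>) * TN ?G + ennreal \<tau>r * Y f" by (simp add: add_mono)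
  qed simp
  also have "\<dots> \<le> ennreal C2 * (ennreal (C3 / \<delta> + \<tau>r) * TN ?G + ennreal (C3 / \<delta> + \<tau>r) * Y f)"
    using C3_pos \<delta>_pos \<tau>r(2) by (intro mult_left_mono add_mono mult_right_mono ennreal_leI) auto
  also have "\<dots> = ennreal C4 * (TN ?G + Y f)"
  proof -
    have "ennreal C4 = ennreal C2 * ennreal (C3 / \<delta> + \<tau>r)"
      unfolding C4_def using C2_pos C3_pos \<delta>_pos \<tau>r(2) by (intro ennreal_mult) auto
    then show ?thesis by (simp only: distrib_left mult.assoc)
  qed
  finally show ?thesis using True sum by (simp add: interp_def inhom_besov_def)
next
  case False
  then have "inhom_besov f = \<infinity>" unfolding inhom_besov_def by (rule if_not_P)
  then show ?thesis using C4_pos by (simp add: ennreal_mult_top)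
qed

text \<open>The homogeneous K-functional is below the inhomogeneous one, which bounds the
  oscillation at all scales, in particular the finiteness required by \<open>inhom_besov\<close>.
  The term \<open>Y f\<close> is at most K(f,1).\<close>

lemma inhom_besov_le: "inhom_besov f \<le> ennreal (C0 + 1 / \<tau>r) * interp SN f"
proof (cases "interp SN f < \<infinity>")
  case True
  then have sum: "f \<in> sum_space Y SN" by (auto simp: interp_def split: if_splits)
  then have Yf: "Y f < \<infinity>" by (simp add: sum_space_inhom_iff)
  have fm: "f \<in> borel_measurable M" by (rule space_norm_finite_measurable[OF Yf])
  have f: "f \<in> L1_plus_Linf M" by (rule norm_finite_imp_L1_plus_Linf[OF Yf])
  note [measurable] = measurable_E[OF fm]
  have ind [measurable]: "(\<lambda>s. indicator {0<..<1} s :: ennreal) \<in> borel_measurable half_line"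
    by (rule borel_half_lineI) measurable
  let ?T = "TN (\<lambda>t. ennreal (w t) * K_functional Y SN f t)"
  have T: "interp SN f = ?T" using sum by (simp add: interp_def)
  have wE: "ennreal (w t) * E f t \<le> ennreal C0 * (ennreal (w t) * K_functional Y SN f t)" if t: "0 < t" for t
  proof -
    have "E f t \<le> ennreal C0 * K_functional Y SN f t"
      by (rule order_trans[OF E_le_K[OF t fm] mult_left_mono[OF K_hom_le_K_inhom]]) simp
    then have "ennreal (w t) * E f t \<le> ennreal (w t) * (ennreal C0 * K_functional Y SN f t)"
      by (rule mult_left_mono) simp
    then show ?thesis by (simp only: mult.left_commute)
  qed
  have "TN (\<lambda>t. ennreal (w t) * E f t) \<le> ennreal C0 * ?T"
    by (rule tilde_norm_mono[OF measurable_wE[OF fm] _ C0_pos], rule AE_I2, rule wE) simp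
  also have "\<dots> < \<infinity>" using True T by (simp add: ennreal_mult_less_top)
  finally have hb: "f \<in> fspace hom_besov" using f by (simp add: fspace_def hom_besov_def)
  have G: "TN (\<lambda>t. indicator {0<..<1} t * (ennreal (w t) * E f t)) \<le> ennreal C0 * ?T"
  proof (rule tilde_norm_mono[OF _ _ C0_pos])
    show "(\<lambda>t. indicator {0<..<1} t * (ennreal (w t) * E f t)) \<in> borel_measurable half_line" by measurable
    have "indicator {0<..<1} t * (ennreal (w t) * E f t) \<le> ennreal C0 * (ennreal (w t) * K_functional Y SN f t)"
      if "0 < t" for t
      using wE[OF that] by (simp add: indicator_def)
    then show "AE t in half_line. indicator {0<..<1} t * (ennreal (w t) * E f t) \<le> ennreal C0 * (ennreal (w t) * K_functional Y SN f t)"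
      by (intro AE_I2) simp
  qed
  \<comment> \<open>K(f,t) \<ge> min(1,t) K(f,1) gives K(f,1) \<tau> \<le> T after taking weighted
    norms. The case K(f,1) = 0 is apart because the comparison divides by it.\<close>
  have "Y f \<le> ennreal (1 / \<tau>r) * ?T"
  proof -
    let ?k = "K_functional Y SN f 1"
    obtain k where k: "?k = ennreal k" "0 \<le> k"
      using K_functional_finite[OF sum, of 1] by (cases ?k) auto
    have "ennreal k * \<tau> \<le> ?T"
    proof (cases "k = 0")
      case False
      with k have k0: "0 < k" by simp
      have "\<tau> \<le> ennreal (1 / k) * ?T"
        unfolding \<tau>_def
      proof (rule tilde_norm_mono)
        have "ennreal (min 1 t * w t) \<le> ennreal (1 / k) * (ennreal (w t) * K_functional Y SN f t)" if t: "0 < t" for t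
        proof -
          have "ennreal (min 1 t * w t) = ennreal (1 / k) * (ennreal (w t) * (ennreal (min 1 t) * ennreal k))"
            using k0 w_pos[OF t] t by (simp add: ennreal_mult[symmetric] mult.commute)
          also have "\<dots> \<le> ennreal (1 / k) * (ennreal (w t) * K_functional Y SN f t)"
            using K_functional_min_1[OF t, of Y SN f] by (intro mult_left_mono) (auto simp: k)
          finally show ?thesis .
        qed
        then show "AE t in half_line. ennreal (min 1 t * w t) \<le> ennreal (1 / k) * (ennreal (w t) * K_functional Y SN f t)"
          by (intro AE_I2) simp
      qed (use k0 in auto)
      then have "ennreal k * \<tau> \<le> ennreal k * (ennreal (1 / k) * ?T)" by (rule mult_left_mono) simp
      also have "\<dots> = ?T" using k0 by (simp add: mult.assoc[symmetric] ennreal_mult[symmetric])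
      finally show ?thesis .
    qed simp
    then have "ennreal (1 / \<tau>r) * (ennreal k * ennreal \<tau>r) \<le> ennreal (1 / \<tau>r) * ?T"
      unfolding \<tau>r(1) by (rule mult_left_mono) simp
    moreover have "ennreal (1 / \<tau>r) * (ennreal k * ennreal \<tau>r) = ?k"
      using \<tau>r(2) k by (simp add: ennreal_mult[symmetric])
    ultimately show ?thesis using norm_le_K_inhom[of f] by (simp only: order_trans)
  qed
  with G have "TN (\<lambda>t. indicator {0<..<1} t * (ennreal (w t) * E f t)) + Y f \<le> ennreal C0 * ?T + ennreal (1 / \<tau>r) * ?T"
    by (rule add_mono)
  also have "\<dots> = ennreal (C0 + 1 / \<tau>r) * ?T" using C0_pos \<tau>r(2) by (simp add: distrib_right)
  finally show ?thesis using hb Yf by (simp add: inhom_besov_def fspace_def T)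
next
  case False
  then show ?thesis using C0_pos \<tau>r(2) by (simp add: not_less top_unique ennreal_mult_top add_pos_pos)
qed

lemma inhom_besov_equiv: "same_space_equiv_norms inhom_besov (interp SN)"
  by (rule same_space_equiv_normsI[OF C4_pos _ inhom_besov_le interp_inhom_le])
     (use C0_pos \<tau>r(2) in \<open>simp add: add_pos_pos\<close>)

end

text \<open>The upper growth bound at \<lambda> = 2; the maximum with 1 keeps powers of D
  increasing. A ball of non-positive radius is empty, so finiteness holds for all radii.\<close>

lemma RD_space_doubling:
  assumes "RD_space M"
  obtains D where "doubling_space M D"
proof -
  obtain k n where "RD_space_indices M k n" using assms by (auto simp: RD_space_def)
  then have mms: "metric_measure_space M"
    and "\<exists>C1 C2::real. 0 < C1 \<and> C1 \<le> 1 \<and> 1 \<le> C2 \<and>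
        (\<forall>x. \<forall>r>0. \<forall>l\<ge>1.
           ennreal (C1 * l powr k) * emeasure M (ball x r) \<le> emeasure M (ball x (l * r)) \<and>
           emeasure M (ball x (l * r)) \<le> ennreal (C2 * l powr n) * emeasure M (ball x r))"
    by (simp_all add: RD_space_indices_def)
  then obtain C2 :: real where C2: "\<And>x r. r > 0 \<Longrightarrow>
      emeasure M (ball x (2 * r)) \<le> ennreal (C2 * 2 powr n) * emeasure M (ball x r)"
    by (metis one_le_numeral)
  define D where "D = max 1 (C2 * 2 powr n)"
  have "doubling_space M D"
  proof
    show "space M = UNIV" "sets borel \<subseteq> sets M" "emeasure M {x} = 0" for x
      using mms by (auto simp: metric_measure_space_def)
    show "0 < emeasure M (ball x r)" if "0 < r" for x r
      using mms that by (simp add: metric_measure_space_def)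
    show "emeasure M (ball x r) < \<infinity>" for x r
    proof (cases "0 < r")
      case True
      then show ?thesis using mms by (simp add: metric_measure_space_def)
    next
      case False
      then have "ball x r = {}" by simp
      then show ?thesis by (simp only: emeasure_empty) simp
    qed
    show "1 \<le> D" by (simp add: D_def)
    show "emeasure M (ball x (2 * r)) \<le> ennreal D * emeasure M (ball x r)" if "0 < r" for x r
      by (rule order_trans[OF C2[OF that]]) (auto simp: D_def intro: mult_right_mono ennreal_leI)
  qed
  then show thesis by (rule that)
qed

theorem corollary14:
  fixes M :: "'a::metric_space measure"
    and X :: "('a \<Rightarrow> ennreal) \<Rightarrow> ennreal"
    and E :: "(real \<Rightarrow> ennreal) \<Rightarrow> ennreal"
    and F :: "real fnorm \<Rightarrow> real fnorm \<Rightarrow> real fnorm"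
    and b :: "real \<Rightarrow> real"
    and p \<theta> :: real
  assumes "RD_space M"
    and "ri_space M X"
    and "1 \<le> p"
    and "0 < \<theta>" and "\<theta> < 1"
    and "interpolation_parameter F E"
    and "slowly_varying b"
  shows "same_space_equiv_norms
           (hom_besov_norm M (convexification p X) F \<theta> b)
           (interp_norm (space_norm M (convexification p X))
              (hom_sobolev_norm M (convexification p X)) \<theta> b F) \<and>
         same_space_equiv_norms
           (besov_norm M (convexification p X) F \<theta> b)
           (interp_norm (space_norm M (convexification p X))
              (sobolev_norm M (convexification p X)) \<theta> b F)"
proof -
  obtain D where D: "doubling_space M D" using RD_space_doubling[OF assms(1)] .
  let ?\<rho> = "convexification p X"
  have ri: "ri_space M ?\<rho>" by (rule ri_space_convexification[OF assms(2,3)])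
  obtain C3 where w: "weight (\<lambda>t. t powr (- \<theta>) * b t) ((1 - \<theta>) / 2) C3"
    using slowly_varying_weight[OF assms(7,4,5)] .
  have F: "exact_interpolation_functor F" using assms(6) by (simp add: interpolation_parameter_def)
  interpret B: besov_interpolation M D ?\<rho> F "\<lambda>t. t powr (- \<theta>) * b t" "(1 - \<theta>) / 2" C3
    unfolding besov_interpolation_def doubling_ri_space_def doubling_ri_space_axioms_def functor_norm_def
    using D ri w F by blast
  have 1: "hom_besov_norm M ?\<rho> F \<theta> b = B.hom_besov"
    by (rule ext) (simp add: hom_besov_norm_def B.hom_besov_def)
  \<comment> \<open>Left general in the second norm, so that one identity serves both
    couples.\<close>
  have 2: "interp_norm (space_norm M ?\<rho>) N1 \<theta> b F = B.interp N1" for N1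
    by (rule ext) (simp add: interp_norm_def B.interp_def)
  have 3: "besov_norm M ?\<rho> F \<theta> b = B.inhom_besov"
    by (rule ext) (simp add: besov_norm_def B.inhom_besov_def 1)
  show ?thesis
    unfolding 1 2 3 using B.hom_besov_equiv B.inhom_besov_equiv by blast
qed

end
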